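(* Let $0=t_0<t_1<\dots<t_m$, and let the process $S_t$, the basis functions $\psi_{nk}$, the coefficient vectors $\beta_n$ and their estimators $\hat\beta_n$ ($1\le n<m$) from the Longstaff–Schwartz algorithm with $N$ paths and basis functions indexed by $0,\dots,K$ be as in the context. Let $u$ equal $8$, $10$, $8$, $11$ when $S_t$ is the Meixner, standard Poisson, Gamma and Pascal process, respectively. Suppose that the payoff functions satisfy the growth constraint $$\mathbf{E}[h_n(S_{t_n})^4]\le\max_{1\le\nu<m}\left(\frac{t_{\nu+1}}{t_\nu}\right)^{2K}\ \max_{1\le\nu\le m,\ 0\le k\le K}\mathbf{E}[\psi_{\nu k}(S_{t_\nu})^4],\qquad 0\le n\le m.$$ Then there is a constant $c>0$, not depending on $N$ and $K$, such that $$\sup_{|\beta_{m-1}|=1}\mathbf{E}\big[|\beta_n-\hat\beta_n|^2\big]\le N^{-1}\,c^K\,K^{(m-n+1)uK},\qquad 1\le n<m .$$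
   Context: Processes (all Lévy processes started at $0$) and basis functions $\psi_{nk}$, $k=0,1,2,\dots$, $1\le n\le m$; $(t)_k=t(t+1)\cdots(t+k-1)$: - Meixner process $S_t=H_t$, parameter $0<\zeta<\pi$: $H_t$ has density $\frac{(2\sin\zeta)^{2t}}{2\pi\Gamma(2t)}e^{(2\zeta-\pi)x}|\Gamma(t+ix)|^2$ on $\mathbb{R}$; $\psi_{nk}(x)=P_k(x;t_n,\zeta)$, the Meixner–Pollaczek polynomials with generating function $\sum_{k\ge0}P_k(x;t,\zeta)z^k=(1-e^{i\zeta}z)^{-t+ix}(1-e^{-i\zeta}z)^{-t-ix}$. - Standard Poisson process $S_t=N_t$ (intensity $1$): $\psi_{nk}(x)=t_n^kC_k(x,t_n)$, with Charlier polynomials $\sum_{k\ge0}C_k(x,t)\frac{z^k}{k!}=e^z(1-z/t)^x$. - Gamma process $S_t=G_t$: $G_t$ has density $x^{t-1}e^{-x}/\Gamma(t)$ on $]0,\infty[$; $\psi_{nk}(x)=L_k^{(t_n-1)}(x)$, with Laguerre polynomials $\sum_{k\ge0}L_k^{(\alpha)}(x)z^k=(1-z)^{-\alpha-1}\exp\left(-\frac{xz}{1-z}\right)$. - Pascal process $S_t=P_t$, parameter $0<q<1$: $\mathbf{P}[P_t=x]=\frac{(t)_x}{x!}q^x(1-q)^t$, $x=0,1,2,\dots$; $\psi_{nk}(x)=(t_n)_kM_k(x;t_n,q)$, with Meixner polynomials $\sum_{k\ge0}\frac{(t)_k}{k!}M_k(x;t,q)z^k=(1-z/q)^x(1-z)^{-x-t}$.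 In all cases $\mathbf{E}[\psi_{n+1,k}(S_{t_{n+1}})\mid S_{t_n}]=\psi_{nk}(S_{t_n})$ for $1\le n<m$. Notation: $\psi_n=(\psi_{n0},\dots,\psi_{nK})^{\mathrm T}$, $\Psi_n=\mathbf{E}[\psi_n(S_{t_n})\psi_n(S_{t_n})^{\mathrm T}]$, $K\ge1$, $N\ge1$; $|\cdot|$ is the Euclidean norm. The payoff at date $t_n$ is $h_n(S_{t_n})$ ($h_n$ Borel measurable), the interest rate is zero. Final payoff: the exact representation $h_m(S_{t_m})=\beta_{m-1}^{\mathrm T}\psi_m(S_{t_m})$ is assumed for a vector $\beta_{m-1}\in\mathbb{R}^{K+1}$; so $h_m$ varies with $\beta_{m-1}$ in the supremum over $|\beta_{m-1}|=1$, and the growth constraint is assumed for the payoff functions in question. Exact coefficients: $V_m=h_m$ and, for $n=m-1,\dots,1$, $\beta_n=\Psi_n^{-1}\mathbf{E}[V_{n+1}(S_{t_{n+1}})\psi_n(S_{t_n})]$, $C_n=\beta_n^{\mathrm T}\psi_n$, $V_n=\max\{h_n,C_n\}$ (for $n=m-1$ this returns the vector $\beta_{m-1}$ above, by the martingale property). Estimated coefficients: $\hat V_m=h_m$. For $n=m-1,\dots,1$, generate a fresh set (independent of the earlier sets) of $N$ independent sample paths $(S^{(i)}_{t_1},\dots,S^{(i)}_{t_{n+1}})$, $1\le i\le N$, of the process and set $$\hat\gamma_n=\frac1N\sum_{i=1}^N\hat V_{n+1}\big(S^{(i)}_{t_{n+1}}\big)\psi_n\big(S^{(i)}_{t_n}\big),\quad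 \hat\beta_n=\Psi_n^{-1}\hat\gamma_n,\quad \hat C_n=\hat\beta_n^{\mathrm T}\psi_n,\quad \hat V_n=\max\{h_n,\hat C_n\}.$$ *)

theory Defs
  imports
    "HOL-Probability.Probability"
    "HOL-Computational_Algebra.Formal_Power_Series"
    "Jordan_Normal_Form.Gauss_Jordan_Elimination"
begin

section \<open>Levy processes\<close>

text \<open>Independent increments are required along every nondecreasing sequence
  \<open>0 \<le> s 0 \<le> \<dots> \<le> s k\<close>; the last conjunct is stochastic continuity.\<close>

definition levy_process :: "'a measure \<Rightarrow> (real \<Rightarrow> 'a \<Rightarrow> real) \<Rightarrow> bool" where
  "levy_process M S \<longleftrightarrow>
     prob_space M \<and>
     (\<forall>t\<ge>0. S t \<in> borel_measurable M) \<and>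
     (AE \<omega> in M. S 0 \<omega> = 0) \<and>
     (\<forall>(k::nat) (s::nat \<Rightarrow> real). 0 \<le> s 0 \<and> (\<forall>i<k. s i \<le> s (Suc i)) \<longrightarrow>
        prob_space.indep_vars M (\<lambda>_. borel) (\<lambda>i \<omega>. S (s (Suc i)) \<omega> - S (s i) \<omega>) {..<k}) \<and>
     (\<forall>s t. 0 \<le> s \<and> s \<le> t \<longrightarrow>
        distr M borel (\<lambda>\<omega>. S t \<omega> - S s \<omega>) = distr M borel (S (t - s))) \<and>
     (\<forall>s\<ge>0. \<forall>e>0.
        ((\<lambda>t. measure M {\<omega> \<in> space M. \<bar>S t \<omega> - S s \<omega>\<bar> > e}) \<longlongrightarrow> 0) (at s within {0..}))"

datatype levy_model =
    MeixnerModel real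
  | PoissonModel
  | GammaModel
  | PascalModel real

fun valid_model :: "levy_model \<Rightarrow> bool" where
  "valid_model (MeixnerModel \<zeta>) \<longleftrightarrow> 0 < \<zeta> \<and> \<zeta> < pi"
| "valid_model PoissonModel \<longleftrightarrow> True"
| "valid_model GammaModel \<longleftrightarrow> True"
| "valid_model (PascalModel q) \<longleftrightarrow> 0 < q \<and> q < 1"

text \<open>The law of the process at time \<open>t > 0\<close>, as a measure on the real line.\<close>

fun marginal_law :: "levy_model \<Rightarrow> real \<Rightarrow> real measure" where
  "marginal_law (MeixnerModel \<zeta>) t =
     density lborel (\<lambda>x. ennreal
       ((2 * sin \<zeta>) powr (2 * t) / (2 * pi * Gamma (2 * t)) *
        exp ((2 * \<zeta> - pi) * x) * (cmod (Gamma (Complex t x)))\<^sup>2))"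
| "marginal_law PoissonModel t = distr (measure_pmf (poisson_pmf t)) borel real"
| "marginal_law GammaModel t =
     density lborel (\<lambda>x. ennreal (if 0 < x then x powr (t - 1) * exp (- x) / Gamma t else 0))"
| "marginal_law (PascalModel q) t =
     distr (density (count_space UNIV)
              (\<lambda>x::nat. ennreal (pochhammer t x / fact x * q ^ x * (1 - q) powr t)))
       borel real"

definition model_process ::
    "levy_model \<Rightarrow> 'a measure \<Rightarrow> (real \<Rightarrow> 'a \<Rightarrow> real) \<Rightarrow> bool" where
  "model_process P M S \<longleftrightarrow>
     levy_process M S \<and> (\<forall>t>0. distr M borel (S t) = marginal_law P t)"


section \<open>Orthogonal polynomials\<close>

text \<open>The polynomials are read off as coefficients of their generating functions, taken as
  formal power series in \<open>z\<close>. A factor \<open>(1 - c z)\<^sup>a\<close> is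
  \<open>fps_binomial a oo (fps_const (- c) * fps_X)\<close>, where \<open>fps_binomial a\<close> is \<open>(1 + z)\<^sup>a\<close>.\<close>

definition fps_lin_pow :: "'a::field_char_0 \<Rightarrow> 'a \<Rightarrow> 'a fps" where
  "fps_lin_pow c a = fps_compose (fps_binomial a) (fps_const (- c) * fps_X)"

text \<open>For real \<open>x\<close>, \<open>t\<close> and \<open>\<zeta>\<close> the two factors below are complex conjugates, so that the
  coefficients of the product are real.\<close>

definition meixner_pollaczek :: "nat \<Rightarrow> real \<Rightarrow> real \<Rightarrow> real \<Rightarrow> real" where
  "meixner_pollaczek k x t \<zeta> =
     Re (fps_nth (fps_lin_pow (exp (\<i> * of_real \<zeta>)) (- of_real t + \<i> * of_real x) *
                  fps_lin_pow (exp (- (\<i> * of_real \<zeta>))) (- of_real t - \<i> * of_real x)) k)"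

definition charlier :: "nat \<Rightarrow> real \<Rightarrow> real \<Rightarrow> real" where
  "charlier k x t = fact k * fps_nth (fps_exp 1 * fps_lin_pow (1 / t) x) k"

definition laguerre :: "nat \<Rightarrow> real \<Rightarrow> real \<Rightarrow> real" where
  "laguerre k \<alpha> x =
     fps_nth (fps_lin_pow 1 (- \<alpha> - 1) *
              fps_compose (fps_exp 1) (- fps_const x * fps_X * inverse (1 - fps_X))) k"

definition meixner :: "nat \<Rightarrow> real \<Rightarrow> real \<Rightarrow> real \<Rightarrow> real" where
  "meixner k x t q =
     fact k / pochhammer t k * fps_nth (fps_lin_pow (1 / q) x * fps_lin_pow 1 (- x - t)) k"

text \<open>\<open>basis_fun P t k\<close> is the \<open>k\<close>-th basis function at an exercise date \<open>t > 0\<close>.\<close>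

fun basis_fun :: "levy_model \<Rightarrow> real \<Rightarrow> nat \<Rightarrow> real \<Rightarrow> real" where
  "basis_fun (MeixnerModel \<zeta>) t k x = meixner_pollaczek k x t \<zeta>"
| "basis_fun PoissonModel t k x = t ^ k * charlier k x t"
| "basis_fun GammaModel t k x = laguerre k (t - 1) x"
| "basis_fun (PascalModel q) t k x = pochhammer t k * meixner k x t q"

fun growth_exponent :: "levy_model \<Rightarrow> nat" where
  "growth_exponent (MeixnerModel \<zeta>) = 8"
| "growth_exponent PoissonModel = 10"
| "growth_exponent GammaModel = 8"
| "growth_exponent (PascalModel q) = 11"


section \<open>The Longstaff--Schwartz algorithm\<close>

definition euclid_norm :: "real vec \<Rightarrow> real" where
  "euclid_norm v = L2_set (\<lambda>k. vec_index v k) {..<dim_vec v}"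

definition basis_vec :: "levy_model \<Rightarrow> nat \<Rightarrow> real \<Rightarrow> real \<Rightarrow> real vec" where
  "basis_vec P K t x = vec (Suc K) (\<lambda>k. basis_fun P t k x)"

definition gram_mat ::
    "levy_model \<Rightarrow> 'a measure \<Rightarrow> (real \<Rightarrow> 'a \<Rightarrow> real) \<Rightarrow> nat \<Rightarrow> real \<Rightarrow> real mat" where
  "gram_mat P M S K t =
     mat (Suc K) (Suc K) (\<lambda>(j, k). \<integral>\<omega>. basis_fun P t j (S t \<omega>) * basis_fun P t k (S t \<omega>) \<partial>M)"

definition gram_inv ::
    "levy_model \<Rightarrow> 'a measure \<Rightarrow> (real \<Rightarrow> 'a \<Rightarrow> real) \<Rightarrow> nat \<Rightarrow> real \<Rightarrow> real mat" where
  "gram_inv P M S K t = the (mat_inverse (gram_mat P M S K t))"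

text \<open>Backward induction, for a given regression operator \<open>reg\<close> that sends a date \<open>n\<close> and the
  value function at date \<open>n + 1\<close> to the coefficient vector of the continuation value at date
  \<open>n\<close>. Exact and estimated values differ only in this operator. The payoff at date \<open>n\<close> is
  \<open>h n\<close> and \<open>\<psi> n\<close> is the vector of basis functions.\<close>

function ls_value ::
    "(nat \<Rightarrow> (real \<Rightarrow> real) \<Rightarrow> real vec) \<Rightarrow> (nat \<Rightarrow> real \<Rightarrow> real vec) \<Rightarrow> (nat \<Rightarrow> real \<Rightarrow> real)
      \<Rightarrow> nat \<Rightarrow> nat \<Rightarrow> real \<Rightarrow> real" where
  "ls_value reg \<psi> h m n =
     (if n < m
      then (\<lambda>x. max (h n x) (scalar_prod (reg n (ls_value reg \<psi> h m (Suc n))) (\<psi> n x)))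
      else h n)"
  by pat_completeness auto
termination
  by (relation "Wellfounded.measure (\<lambda>(reg, \<psi>, h, m, n). m - n)") auto

declare ls_value.simps [simp del]

definition exact_regression ::
    "levy_model \<Rightarrow> 'a measure \<Rightarrow> (real \<Rightarrow> 'a \<Rightarrow> real) \<Rightarrow> (nat \<Rightarrow> real) \<Rightarrow> nat
      \<Rightarrow> nat \<Rightarrow> (real \<Rightarrow> real) \<Rightarrow> real vec" where
  "exact_regression P M S t K n V =
     mult_mat_vec (gram_inv P M S K (t n))
       (vec (Suc K) (\<lambda>k. \<integral>\<omega>. V (S (t (Suc n)) \<omega>) * basis_fun P (t n) k (S (t n) \<omega>) \<partial>M))"

text \<open>\<open>X n i j \<omega>\<close> is the value at date \<open>t j\<close> of the \<open>i\<close>-th path of the set generated for step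
  \<open>n\<close>. The matrix is the exact one; only the expectation is replaced by a sample mean.\<close>

definition estimated_regression ::
    "levy_model \<Rightarrow> 'a measure \<Rightarrow> (real \<Rightarrow> 'a \<Rightarrow> real) \<Rightarrow> (nat \<Rightarrow> real) \<Rightarrow> nat
      \<Rightarrow> nat \<Rightarrow> (nat \<Rightarrow> nat \<Rightarrow> nat \<Rightarrow> 'b \<Rightarrow> real) \<Rightarrow> 'b
      \<Rightarrow> nat \<Rightarrow> (real \<Rightarrow> real) \<Rightarrow> real vec" where
  "estimated_regression P M S t K N X \<omega> n V =
     mult_mat_vec (gram_inv P M S K (t n))
       (vec (Suc K) (\<lambda>k. (1 / real N) *
          (\<Sum>i\<in>{1..N}. V (X n i (Suc n) \<omega>) * basis_fun P (t n) k (X n i n \<omega>))))"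

definition exact_coeff ::
    "levy_model \<Rightarrow> 'a measure \<Rightarrow> (real \<Rightarrow> 'a \<Rightarrow> real) \<Rightarrow> (nat \<Rightarrow> real) \<Rightarrow> nat \<Rightarrow> nat
      \<Rightarrow> (nat \<Rightarrow> real \<Rightarrow> real) \<Rightarrow> nat \<Rightarrow> real vec" where
  "exact_coeff P M S t m K h n =
     (let reg = exact_regression P M S t K
      in reg n (ls_value reg (\<lambda>n. basis_vec P K (t n)) h m (Suc n)))"

definition estimated_coeff ::
    "levy_model \<Rightarrow> 'a measure \<Rightarrow> (real \<Rightarrow> 'a \<Rightarrow> real) \<Rightarrow> (nat \<Rightarrow> real) \<Rightarrow> nat \<Rightarrow> nat
      \<Rightarrow> nat \<Rightarrow> (nat \<Rightarrow> nat \<Rightarrow> nat \<Rightarrow> 'b \<Rightarrow> real) \<Rightarrow> 'b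
      \<Rightarrow> (nat \<Rightarrow> real \<Rightarrow> real) \<Rightarrow> nat \<Rightarrow> real vec" where
  "estimated_coeff P M S t m K N X \<omega> h n =
     (let reg = estimated_regression P M S t K N X \<omega>
      in reg n (ls_value reg (\<lambda>n. basis_vec P K (t n)) h m (Suc n)))"

text \<open>All paths, within a set and across the sets for different steps \<open>n\<close>, are independent, and
  each path of set \<open>n\<close> has the joint law of \<open>(S (t 1), \<dots>, S (t (n + 1)))\<close>.\<close>

definition sample_paths ::
    "'a measure \<Rightarrow> (real \<Rightarrow> 'a \<Rightarrow> real) \<Rightarrow> (nat \<Rightarrow> real) \<Rightarrow> nat \<Rightarrow> nat
      \<Rightarrow> 'b measure \<Rightarrow> (nat \<Rightarrow> nat \<Rightarrow> nat \<Rightarrow> 'b \<Rightarrow> real) \<Rightarrow> bool" where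
  "sample_paths M S t m N Q X \<longleftrightarrow>
     prob_space Q \<and>
     prob_space.indep_vars Q (\<lambda>(n, i). PiM {1..Suc n} (\<lambda>_. borel))
       (\<lambda>(n, i) \<omega>. \<lambda>j\<in>{1..Suc n}. X n i j \<omega>) ({1..<m} \<times> {1..N}) \<and>
     (\<forall>n\<in>{1..<m}. \<forall>i\<in>{1..N}.
        distr Q (PiM {1..Suc n} (\<lambda>_. borel)) (\<lambda>\<omega>. \<lambda>j\<in>{1..Suc n}. X n i j \<omega>) =
        distr M (PiM {1..Suc n} (\<lambda>_. borel)) (\<lambda>\<omega>. \<lambda>j\<in>{1..Suc n}. S (t j) \<omega>))"

text \<open>Fourth moments are nonnegative integrals, so that an infinite moment counts as
  \<open>\<infinity>\<close>.\<close>

definition fourth_moment ::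
    "'a measure \<Rightarrow> ('a \<Rightarrow> real) \<Rightarrow> ennreal" where
  "fourth_moment M f = (\<integral>\<^sup>+\<omega>. ennreal (f \<omega> ^ 4) \<partial>M)"

definition growth_bound ::
    "levy_model \<Rightarrow> 'a measure \<Rightarrow> (real \<Rightarrow> 'a \<Rightarrow> real) \<Rightarrow> (nat \<Rightarrow> real) \<Rightarrow> nat \<Rightarrow> nat \<Rightarrow> ennreal" where
  "growth_bound P M S t m K =
     ennreal (Max ((\<lambda>\<nu>. (t (Suc \<nu>) / t \<nu>) ^ (2 * K)) ` {1..<m})) *
     Max ((\<lambda>(\<nu>, k). fourth_moment M (\<lambda>\<omega>. basis_fun P (t \<nu>) k (S (t \<nu>) \<omega>))) ` ({1..m} \<times> {0..K}))"

definition growth_constraint ::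
    "levy_model \<Rightarrow> 'a measure \<Rightarrow> (real \<Rightarrow> 'a \<Rightarrow> real) \<Rightarrow> (nat \<Rightarrow> real) \<Rightarrow> nat \<Rightarrow> nat
      \<Rightarrow> (nat \<Rightarrow> real \<Rightarrow> real) \<Rightarrow> nat \<Rightarrow> bool" where
  "growth_constraint P M S t m K h n \<longleftrightarrow>
     fourth_moment M (\<lambda>\<omega>. h n (S (t n) \<omega>)) \<le> growth_bound P M S t m K"

text \<open>The payoffs with the one at date \<open>m\<close> replaced by \<open>\<beta>\<^sup>T \<psi>\<^sub>m\<close>.\<close>

definition with_final_payoff ::
    "levy_model \<Rightarrow> (nat \<Rightarrow> real) \<Rightarrow> nat \<Rightarrow> nat \<Rightarrow> (nat \<Rightarrow> real \<Rightarrow> real) \<Rightarrow> real vec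
      \<Rightarrow> nat \<Rightarrow> real \<Rightarrow> real" where
  "with_final_payoff P t m K h \<beta> = h(m := \<lambda>x. scalar_prod \<beta> (basis_vec P K (t m) x))"

end

theory Submission
  imports Defs "Jordan_Normal_Form.Determinant"
begin

text \<open>
  The estimation error obeys a backward recursion. Given the sample sets of the later steps, the
  estimated value function at date \<open>n + 1\<close> is a fixed function, so \<open>\<gamma>\<close> at step \<open>n\<close> is a mean of
  \<open>N\<close> independent copies. Its error splits into a fluctuation, whose variance is of order \<open>1 / N\<close>,
  and a bias inherited from step \<open>n + 1\<close>; the latter is controlled because \<open>x \<mapsto> max h x\<close> is
  1-Lipschitz. Both parts are then amplified by the inverse Gram matrix. If \<open>\<Lambda>\<close> bounds the norm of
  the inverse Gram matrices and \<open>T\<close> bounds the fourth moments of the payoffs and of the norm of the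
  basis vector, the expected squared error is at most \<open>(20 \<Lambda>\<^sup>2 T)\<^bsup>m - n\<^esup> / N\<close>
  (\<open>err_rec\<close>, \<open>err_bound\<close>). It remains to see that \<open>\<Lambda>\<^sup>2 T\<close> is at most \<open>c\<^bsup>K\<^esup> K\<^bsup>u K\<^esup>\<close>.

  Both bounds come from one algebraic fact. All four generating functions have the form
  \<open>F(z) (\<Sum>j. e\<^sub>j(x) (z / (1 - b z))\<^bsup>j\<^esup>)\<close> with \<open>e\<^sub>j\<close> a multiple of a Newton polynomial
  \<open>(x - y\<^sub>0) \<dots> (x - y\<^bsub>j - 1\<^esub>) / j!\<close>. Comparing coefficients, the basis functions arise from the
  \<open>e\<^sub>j\<close> by a diagonally rescaled binomial matrix (locale \<open>newton_basis\<close>), and the inverse of that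
  matrix is again explicit.

  The fourth moments follow from this and an exponential moment of the law (\<open>fourth_moment_le\<close>).
  For the Gamma and Meixner laws the latter is read off from the normalising constants: multiplying
  the density at \<open>t\<close> by a suitable polynomial of degree \<open>k\<close> (Gamma) or \<open>2 k\<close> (Meixner) gives a
  multiple of the density at \<open>t + k\<close>, whose integral is 1.

  The bound for the inverse Gram matrix says that the coefficients of \<open>p = (\<Sum>k\<le>K. a\<^sub>k \<psi>\<^sub>k)\<close> are
  controlled by \<open>E p(S)\<^sup>2\<close>. A law that charges \<open>K + 1\<close> well separated sets yields a point in each of
  them at which \<open>p\<close> is controlled. Interpolation at these points bounds the Newton coefficients, and
  binomial inversion bounds the \<open>a\<^sub>k\<close> (\<open>coeff_sq_sum_le\<close>). Each coefficient costs a factor \<open>K\<^bsup>K\<^esup>\<close>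
  for \<open>j!\<close>, and the sampling costs \<open>K\<^bsup>K\<^esup>\<close> for a law with a density, where the points are only
  \<open>1 / K\<close> apart, and at most \<open>K\<^bsup>K / 2\<^esup>\<close> for an atomic law, where the atoms \<open>0, \<dots>, K\<close> have mass at
  least \<open>K\<^bsup>-K\<^esup>\<close>, in each case up to a geometric factor. The basis functions of the Poisson and
  Pascal processes carry a factor \<open>k!\<close>, which contributes \<open>K\<^bsup>4 K\<^esup>\<close> to \<open>T\<close>. In \<open>\<Lambda>\<^sup>2 T\<close> this adds up to
  the exponents 8 for the Meixner and Gamma processes and 10 for the Poisson and Pascal processes
  (\<open>growth_exponent_ge\<close>).
\<close>

section \<open>Coefficients of the generating functions\<close>

unbundle fps_syntax
no_notation vec_index (infixl "$" 100)
no_notation vec_nth (infixl "$" 90)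

lemma fps_lin_pow_nth: "fps_nth (fps_lin_pow c a) k = (a gchoose k) * (- c) ^ k"
  unfolding fps_lin_pow_def fps_compose_linear by simp

lemma fps_lin_pow_neg_nth:
  "fps_nth (fps_lin_pow c (- a)) k = c ^ k * pochhammer a k / fact k"
  unfolding fps_lin_pow_nth gbinomial_pochhammer power_minus[of c] by simp

lemma fps_lin_pow_add: "fps_lin_pow c (a + b) = fps_lin_pow c a * fps_lin_pow c b"
  unfolding fps_lin_pow_def fps_binomial_add_mult by (rule fps_compose_mult_distrib) simp

lemma fps_lin_pow_minus_one: "fps_lin_pow c (- 1) = inverse (1 - fps_const c * fps_X)"
proof -
  have "fps_lin_pow c 1 = 1 - fps_const c * fps_X"
    by (simp add: fps_lin_pow_def fps_binomial_1 fps_compose_add_distrib fps_const_neg[symmetric]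
        del: fps_const_neg)
  moreover have "fps_lin_pow c (- 1) * fps_lin_pow c 1 = 1"
    by (subst fps_lin_pow_add[symmetric]) (simp add: fps_lin_pow_def)
  ultimately show ?thesis
    by (metis fps_inverse_unique mult.commute)
qed

text \<open>\<open>(1 - c z)\<^bsup>a\<^esup>\<close> is the normalised solution of a linear differential equation. This holds for
  every exponent \<open>a\<close>, also a complex one, so identities between such powers follow from uniqueness.\<close>
lemma fps_lin_pow_ODE:
  "(1 - fps_const c * fps_X) * fps_deriv (fps_lin_pow c a) = fps_const (- a * c) * fps_lin_pow c a"
proof (rule fps_ext)
  fix n
  have "((1 - fps_const c * fps_X) * fps_deriv (fps_lin_pow c a)) $ n =
     of_nat (n + 1) * ((a gchoose Suc n) * (- c) ^ Suc n)
       - c * (of_nat n * ((a gchoose n) * (- c) ^ n))"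
    by (cases n) (simp_all add: algebra_simps fps_lin_pow_nth mult.assoc)
  also have "of_nat (n + 1) * (a gchoose Suc n) = (a - of_nat n) * (a gchoose n)"
    using gbinomial_mult_1[of a n] by (simp add: algebra_simps)
  hence "of_nat (n + 1) * ((a gchoose Suc n) * (- c) ^ Suc n)
       = (a - of_nat n) * (a gchoose n) * (- c) ^ Suc n"
    by (simp add: mult.assoc[symmetric])
  finally show "((1 - fps_const c * fps_X) * fps_deriv (fps_lin_pow c a)) $ n =
    (fps_const (- a * c) * fps_lin_pow c a) $ n"
    by (simp add: fps_lin_pow_nth algebra_simps)
qed

lemma fps_lin_pow_unique:
  assumes ode: "(1 - fps_const c * fps_X) * fps_deriv F = fps_const (- a * c) * F"
    and F0: "fps_nth F 0 = 1"
  shows "F = fps_lin_pow c a"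
proof -
  have rec: "of_nat (Suc n) * G $ Suc n = (of_nat n * c - a * c) * G $ n"
    if "(1 - fps_const c * fps_X) * fps_deriv G = fps_const (- a * c) * G" for G n
  proof -
    have "((1 - fps_const c * fps_X) * fps_deriv G) $ n = (fps_const (- a * c) * G) $ n"
      using that by simp
    moreover have "((1 - fps_const c * fps_X) * fps_deriv G) $ n =
        of_nat (Suc n) * G $ Suc n - c * (of_nat n * G $ n)"
      by (cases n) (simp_all add: algebra_simps mult.assoc)
    ultimately show ?thesis by (simp add: algebra_simps)
  qed
  have "F $ n = fps_lin_pow c a $ n" for n
  proof (induction n)
    case 0
    show ?case by (simp add: F0 fps_lin_pow_nth)
  next
    case (Suc n)
    have "of_nat (Suc n) * F $ Suc n = of_nat (Suc n) * fps_lin_pow c a $ Suc n"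
      using rec[OF ode, of n] rec[OF fps_lin_pow_ODE, of n] Suc by simp
    thus ?case by (simp del: of_nat_Suc)
  qed
  thus ?thesis by (simp add: fps_eq_iff)
qed

text \<open>The identity \<open>1 - c1 z = (1 - c2 z) (1 + (c2 - c1) z / (1 - c2 z))\<close>, raised to the power \<open>a\<close>.
  Both sides solve the same differential equation.\<close>
lemma fps_lin_pow_change_base:
  fixes c1 c2 a :: "'a::field_char_0"
  defines "g \<equiv> fps_const (c2 - c1) * fps_X * inverse (1 - fps_const c2 * fps_X)"
  shows "fps_lin_pow c1 a = fps_lin_pow c2 a * (fps_binomial a oo g)"
proof (rule fps_lin_pow_unique[symmetric])
  define u where "u = inverse (1 - fps_const c2 * fps_X)"
  define v where "v = 1 - fps_const c2 * fps_X"
  define A where "A = fps_lin_pow c2 a"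
  define B where "B = fps_binomial a oo g"
  \<comment> \<open>\<open>u\<close> and \<open>v\<close> are mutually inverse; every derivative below is expressed through \<open>u\<close>.\<close>
  have uv: "u * v = 1"
    unfolding u_def v_def by (rule inverse_mult_eq_1) simp
  have g: "g = fps_const (c2 - c1) * fps_X * u"
    by (simp add: g_def u_def)
  have g0: "g $ 0 = 0"
    by (simp add: g)
  have dv: "fps_deriv v = - fps_const c2"
    by (simp add: v_def)
  have "fps_deriv (u * v) = 0"
    by (simp add: uv)
  hence "v * fps_deriv u = u * fps_const c2"
    by (simp add: dv fps_const_neg[symmetric] algebra_simps eq_neg_iff_add_eq_0 del: fps_const_neg)
  hence "u * v * fps_deriv u = u * u * fps_const c2"
    by (simp add: mult.assoc)
  hence du: "fps_deriv u = fps_const c2 * u * u"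
    by (simp add: uv mult_ac)
  have Xu: "fps_const c2 * fps_X * u = u - 1"
    using uv by (simp add: v_def algebra_simps)
  have dg: "fps_deriv g = fps_const (c2 - c1) * u * u"
  proof -
    have "fps_deriv g = fps_const (c2 - c1) * (u + fps_const c2 * fps_X * u * u)"
      by (simp add: g du algebra_simps)
    also have "fps_const c2 * fps_X * u * u = (u - 1) * u"
      by (simp only: Xu)
    finally show ?thesis by (simp add: algebra_simps)
  qed
  have g1: "1 + g = (1 - fps_const c1 * fps_X) * u"
    using Xu by (simp add: g fps_const_sub[symmetric] algebra_simps del: fps_const_sub)
  have dB: "(1 + g) * fps_deriv B = fps_const a * B * fps_deriv g"
  proof -
    have "fps_deriv (fps_binomial a) * (1 + fps_X) = fps_const a * fps_binomial a"
      by (simp add: fps_binomial_deriv)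
    hence "(fps_deriv (fps_binomial a) * (1 + fps_X)) oo g = (fps_const a * fps_binomial a) oo g"
      by simp
    hence "(fps_deriv (fps_binomial a) oo g) * (1 + g) = fps_const a * B"
      by (simp add: fps_compose_mult_distrib[OF g0] fps_compose_add_distrib B_def
          fps_X_fps_compose_startby0[OF g0])
    thus ?thesis
      by (simp add: B_def fps_compose_deriv[OF g0] mult_ac)
  qed
  have dA: "v * fps_deriv A = fps_const (- a * c2) * A"
    using fps_lin_pow_ODE by (simp add: A_def v_def)
  have "u * ((1 - fps_const c1 * fps_X) * fps_deriv B) = u * (fps_const (a * (c2 - c1)) * u * B)"
    using dB by (simp add: g1 dg mult_ac fps_const_mult[symmetric] del: fps_const_mult)
  hence dB': "(1 - fps_const c1 * fps_X) * fps_deriv B = fps_const (a * (c2 - c1)) * u * B"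
    using uv by (metis mult_cancel_left mult_zero_left zero_neq_one)
  have dA': "fps_deriv A = fps_const (- a * c2) * u * A"
  proof -
    have "u * (v * fps_deriv A) = u * (fps_const (- a * c2) * A)"
      by (simp only: dA)
    hence "(u * v) * fps_deriv A = fps_const (- a * c2) * u * A"
      by (simp only: mult_ac)
    thus ?thesis unfolding uv by simp
  qed
  have cc: "fps_const (- a * c2) * (1 - fps_const c1 * fps_X) + fps_const (a * (c2 - c1))
     = fps_const (- a * c1) * v"
    by (simp add: v_def algebra_simps fps_const_mult[symmetric] fps_const_sub[symmetric]
         fps_const_neg[symmetric] del: fps_const_mult fps_const_neg fps_const_sub)
  have "(1 - fps_const c1 * fps_X) * fps_deriv (A * B) =
    (1 - fps_const c1 * fps_X) * fps_deriv A * B + A * ((1 - fps_const c1 * fps_X) * fps_deriv B)"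
    by (simp add: algebra_simps)
  also have "\<dots> = (fps_const (- a * c2) * (1 - fps_const c1 * fps_X) + fps_const (a * (c2 - c1)))
      * u * (A * B)"
    unfolding dA' dB' by (simp only: ring_distribs mult_ac)
  also have "\<dots> = fps_const (- a * c1) * (u * v) * (A * B)"
    unfolding cc by (simp only: mult_ac)
  finally show "(1 - fps_const c1 * fps_X) * fps_deriv (fps_lin_pow c2 a * (fps_binomial a oo g)) =
     fps_const (- a * c1) * (fps_lin_pow c2 a * (fps_binomial a oo g))"
    by (simp add: uv A_def B_def)
qed (simp add: fps_lin_pow_nth)

lemma fps_mult_compose_nth:
  fixes A B g :: "'a::field_char_0 fps"
  assumes g0: "fps_nth g 0 = 0"
  shows "fps_nth (A * (B oo g)) k = (\<Sum>j\<le>k. B $ j * (A * g ^ j) $ k)"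
proof -
  have gz: "(g ^ j) $ i = 0" if "i < j" for i j
    using startsby_zero_power_prefix[OF g0] that by auto
  have comp: "(B oo g) $ i = (\<Sum>j\<le>k. B $ j * (g ^ j) $ i)" if "i \<le> k" for i
    unfolding fps_compose_nth
    using that gz by (intro sum.mono_neutral_left) auto
  have "fps_nth (A * (B oo g)) k = (\<Sum>i=0..k. A $ i * (B oo g) $ (k - i))"
    by (simp add: fps_mult_nth)
  also have "\<dots> = (\<Sum>i=0..k. \<Sum>j\<le>k. B $ j * (A $ i * (g ^ j) $ (k - i)))"
    by (simp add: comp sum_distrib_left mult_ac)
  also have "\<dots> = (\<Sum>j\<le>k. B $ j * (A * g ^ j) $ k)"
    by (subst sum.swap) (simp add: fps_mult_nth sum_distrib_left)
  finally show ?thesis .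
qed

text \<open>The coefficients of \<open>(1 - c z)\<^bsup>-\<tau>\<^esup> B(d z / (1 - c z))\<close>: the powers of \<open>1 / (1 - c z)\<close> are
  absorbed into the prefactor. The generating functions of the Laguerre, Meixner and
  Meixner--Pollaczek polynomials are of this form.\<close>
lemma fps_lin_pow_mult_compose_nth:
  fixes c d \<tau> :: "'a::field_char_0"
  shows "fps_nth (fps_lin_pow c (- \<tau>) *
           (B oo (fps_const d * fps_X * inverse (1 - fps_const c * fps_X)))) k =
     (\<Sum>j\<le>k. c ^ (k - j) * pochhammer (\<tau> + of_nat j) (k - j) / fact (k - j) * (B $ j * d ^ j))"
proof -
  let ?u = "inverse (1 - fps_const c * fps_X)"
  have pw: "?u ^ j = fps_lin_pow c (- of_nat j)" for j
    by (induction j) (simp_all add: fps_lin_pow_def[of c 0] fps_lin_pow_minus_one[symmetric]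
        fps_lin_pow_add[symmetric])
  have nth: "(fps_lin_pow c (- \<tau>) * (fps_const d * fps_X * ?u) ^ j) $ k =
     d ^ j * (c ^ (k - j) * pochhammer (\<tau> + of_nat j) (k - j) / fact (k - j))" if "j \<le> k" for j
  proof -
    have neg: "- (\<tau> + of_nat j) = - \<tau> + - of_nat j"
      by simp
    have "fps_lin_pow c (- \<tau>) * (fps_const d * fps_X * ?u) ^ j =
       fps_const (d ^ j) * (fps_X ^ j * fps_lin_pow c (- (\<tau> + of_nat j)))"
      unfolding neg fps_lin_pow_add power_mult_distrib pw by (simp add: mult_ac)
    thus ?thesis using that
      by (simp only: fps_mult_left_const_nth fps_X_power_mult_nth fps_lin_pow_neg_nth) simp
  qed
  have "(fps_lin_pow c (- \<tau>) * (B oo (fps_const d * fps_X * ?u))) $ k =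
      (\<Sum>j\<le>k. B $ j * (fps_lin_pow c (- \<tau>) * (fps_const d * fps_X * ?u) ^ j) $ k)"
    by (rule fps_mult_compose_nth) simp
  also have "\<dots> = (\<Sum>j\<le>k. c ^ (k - j) * pochhammer (\<tau> + of_nat j) (k - j) / fact (k - j) *
      (B $ j * d ^ j))"
    by (rule sum.cong[OF refl], subst nth) (simp_all add: mult_ac)
  finally show ?thesis .
qed

lemma fps_lin_pow_product_nth:
  fixes c1 c2 a \<tau> :: "'a::field_char_0"
  shows "fps_nth (fps_lin_pow c1 a * fps_lin_pow c2 (- a - \<tau>)) k =
    (\<Sum>j\<le>k. c2 ^ (k - j) * pochhammer (\<tau> + of_nat j) (k - j) / fact (k - j) *
       ((a gchoose j) * (c2 - c1) ^ j))"
proof -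
  let ?g = "fps_const (c2 - c1) * fps_X * inverse (1 - fps_const c2 * fps_X)"
  have "fps_lin_pow c2 a * fps_lin_pow c2 (- a - \<tau>) = fps_lin_pow c2 (a + (- a - \<tau>))"
    by (rule fps_lin_pow_add[symmetric])
  also have "a + (- a - \<tau>) = - \<tau>"
    by simp
  finally have add: "fps_lin_pow c2 a * fps_lin_pow c2 (- a - \<tau>) = fps_lin_pow c2 (- \<tau>)" .
  have swap: "p * q * r = p * r * q" for p q r :: "'a fps"
    by (simp only: ac_simps)
  have "fps_lin_pow c1 a * fps_lin_pow c2 (- a - \<tau>) =
    fps_lin_pow c2 a * (fps_binomial a oo ?g) * fps_lin_pow c2 (- a - \<tau>)"
    by (rule arg_cong[OF fps_lin_pow_change_base])
  also have "\<dots> = fps_lin_pow c2 (- \<tau>) * (fps_binomial a oo ?g)"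
    by (subst swap) (simp only: add)
  finally have "fps_lin_pow c1 a * fps_lin_pow c2 (- a - \<tau>) =
      fps_lin_pow c2 (- \<tau>) * (fps_binomial a oo ?g)" .
  thus ?thesis by (simp only: fps_lin_pow_mult_compose_nth fps_binomial_nth)
qed

section \<open>The basis functions in Newton form\<close>

lemma gbinomial_eq_prod_lessThan:
  fixes a :: "'a::field_char_0"
  shows "a gchoose j = (\<Prod>i<j. a - of_nat i) / fact j"
  by (simp add: gbinomial_prod_rev atLeast0LessThan)

lemma pochhammer_shift_le:
  fixes \<tau> :: real
  assumes "\<tau> > 0"
  shows "pochhammer (\<tau> + real j) n \<le> (2 * (1 + \<tau>)) ^ (j + n) * fact n"
proof -
  have "pochhammer (\<tau> + real j) n \<le> (\<Prod>i<n. (1 + \<tau>) * (1 + real j + real i))"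
    unfolding pochhammer_prod atLeast0LessThan
    using assms by (intro prod_mono) (auto simp: algebra_simps)
  also have "\<dots> = (1 + \<tau>) ^ n * pochhammer (1 + real j) n"
    by (simp add: prod.distrib pochhammer_prod atLeast0LessThan)
  also have "pochhammer (1 + real j) n = fact n * real ((j + n) choose n)"
  proof -
    have "pochhammer (1::real) (j + n) = pochhammer 1 j * pochhammer (1 + real j) n"
      by (rule pochhammer_product')
    hence "(fact (j + n) :: real) = fact j * pochhammer (1 + real j) n"
      by (simp add: pochhammer_fact)
    thus ?thesis
      by (simp add: binomial_fact field_simps)
  qed
  also have "real ((j + n) choose n) \<le> 2 ^ (j + n)"
    using binomial_le_pow2[of "j + n" n] by (metis of_nat_le_iff of_nat_numeral of_nat_power)
  also have "(1 + \<tau>) ^ n \<le> (1 + \<tau>) ^ (j + n)"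
    using assms by (intro power_increasing) auto
  finally show ?thesis
    using assms unfolding power_mult_distrib by (simp add: mult_ac mult_left_mono mult_right_mono)
qed

text \<open>The common shape of the four bases. With \<open>\<nu>\<^sub>j = rho\<^bsup>j\<^esup> (\<Prod>i<j. x - y i) / w j\<close>, the expansion
  reads \<open>k! psi k / (sg k * w k) = (\<Sum>j\<le>k. (k choose j) \<nu>\<^sub>j)\<close>, a binomial transform. The parameters
  are complex because of the Meixner--Pollaczek polynomials, whose nodes are imaginary; the scale
  \<open>sg\<close> is 1 or \<open>k!\<close>.\<close>
locale newton_basis =
  fixes psi :: "nat \<Rightarrow> real \<Rightarrow> real"
    and sg :: "nat \<Rightarrow> real"
    and w :: "nat \<Rightarrow> complex"
    and rho :: complex
    and y :: "nat \<Rightarrow> complex"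
    and C :: real
  assumes C_ge_1: "1 \<le> C"
    and sg_ge_1: "1 \<le> sg k"
    and w_nonzero: "w k \<noteq> 0"
    and w_ratio: "j \<le> k \<Longrightarrow> cmod (w k / w j) \<le> C ^ k * fact (k - j)"
    and rho_le: "cmod rho \<le> C"
    and rho_ge: "1 \<le> C * cmod rho"
    and node_le: "cmod (y i) \<le> C * (real i + 1)"
    and expansion: "complex_of_real (psi k x) = of_real (sg k) *
      (\<Sum>j\<le>k. w k / w j / fact (k - j) * (rho ^ j / fact j * (\<Prod>i<j. of_real x - y i)))"

lemma newton_basis_pochhammerI:
  fixes \<tau> :: real and b :: complex and Y :: real
  assumes \<tau>: "\<tau> > 0" and b: "cmod b = 1" and rho: "rho \<noteq> 0" and sg: "\<And>k. 1 \<le> sg k"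
    and node: "\<And>i. cmod (y i) \<le> Y * (real i + 1)"
    and expansion: "\<And>k x. complex_of_real (psi k x) = of_real (sg k) *
      (\<Sum>j\<le>k. b ^ (k - j) * of_real (pochhammer (\<tau> + real j) (k - j)) / fact (k - j) *
        (rho ^ j / fact j * (\<Prod>i<j. of_real x - y i)))"
  shows "\<exists>C. newton_basis psi sg (\<lambda>k. b ^ k * of_real (pochhammer \<tau> k)) rho y C"
proof -
  define C where "C = 2 * (1 + \<tau>) + cmod rho + 1 / cmod rho + \<bar>Y\<bar>"
  have b0: "b \<noteq> 0"
    using b by auto
  have pos: "pochhammer \<tau> k > 0" for k
    using \<tau> by (rule pochhammer_pos)
  have ratio: "b ^ k * of_real (pochhammer \<tau> k) / (b ^ j * of_real (pochhammer \<tau> j)) =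
      b ^ (k - j) * of_real (pochhammer (\<tau> + real j) (k - j))" if "j \<le> k" for j k
  proof -
    have "pochhammer \<tau> k = pochhammer \<tau> j * pochhammer (\<tau> + real j) (k - j)"
      using that by (rule pochhammer_product)
    moreover have "b ^ k = b ^ j * b ^ (k - j)"
      using that by (simp flip: power_add)
    ultimately show ?thesis
      using b0 pos[of j] by simp
  qed
  have "newton_basis psi sg (\<lambda>k. b ^ k * of_real (pochhammer \<tau> k)) rho y C"
  proof
    show "1 \<le> C"
      using \<tau> by (simp add: C_def)
    show "1 \<le> sg k" for k
      by (rule sg)
    show "b ^ k * of_real (pochhammer \<tau> k) \<noteq> 0" for k
      using b0 pos[of k] by simp
    show "cmod (b ^ k * of_real (pochhammer \<tau> k) / (b ^ j * of_real (pochhammer \<tau> j)))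
        \<le> C ^ k * fact (k - j)" if "j \<le> k" for j k
    proof -
      have "cmod (b ^ (k - j) * of_real (pochhammer (\<tau> + real j) (k - j))) =
          pochhammer (\<tau> + real j) (k - j)"
        using \<tau> by (simp add: norm_mult norm_power b abs_of_nonneg pochhammer_nonneg)
      also have "\<dots> \<le> (2 * (1 + \<tau>)) ^ (j + (k - j)) * fact (k - j)"
        by (rule pochhammer_shift_le[OF \<tau>])
      also have "\<dots> \<le> C ^ k * fact (k - j)"
        using that \<tau> by (intro mult_right_mono) (auto simp: C_def intro!: power_mono)
      finally show ?thesis
        by (simp only: ratio[OF that])
    qed
    show "cmod rho \<le> C"
      using \<tau> by (simp add: C_def)
    have "1 = 1 / cmod rho * cmod rho"
      using rho by simp
    also have "\<dots> \<le> C * cmod rho"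
      using \<tau> by (intro mult_right_mono) (auto simp: C_def)
    finally show "1 \<le> C * cmod rho" .
    show "cmod (y i) \<le> C * (real i + 1)" for i
    proof -
      have "Y * (real i + 1) \<le> C * (real i + 1)"
        using \<tau> by (intro mult_right_mono) (auto simp: C_def add_increasing)
      with node[of i] show ?thesis by linarith
    qed
    show "complex_of_real (psi k x) = of_real (sg k) *
      (\<Sum>j\<le>k. b ^ k * of_real (pochhammer \<tau> k) / (b ^ j * of_real (pochhammer \<tau> j)) / fact (k - j) *
        (rho ^ j / fact j * (\<Prod>i<j. of_real x - y i)))" for k x
      unfolding expansion
      by (intro arg_cong2[where f = "(*)"] sum.cong refl) (simp only: ratio atMost_iff)
  qed
  thus ?thesis by blast
qed

text \<open>The factors \<open>(1 - e\<^bsup>i\<zeta>\<^esup> z)\<^bsup>-t + ix\<^esup>\<close> and \<open>(1 - e\<^bsup>-i\<zeta>\<^esup> z)\<^bsup>-t - ix\<^esup>\<close> are rewritten over the base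
  \<open>e\<^bsup>i\<zeta>\<^esup>\<close>. The exponents add up to \<open>-2 t\<close>, which is why \<open>2 t\<close> takes the place of the parameter \<open>t\<close>
  of the other families.\<close>
lemma newton_basis_meixner_pollaczek:
  assumes t: "t > 0" and \<zeta>: "0 < \<zeta>" "\<zeta> < pi"
  shows "\<exists>w rho y C. newton_basis (basis_fun (MeixnerModel \<zeta>) t) (\<lambda>_. 1) w rho y C"
proof -
  define b where "b = exp (\<i> * complex_of_real \<zeta>)"
  define y where "y i = \<i> * complex_of_real (t + real i)" for i :: nat
  define rho where "rho = complex_of_real (2 * sin \<zeta>)"
  have b_cis: "b = cis \<zeta>"
    by (simp add: b_def cis_conv_exp)
  have cb: "exp (- (\<i> * complex_of_real \<zeta>)) = cnj b"
    by (simp add: b_def exp_cnj)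
  have cnj_nth: "cnj (fps_lin_pow c a $ k) = fps_lin_pow (cnj c) (cnj a) $ k" for c a k
    by (simp add: fps_lin_pow_nth gbinomial_eq_prod_lessThan)
  have "\<exists>C. newton_basis (basis_fun (MeixnerModel \<zeta>) t) (\<lambda>_. 1)
       (\<lambda>k. b ^ k * of_real (pochhammer (2 * t) k)) rho y C"
  proof (rule newton_basis_pochhammerI)
    show "2 * t > 0" using t by simp
    show "cmod b = 1" by (simp add: b_cis)
    show "rho \<noteq> 0"
      using sin_gt_zero[OF \<zeta>] by (simp add: rho_def)
    show "cmod (y i) \<le> (t + 1) * (real i + 1)" for i
      unfolding y_def norm_mult norm_ii norm_of_real using t by (simp add: algebra_simps)
    fix k x
    define a where "a = - complex_of_real t - \<i> * of_real x"
    let ?F = "fps_lin_pow b (cnj a)" and ?G = "fps_lin_pow (cnj b) a"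
    have ca: "cnj a = - of_real t + \<i> * of_real x"
      by (simp add: a_def)
    \<comment> \<open>The two factors are conjugate, so the real part taken in the definition loses nothing.\<close>
    have "cnj ((?F * ?G) $ k) = (\<Sum>i=0..k. ?G $ i * ?F $ (k - i))"
      unfolding fps_mult_nth cnj_sum complex_cnj_mult cnj_nth complex_cnj_cnj ..
    also have "\<dots> = (?G * ?F) $ k"
      by (rule fps_mult_nth[symmetric])
    also have "\<dots> = (?F * ?G) $ k"
      by (simp only: mult.commute)
    finally have "cnj ((?F * ?G) $ k) = (?F * ?G) $ k" .
    hence real: "complex_of_real (Re ((?F * ?G) $ k)) = (?F * ?G) $ k"
      by (simp add: complex_eq_iff)
    have prod: "a gchoose j = (- \<i>) ^ j / fact j * (\<Prod>i<j. of_real x - y i)" for j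
    proof -
      have "(\<Prod>i<j. a - of_nat i) = (\<Prod>i<j. (- \<i>) * (of_real x - y i))"
        by (rule prod.cong) (simp_all add: a_def y_def algebra_simps)
      also have "\<dots> = (- \<i>) ^ j * (\<Prod>i<j. of_real x - y i)"
        by (simp only: prod.distrib prod_constant card_lessThan)
      finally show ?thesis
        by (simp add: gbinomial_eq_prod_lessThan)
    qed
    have rho: "rho = (b - cnj b) * (- \<i>)"
      by (simp add: rho_def b_cis complex_eq_iff)
    have poch: "pochhammer (complex_of_real (2 * t) + of_nat j) n =
        of_real (pochhammer (2 * t + real j) n)"
      for j n
      using pochhammer_of_real[of "2 * t + real j" n, where 'a = complex] by simp
    have rpow: "rho ^ j = (b - cnj b) ^ j * (- \<i>) ^ j" for j
      unfolding rho by (rule power_mult_distrib)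
    have aa: "cnj a = - a - complex_of_real (2 * t)"
      by (simp add: a_def complex_eq_iff)
    have "complex_of_real (basis_fun (MeixnerModel \<zeta>) t k x) = of_real (Re ((?F * ?G) $ k))"
      unfolding basis_fun.simps meixner_pollaczek_def cb b_def[symmetric] ca
      unfolding a_def ..
    also have "\<dots> = (?F * ?G) $ k"
      by (rule real)
    also have "\<dots> = (?G * ?F) $ k"
      by (simp only: mult.commute)
    also have "\<dots> = (\<Sum>j\<le>k. b ^ (k - j) * pochhammer (complex_of_real (2 * t) + of_nat j) (k - j) /
        fact (k - j) * ((a gchoose j) * (b - cnj b) ^ j))"
      unfolding aa by (rule fps_lin_pow_product_nth)
    also have "\<dots> = (\<Sum>j\<le>k. b ^ (k - j) * of_real (pochhammer (2 * t + real j) (k - j)) /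
        fact (k - j) * (rho ^ j / fact j * (\<Prod>i<j. of_real x - y i)))"
      unfolding prod poch rpow by (rule sum.cong[OF refl]) (simp add: mult_ac)
    finally show "complex_of_real (basis_fun (MeixnerModel \<zeta>) t k x) = of_real 1 *
       (\<Sum>j\<le>k. b ^ (k - j) * of_real (pochhammer (2 * t + real j) (k - j)) /
        fact (k - j) * (rho ^ j / fact j * (\<Prod>i<j. of_real x - y i)))"
      by simp
  qed auto
  thus ?thesis by blast
qed

lemma newton_basis_charlier:
  assumes t: "t > 0"
  shows "\<exists>w rho y C. newton_basis (basis_fun PoissonModel t) fact w rho y C"
proof (intro exI)
  define C where "C = 1 + t"
  show "newton_basis (basis_fun PoissonModel t) fact (\<lambda>k. complex_of_real t ^ k) (-1) of_nat C"
  proof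
    show "cmod (complex_of_real t ^ k / complex_of_real t ^ j) \<le> C ^ k * fact (k - j)"
      if "j \<le> k" for j k
    proof -
      have "cmod (complex_of_real t ^ k / complex_of_real t ^ j) = t ^ (k - j)"
        using t that by (simp add: norm_divide norm_power power_diff)
      also have "\<dots> \<le> C ^ (k - j)"
        using t by (intro power_mono) (auto simp: C_def)
      also have "\<dots> \<le> C ^ k"
        using t by (intro power_increasing) (auto simp: C_def)
      also have "\<dots> \<le> C ^ k * fact (k - j)"
        using t by (intro mult_le_cancel_left1[THEN iffD2]) (auto simp: C_def fact_ge_1)
      finally show ?thesis .
    qed
    fix k x
    have "(fps_exp 1 * fps_lin_pow (1 / t) x) $ k = (fps_lin_pow (1 / t) x * fps_exp 1) $ k"
      by (simp only: mult.commute)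
    also have "\<dots> = (\<Sum>j\<le>k. (x gchoose j) * (- (1 / t)) ^ j * (1 / fact (k - j)))"
      unfolding fps_mult_nth fps_lin_pow_nth by (simp add: atLeast0AtMost)
    finally have nth: "(fps_exp 1 * fps_lin_pow (1 / t) x) $ k =
        (\<Sum>j\<le>k. (x gchoose j) * (- (1 / t)) ^ j * (1 / fact (k - j)))" .
    have "basis_fun PoissonModel t k x = fact k * (t ^ k * (fps_exp 1 * fps_lin_pow (1 / t) x) $ k)"
      by (simp add: charlier_def)
    also have "\<dots> = fact k *
       (\<Sum>j\<le>k. t ^ k * ((x gchoose j) * (- (1 / t)) ^ j * (1 / fact (k - j))))"
      unfolding nth sum_distrib_left ..
    also have "\<dots> = fact k * (\<Sum>j\<le>k. t ^ k / t ^ j / fact (k - j) *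
        ((-1) ^ j / fact j * (\<Prod>i<j. x - real i)))"
      using t by (intro arg_cong[where f = "\<lambda>s. fact k * s"] sum.cong refl)
        (simp add: gbinomial_eq_prod_lessThan power_minus[of "1 / t"] power_one_over mult_ac)
    finally show "complex_of_real (basis_fun PoissonModel t k x) = of_real (fact k) *
       (\<Sum>j\<le>k. complex_of_real t ^ k / complex_of_real t ^ j / fact (k - j) *
        ((-1) ^ j / fact j * (\<Prod>i<j. complex_of_real x - of_nat i)))"
      by simp
  qed (use t in \<open>auto simp: C_def fact_ge_1 algebra_simps\<close>)
qed

lemma newton_basis_laguerre:
  assumes t: "t > 0"
  shows "\<exists>w rho y C. newton_basis (basis_fun GammaModel t) (\<lambda>_. 1) w rho y C"
proof -
  have "\<exists>C. newton_basis (basis_fun GammaModel t) (\<lambda>_. 1)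
       (\<lambda>k. 1 ^ k * of_real (pochhammer t k)) (-1) (\<lambda>_. 0) C"
  proof (rule newton_basis_pochhammerI)
    show "cmod 0 \<le> 0 * (real i + 1)" for i by simp
    fix k x
    have "basis_fun GammaModel t k x = fps_nth (fps_lin_pow 1 (- t) *
        (fps_exp 1 oo (fps_const (- x) * fps_X * inverse (1 - fps_const 1 * fps_X)))) k"
      by (simp add: laguerre_def fps_const_neg[symmetric] del: fps_const_neg)
    also have "\<dots> = (\<Sum>j\<le>k. 1 ^ (k - j) * pochhammer (t + real j) (k - j) / fact (k - j) *
        (fps_exp 1 $ j * (- x) ^ j))"
      by (rule fps_lin_pow_mult_compose_nth)
    also have "\<dots> = (\<Sum>j\<le>k. 1 ^ (k - j) * pochhammer (t + real j) (k - j) / fact (k - j) *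
        ((-1) ^ j / fact j * (\<Prod>i<j. x - 0)))"
      by (intro sum.cong refl) (simp add: power_minus[of x])
    finally show "complex_of_real (basis_fun GammaModel t k x) = of_real 1 *
      (\<Sum>j\<le>k. 1 ^ (k - j) * of_real (pochhammer (t + real j) (k - j)) / fact (k - j) *
        ((-1) ^ j / fact j * (\<Prod>i<j. of_real x - 0)))"
      by simp
  qed (use t in auto)
  thus ?thesis by blast
qed

lemma newton_basis_meixner:
  assumes t: "t > 0" and q: "0 < q" "q < 1"
  shows "\<exists>w rho y C. newton_basis (basis_fun (PascalModel q) t) fact w rho y C"
proof -
  have "\<exists>C. newton_basis (basis_fun (PascalModel q) t) fact
       (\<lambda>k. 1 ^ k * of_real (pochhammer t k)) (of_real (1 - 1 / q)) of_nat C"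
  proof (rule newton_basis_pochhammerI)
    show "cmod (of_nat i) \<le> 1 * (real i + 1)" for i by simp
    show "complex_of_real (1 - 1 / q) \<noteq> 0"
      using q by (subst of_real_eq_0_iff) simp
    fix k x
    have "pochhammer t k > 0"
      using t by (rule pochhammer_pos)
    hence "basis_fun (PascalModel q) t k x =
        fact k * fps_nth (fps_lin_pow (1 / q) x * fps_lin_pow 1 (- x - t)) k"
      by (simp add: meixner_def)
    also have "fps_nth (fps_lin_pow (1 / q) x * fps_lin_pow 1 (- x - t)) k =
        (\<Sum>j\<le>k. 1 ^ (k - j) * pochhammer (t + real j) (k - j) / fact (k - j) *
          ((x gchoose j) * (1 - 1 / q) ^ j))"
      by (rule fps_lin_pow_product_nth)
    also have "\<dots> = (\<Sum>j\<le>k. 1 ^ (k - j) * pochhammer (t + real j) (k - j) / fact (k - j) *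
        ((1 - 1 / q) ^ j / fact j * (\<Prod>i<j. x - real i)))"
      by (intro sum.cong refl) (simp add: gbinomial_eq_prod_lessThan)
    finally show "complex_of_real (basis_fun (PascalModel q) t k x) = of_real (fact k) *
      (\<Sum>j\<le>k. 1 ^ (k - j) * of_real (pochhammer (t + real j) (k - j)) / fact (k - j) *
        (of_real (1 - 1 / q) ^ j / fact j * (\<Prod>i<j. of_real x - of_nat i)))"
      by simp
  qed (use t in \<open>auto simp: fact_ge_1\<close>)
  thus ?thesis by blast
qed

unbundle no fps_syntax
notation vec_index (infixl "$" 100)
notation vec_nth (infixl "$" 90)

section \<open>Newton coefficients from scattered values\<close>

text \<open>Multiplying \<open>n\<^sub>j = (\<Prod>i<j. x - y i)\<close> by \<open>x - z\<close> gives \<open>n\<^bsub>j + 1\<^esub> + (y j - z) n\<^sub>j\<close>, so each linear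
  factor increases the sum of the moduli of the Newton coefficients by a factor of at most
  \<open>1 + Y + \<bar>z\<bar>\<close>.\<close>
lemma prod_linear_newton_expansion:
  fixes y z :: "nat \<Rightarrow> complex"
  assumes "finite I" and "\<And>i. i < card I \<Longrightarrow> cmod (y i) \<le> Y"
  shows "\<exists>E. (\<forall>x. (\<Prod>i\<in>I. x - z i) = (\<Sum>j\<le>card I. E j * (\<Prod>i<j. x - y i))) \<and>
    (\<Sum>j\<le>card I. cmod (E j)) \<le> (\<Prod>i\<in>I. 1 + Y + cmod (z i))"
  using assms
proof (induction I rule: finite_induct)
  case empty
  show ?case by (rule exI[of _ "\<lambda>_. 1"]) simp
next
  case (insert l I)
  let ?n = "card I"
  have card: "card (insert l I) = Suc ?n"
    using insert by simp
  have Y: "cmod (y i) \<le> Y" if "i \<le> ?n" for i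
    using insert.prems card that by simp
  obtain E where E: "\<And>x. (\<Prod>i\<in>I. x - z i) = (\<Sum>j\<le>?n. E j * (\<Prod>i<j. x - y i))"
    and E_le: "(\<Sum>j\<le>?n. cmod (E j)) \<le> (\<Prod>i\<in>I. 1 + Y + cmod (z i))"
    using insert.IH Y by (metis less_imp_le_nat)
  define F where "F j = (if j = 0 then 0 else E (j - 1)) + (if j \<le>
      ?n then (y j - z l) * E j else 0)"
    for j
  have split: "(\<Sum>j\<le>Suc ?n. F j * g j) = (\<Sum>j\<le>?n. E j * g (Suc j)) + (\<Sum>j\<le>?n. (y j - z l) * E j * g j)"
    for g :: "nat \<Rightarrow> complex"
  proof -
    have "(\<Sum>j\<le>Suc ?n. F j * g j) = (\<Sum>j\<le>Suc ?n. (if j = 0 then 0 else E (j - 1)) * g j) +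
        (\<Sum>j\<le>Suc ?n. (if j \<le> ?n then (y j - z l) * E j else 0) * g j)"
      by (simp only: F_def distrib_right sum.distrib)
    moreover have "(\<Sum>j\<le>Suc ?n. (if j = 0 then 0 else E (j - 1)) * g j) = (\<Sum>j\<le>?n. E j * g (Suc j))"
      by (subst sum.atMost_Suc_shift) simp
    ultimately show ?thesis by simp
  qed
  have "(\<Prod>i\<in>insert l I. x - z i) = (\<Sum>j\<le>Suc ?n. F j * (\<Prod>i<j. x - y i))" for x
  proof -
    have "(\<Prod>i\<in>insert l I. x - z i) = (\<Sum>j\<le>?n. (x - z l) * (E j * (\<Prod>i<j. x - y i)))"
      using insert.hyps by (simp add: E sum_distrib_left)
    also have "\<dots> = (\<Sum>j\<le>?n. E j * (\<Prod>i<Suc j. x - y i) + (y j - z l) * E j * (\<Prod>i<j. x - y i))"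
      by (intro sum.cong refl) (simp add: algebra_simps)
    finally show ?thesis unfolding split sum.distrib .
  qed
  moreover have "(\<Sum>j\<le>Suc ?n. cmod (F j)) \<le> (\<Prod>i\<in>insert l I. 1 + Y + cmod (z i))"
  proof -
    have "(\<Sum>j\<le>Suc ?n. cmod (F j)) \<le> (\<Sum>j\<le>Suc ?n. (if j = 0 then 0 else cmod (E (j - 1))) +
        (if j \<le> ?n then (Y + cmod (z l)) * cmod (E j) else 0))"
    proof (rule sum_mono)
      fix j
      have "cmod ((y j - z l) * E j) \<le> (Y + cmod (z l)) * cmod (E j)" if "j \<le> ?n"
        unfolding norm_mult
        using Y[OF that] norm_triangle_ineq4[of "y j" "z l"] by (intro mult_right_mono) auto
      thus "cmod (F j) \<le> (if j = 0 then 0 else cmod (E (j - 1))) +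
        (if j \<le> ?n then (Y + cmod (z l)) * cmod (E j) else 0)"
        unfolding F_def by (intro order_trans[OF norm_triangle_ineq] add_mono) auto
    qed
    also have "\<dots> = (\<Sum>j\<le>Suc ?n. if j = 0 then 0 else cmod (E (j - 1))) +
        (\<Sum>j\<le>Suc ?n. if j \<le> ?n then (Y + cmod (z l)) * cmod (E j) else 0)"
      by (rule sum.distrib)
    also have "(\<Sum>j\<le>Suc ?n. if j = 0 then 0 else cmod (E (j - 1))) = (\<Sum>j\<le>?n. cmod (E j))"
      by (subst sum.atMost_Suc_shift) simp
    also have "(\<Sum>j\<le>Suc ?n. if j \<le> ?n then (Y + cmod (z l)) * cmod (E j) else 0) =
        (Y + cmod (z l)) * (\<Sum>j\<le>?n. cmod (E j))"
      by (simp add: sum_distrib_left)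
    also have "(\<Sum>j\<le>?n. cmod (E j)) + (Y + cmod (z l)) * (\<Sum>j\<le>?n. cmod (E j)) =
       (1 + Y + cmod (z l)) * (\<Sum>j\<le>?n. cmod (E j))"
      by (simp add: algebra_simps)
    also have "\<dots> \<le> (1 + Y + cmod (z l)) * (\<Prod>i\<in>I. 1 + Y + cmod (z i))"
      using order_trans[OF norm_ge_zero Y[of 0]] by (intro mult_left_mono E_le) simp
    finally show ?thesis
      using insert.hyps by simp
  qed
  ultimately show ?case
    unfolding card by blast
qed

lemma newton_sum_eq_0D:
  fixes y D :: "nat \<Rightarrow> complex"
  assumes A: "finite A" "card A > K"
    and zero: "\<And>x. x \<in> A \<Longrightarrow> (\<Sum>j\<le>K. D j * (\<Prod>i<j. x - y i)) = 0"
    and "j \<le> K"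
  shows "D j = 0"
proof (rule ccontr)
  assume "D j \<noteq> 0"
  define nu where "nu j = (\<Prod>i<j. [:- y i, 1:])" for j
  have nu: "degree (nu j) = j \<and> coeff (nu j) j = 1" for j
  proof (induction j)
    case 0
    show ?case by (simp add: nu_def)
  next
    case (Suc j)
    have nz: "nu j \<noteq> 0" using Suc by auto
    have eq: "nu (Suc j) = nu j * [:- y j, 1:]" by (simp add: nu_def)
    have deg: "degree (nu (Suc j)) = Suc j"
      unfolding eq using nz Suc by (subst degree_mult_eq) auto
    moreover have "lead_coeff (nu (Suc j)) = 1"
      unfolding eq lead_coeff_mult using Suc by simp
    ultimately show ?case by simp
  qed
  define p where "p = (\<Sum>j\<le>K. Polynomial.smult (D j) (nu j))"
  have "poly p x = (\<Sum>j\<le>K. D j * (\<Prod>i<j. x - y i))" for x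
    by (simp add: p_def poly_sum nu_def poly_prod)
  hence roots: "A \<subseteq> {x. poly p x = 0}"
    using zero by auto
  have "degree p \<le> K"
    unfolding p_def using nu by (intro degree_sum_le) (auto intro: order_trans[OF degree_smult_le])
  have "p = 0"
  proof (rule ccontr)
    assume "p \<noteq> 0"
    hence "card A \<le> card {x. poly p x = 0}"
      using roots by (intro card_mono poly_roots_finite)
    also have "\<dots> \<le> degree p"
      using \<open>p \<noteq> 0\<close> by (rule card_poly_roots_bound)
    finally show False
      using \<open>degree p \<le> K\<close> A by simp
  qed
  define J where "J = Max {j. j \<le> K \<and> D j \<noteq> 0}"
  have fin: "finite {j. j \<le> K \<and> D j \<noteq> 0}" by simp
  have "J \<in> {j. j \<le> K \<and> D j \<noteq> 0}"
    unfolding J_def using \<open>D j \<noteq> 0\<close> \<open>j \<le> K\<close> by (intro Max_in fin) auto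
  hence J: "J \<le> K" "D J \<noteq> 0"
    by auto
  have above: "D i = 0" if "i \<le> K" "J < i" for i
  proof (rule ccontr)
    assume "D i \<noteq> 0"
    hence "i \<in> {j. j \<le> K \<and> D j \<noteq> 0}"
      using that by simp
    hence "i \<le> J"
      unfolding J_def by (rule Max_ge[OF fin])
    thus False using that by simp
  qed
  have "0 = coeff p J"
    by (simp add: \<open>p = 0\<close>)
  also have "\<dots> = (\<Sum>i\<le>K. D i * coeff (nu i) J)"
    by (simp add: p_def coeff_sum)
  also have "\<dots> = (\<Sum>i\<le>K. if i = J then D J else 0)"
  proof (intro sum.cong refl)
    fix i assume "i \<in> {..K}"
    thus "D i * coeff (nu i) J = (if i = J then D J else 0)"
      using nu[of i] nu[of J] above[of i] coeff_eq_0[of "nu i" J]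
      by (cases i J rule: linorder_cases) auto
  qed
  also have "\<dots> = D J"
    using J by simp
  finally show False using J by simp
qed

lemma prod_index_distance:
  fixes l K :: nat
  assumes "l \<le> K"
  shows "(\<Prod>i\<in>{..K} - {l}. \<bar>real l - real i\<bar>) = fact l * fact (K - l)"
proof -
  have split: "{..K} - {l} = {..<l} \<union> {l<..K}"
    using assms by auto
  have "(\<Prod>i\<in>{..K} - {l}. \<bar>real l - real i\<bar>) =
      (\<Prod>i<l. \<bar>real l - real i\<bar>) * (\<Prod>i\<in>{l<..K}. \<bar>real l - real i\<bar>)"
    unfolding split by (rule prod.union_disjoint) auto
  also have "(\<Prod>i<l. \<bar>real l - real i\<bar>) = (\<Prod>i<l. real (Suc (l - Suc i)))"
    by (intro prod.cong refl) (auto simp: of_nat_diff)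
  also have "\<dots> = (\<Prod>i<l. real (Suc i))"
    by (rule prod.nat_diff_reindex)
  also have "\<dots> = fact l"
    by (simp add: fact_prod_Suc atLeast0LessThan)
  also have "(\<Prod>i\<in>{l<..K}. \<bar>real l - real i\<bar>) = (\<Prod>i<K - l. real (Suc i))"
    using assms
    by (intro prod.reindex_bij_witness[of _ "\<lambda>i. i + Suc l" "\<lambda>i. i - Suc l"])
        (auto simp: of_nat_diff)
  also have "\<dots> = fact (K - l)"
    by (simp add: fact_prod_Suc atLeast0LessThan)
  finally show ?thesis .
qed

text \<open>Lagrange interpolation at the points \<open>x l\<close>, with each Lagrange polynomial expanded in the
  Newton basis of the unrelated nodes \<open>y\<close>. Since the points are separated, the denominators are at
  least \<open>\<delta>\<^bsup>K\<^esup> l! (K - l)!\<close>, and the binomial coefficients \<open>K choose l\<close> sum to \<open>2\<^bsup>K\<^esup>\<close>.\<close>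
lemma newton_coeff_le:
  fixes y D :: "nat \<Rightarrow> complex" and x :: "nat \<Rightarrow> real"
  assumes Y: "\<And>i. i < K \<Longrightarrow> cmod (y i) \<le> Y"
    and X: "\<And>l. l \<le> K \<Longrightarrow> \<bar>x l\<bar> \<le> X"
    and \<delta>: "\<delta> > 0"
    and sep: "\<And>l i. i < l \<Longrightarrow> l \<le> K \<Longrightarrow> x l - x i \<ge> \<delta> * (real l - real i)"
    and val: "\<And>l. l \<le> K \<Longrightarrow> cmod (\<Sum>j\<le>K. D j * (\<Prod>i<j. of_real (x l) - y i)) \<le> \<mu>"
    and XY: "0 \<le> 1 + Y + X"
    and j: "j \<le> K"
  shows "cmod (D j) \<le> \<mu> * (2 * (1 + Y + X) / \<delta>) ^ K / fact K"
proof -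
  define z where "z l = complex_of_real (x l)" for l
  define Q where "Q u = (\<Sum>j\<le>K. D j * (\<Prod>i<j. u - y i))" for u
  define I where "I l = {..K} - {l}" for l
  define d where "d l = (\<Prod>i\<in>I l. z l - z i)" for l
  have card_I: "card (I l) = K" if "l \<le> K" for l
    using that by (simp add: I_def)
  have sep': "\<bar>x l - x i\<bar> \<ge> \<delta> * \<bar>real l - real i\<bar>" if "l \<le> K" "i \<le> K" for l i
    using that sep[of i l] sep[of l i] \<delta> by (cases l i rule: linorder_cases) auto
  have "inj_on x {..K}"
  proof (rule inj_onI)
    fix i l assume "i \<in> {..K}" "l \<in> {..K}" "x i = x l"
    thus "i = l" using sep'[of l i] \<delta> by (auto simp: mult_le_0_iff)
  qed
  hence inj: "inj_on z {..K}"
    by (auto simp: inj_on_def z_def)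
  have d0: "d l \<noteq> 0" if "l \<le> K" for l
    using inj that by (auto simp: d_def I_def inj_on_def)
  have "\<exists>E. (\<forall>u. (\<Prod>i\<in>I l. u - z i) = (\<Sum>j\<le>K. E j * (\<Prod>i<j. u - y i))) \<and>
    (\<Sum>j\<le>K. cmod (E j)) \<le> (\<Prod>i\<in>I l. 1 + Y + cmod (z i))" if "l \<le> K" for l
    using prod_linear_newton_expansion[of "I l" y Y z] card_I[OF that] Y by (simp add: I_def)
  then obtain E where E: "\<And>l u. l \<le> K \<Longrightarrow> (\<Prod>i\<in>I l. u - z i) = (\<Sum>j\<le>K. E l j * (\<Prod>i<j. u - y i))"
    and E_le: "\<And>l. l \<le> K \<Longrightarrow> (\<Sum>j\<le>K. cmod (E l j)) \<le> (\<Prod>i\<in>I l. 1 + Y + cmod (z i))"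
    by metis
  define D' where "D' j = (\<Sum>l\<le>K. Q (z l) / d l * E l j)" for j
  have lagrange: "(\<Sum>j\<le>K. D' j * (\<Prod>i<j. u - y i)) = (\<Sum>l\<le>K. Q (z l) / d l * (\<Prod>i\<in>I l. u - z i))" for u
  proof -
    have "(\<Sum>j\<le>K. D' j * (\<Prod>i<j. u - y i)) =
        (\<Sum>j\<le>K. \<Sum>l\<le>K. Q (z l) / d l * (E l j * (\<Prod>i<j. u - y i)))"
      by (simp add: D'_def sum_distrib_right mult.assoc)
    also have "\<dots> = (\<Sum>l\<le>K. Q (z l) / d l * (\<Sum>j\<le>K. E l j * (\<Prod>i<j. u - y i)))"
      by (subst sum.swap) (simp add: sum_distrib_left)
    also have "\<dots> = (\<Sum>l\<le>K. Q (z l) / d l * (\<Prod>i\<in>I l. u - z i))"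
      by (simp add: E)
    finally show ?thesis .
  qed
  have "D j - D' j = 0"
  proof (rule newton_sum_eq_0D[of "z ` {..K}" K "\<lambda>j. D j - D' j" y j])
    show "card (z ` {..K}) > K"
      using inj by (simp add: card_image)
    fix u assume "u \<in> z ` {..K}"
    then obtain l where l: "l \<le> K" "u = z l" by auto
    have "(\<Sum>l'\<le>K. Q (z l') / d l' * (\<Prod>i\<in>I l'. z l - z i)) = (\<Sum>l'\<le>K. if l' = l then Q (z l) else 0)"
    proof (intro sum.cong refl)
      fix l' assume "l' \<in> {..K}"
      show "Q (z l') / d l' * (\<Prod>i\<in>I l'. z l - z i) = (if l' = l then Q (z l) else 0)"
      proof (cases "l' = l")
        case True
        thus ?thesis using d0[OF l(1)] by (simp add: d_def)
      next
        case False
        hence "(\<Prod>i\<in>I l'. z l - z i) = 0"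
          using l by (intro prod_zero) (auto simp: I_def)
        thus ?thesis using False by simp
      qed
    qed
    hence "(\<Sum>j\<le>K. D' j * (\<Prod>i<j. z l - y i)) = Q (z l)"
      unfolding lagrange using l by simp
    thus "(\<Sum>j\<le>K. (D j - D' j) * (\<Prod>i<j. u - y i)) = 0"
      by (simp add: l Q_def left_diff_distrib sum_subtractf)
  qed (use j in auto)
  hence "D j = D' j" by simp
  have summand: "cmod (Q (z l) / d l * E l j) \<le>
      \<mu> * ((1 + Y + X) / \<delta>) ^ K * (real (K choose l) / fact K)"
    if l: "l \<le> K" for l
  proof -
    have "cmod (d l) \<ge> \<delta> ^ K * (fact l * fact (K - l))"
    proof -
      have "cmod (d l) = (\<Prod>i\<in>I l. \<bar>x l - x i\<bar>)"
        unfolding d_def z_def prod_norm[symmetric] of_real_diff[symmetric] norm_of_real ..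
      also have "\<dots> \<ge> (\<Prod>i\<in>I l. \<delta> * \<bar>real l - real i\<bar>)"
        using l \<delta> by (intro prod_mono conjI sep') (auto simp: I_def)
      also have "(\<Prod>i\<in>I l. \<delta> * \<bar>real l - real i\<bar>) = \<delta> ^ K * (fact l * fact (K - l))"
        using card_I[OF l] prod_index_distance[OF l] by (simp add: prod.distrib I_def)
      finally show ?thesis .
    qed
    hence "1 / cmod (d l) \<le> 1 / (\<delta> ^ K * (fact l * fact (K - l)))"
      using \<delta> d0[OF l] by (intro divide_left_mono mult_pos_pos) auto
    also have "\<dots> = real (K choose l) / fact K / \<delta> ^ K"
      using l by (simp add: binomial_fact)
    finally have inv_d: "1 / cmod (d l) \<le> real (K choose l) / fact K / \<delta> ^ K" .
    have "cmod (E l j) \<le> (\<Sum>j\<le>K. cmod (E l j))"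
      using j by (intro member_le_sum) auto
    also have "\<dots> \<le> (\<Prod>i\<in>I l. 1 + Y + cmod (z i))"
      by (rule E_le[OF l])
    also have "\<dots> \<le> (\<Prod>i\<in>I l. 1 + Y + X)"
    proof (rule prod_mono)
      fix i assume i: "i \<in> I l"
      have "K > 0" using i l by (auto simp: I_def)
      hence "0 \<le> Y" using Y[of 0] norm_ge_zero[of "y 0"] by linarith
      thus "0 \<le> 1 + Y + cmod (z i) \<and> 1 + Y + cmod (z i) \<le> 1 + Y + X"
        using X[of i] i by (auto simp: z_def I_def)
    qed
    also have "\<dots> = (1 + Y + X) ^ K"
      by (simp add: card_I[OF l])
    finally have E1: "cmod (E l j) \<le> (1 + Y + X) ^ K" .
    have Qm: "cmod (Q (z l)) \<le> \<mu>"
      using val[OF l] by (simp add: Q_def z_def)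
    have "cmod (Q (z l) / d l * E l j) = cmod (Q (z l)) * (1 / cmod (d l)) * cmod (E l j)"
      by (simp add: norm_mult norm_divide)
    also have "\<dots> \<le> \<mu> * (real (K choose l) / fact K / \<delta> ^ K) * (1 + Y + X) ^ K"
      using order_trans[OF norm_ge_zero Qm] \<delta> by (intro mult_mono Qm inv_d E1) auto
    finally show ?thesis
      by (simp add: power_divide mult_ac)
  qed
  have "cmod (D j) \<le> (\<Sum>l\<le>K. cmod (Q (z l) / d l * E l j))"
    unfolding \<open>D j = D' j\<close> D'_def by (rule norm_sum)
  also have "\<dots> \<le> (\<Sum>l\<le>K. \<mu> * ((1 + Y + X) / \<delta>) ^ K * (real (K choose l) / fact K))"
    by (intro sum_mono summand) auto
  also have "\<dots> = \<mu> * ((1 + Y + X) / \<delta>) ^ K / fact K * (\<Sum>l\<le>K. real (K choose l))"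
    by (simp add: sum_distrib_left)
  also have "(\<Sum>l\<le>K. real (K choose l)) = 2 ^ K"
    using choose_row_sum[of K] by (metis of_nat_numeral of_nat_power of_nat_sum)
  finally have "cmod (D j) \<le> \<mu> * ((1 + Y + X) / \<delta>) ^ K / fact K * 2 ^ K" .
  moreover have "(2 * (1 + Y + X) / \<delta>) ^ K = ((1 + Y + X) / \<delta>) ^ K * 2 ^ K"
    unfolding power_mult_distrib[symmetric] by (simp add: mult.commute)
  ultimately show ?thesis
    by simp
qed

section \<open>Size and coercivity of a Newton basis\<close>

lemma power_le_exp_fact:
  fixes x :: real
  assumes "0 \<le> x"
  shows "x ^ n \<le> fact n * exp x"
proof -
  have "x ^ n / fact n \<le> (\<Sum>k\<le>n. x ^ k / fact k)"
    using assms by (intro member_le_sum) auto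
  also have "\<dots> \<le> (\<Sum>k. x ^ k / fact k)"
    using assms summable_exp_generic[of x]
    by (intro sum_le_suminf) (auto simp: divide_inverse mult.commute scaleR_conv_of_real)
  also have "\<dots> = exp x"
    by (simp add: exp_def divide_inverse mult.commute)
  finally show ?thesis
    by (simp add: field_simps)
qed

lemma Suc_le_two_power: "real (Suc n) \<le> 2 ^ n"
  using less_exp[of n] by (metis Suc_leI of_nat_le_iff of_nat_numeral of_nat_power)

lemma sum_triangle_swap:
  fixes f :: "nat \<Rightarrow> nat \<Rightarrow> 'a::comm_monoid_add"
  shows "(\<Sum>j\<in>{k..n}. \<Sum>l\<in>{j..n}. f j l) = (\<Sum>l\<in>{k..n}. \<Sum>j\<in>{k..l}. f j l)"
proof -
  have "(\<Sum>j\<in>{k..n}. \<Sum>l\<in>{j..n}. f j l) = (\<Sum>(j, l)\<in>(SIGMA j:{k..n}. {j..n}). f j l)"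
    by (rule sum.Sigma) auto
  also have "\<dots> = (\<Sum>(l, j)\<in>(SIGMA l:{k..n}. {k..l}). f j l)"
    by (rule sum.reindex_bij_witness[of _ "\<lambda>(l, j). (j, l)" "\<lambda>(j, l). (l, j)"]) auto
  also have "\<dots> = (\<Sum>l\<in>{k..n}. \<Sum>j\<in>{k..l}. f j l)"
    by (rule sum.Sigma[symmetric]) auto
  finally show ?thesis .
qed

context newton_basis
begin

text \<open>An exponential bound is what the moment estimate needs. It comes from
  \<open>u\<^bsup>j\<^esup> / j! \<le> exp u\<close>, applied with \<open>u = s (\<bar>x\<bar> + C j)\<close>: the product of \<open>j\<close> linear factors and the
  factor \<open>1 / j!\<close> are only geometrically large together, although the nodes grow linearly.\<close>
lemma psi_abs_le:
  assumes "s > 0" "k \<le> K"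
  shows "\<bar>psi k x\<bar> \<le> sg k * (2 * C * (1 + C * exp (s * C) / s)) ^ K * exp (s * \<bar>x\<bar>)"
proof -
  define D where "D = 1 + C * exp (s * C) / s"
  have D1: "D \<ge> 1"
    using C_ge_1 assms by (simp add: D_def)
  have D2: "C * exp (s * C) / s \<le> D"
    by (simp add: D_def)
  have summand: "cmod (w k / w j / fact (k - j) * (rho ^ j / fact j * (\<Prod>i<j. of_real x - y i)))
      \<le> C ^ k * (D ^ k * exp (s * \<bar>x\<bar>))" if j: "j \<le> k" for j
  proof -
    have "cmod (\<Prod>i<j. of_real x - y i) \<le> (\<Prod>i<j. \<bar>x\<bar> + C * real j)"
      unfolding prod_norm[symmetric]
    proof (rule prod_mono, intro conjI)
      fix i assume "i \<in> {..<j}"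
      hence "C * (real i + 1) \<le> C * real j"
        using C_ge_1 by (intro mult_left_mono) auto
      thus "cmod (of_real x - y i) \<le> \<bar>x\<bar> + C * real j"
        using node_le[of i] norm_triangle_ineq4[of "complex_of_real x" "y i"] by simp
    qed simp
    also have "\<dots> = (\<bar>x\<bar> + C * real j) ^ j"
      by simp
    also have "\<dots> = (s * (\<bar>x\<bar> + C * real j)) ^ j / s ^ j"
      using assms by (simp add: power_mult_distrib)
    also have "\<dots> \<le> fact j * exp (s * (\<bar>x\<bar> + C * real j)) / s ^ j"
      using assms C_ge_1 by (intro divide_right_mono power_le_exp_fact) auto
    also have "exp (s * (\<bar>x\<bar> + C * real j)) = exp (s * \<bar>x\<bar>) * exp (s * C) ^ j"
      by (simp add: exp_add[symmetric] exp_of_nat_mult[symmetric] algebra_simps)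
    finally have p: "cmod (\<Prod>i<j. of_real x - y i) \<le>
        fact j * (exp (s * \<bar>x\<bar>) * exp (s * C) ^ j) / s ^ j" .
    have "cmod (w k / w j / fact (k - j)) = cmod (w k / w j) / fact (k - j)"
      by (simp add: norm_divide norm_mult)
    hence "cmod (w k / w j / fact (k - j)) \<le> C ^ k"
      using w_ratio[OF j] by (simp add: pos_divide_le_eq)
    moreover have "cmod (rho ^ j / fact j * (\<Prod>i<j. of_real x - y i)) \<le> D ^ k * exp (s * \<bar>x\<bar>)"
    proof -
      have "cmod (rho ^ j / fact j * (\<Prod>i<j. of_real x - y i)) =
          cmod rho ^ j / fact j * cmod (\<Prod>i<j. of_real x - y i)"
        by (simp add: norm_mult norm_divide norm_power)
      also have "\<dots> \<le> C ^ j / fact j * (fact j * (exp (s * \<bar>x\<bar>) * exp (s * C) ^ j) / s ^ j)"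
        by (intro mult_mono p divide_right_mono power_mono rho_le) (use C_ge_1 in auto)
      also have "\<dots> = (C * exp (s * C) / s) ^ j * exp (s * \<bar>x\<bar>)"
        by (simp add: power_mult_distrib power_divide)
      also have "\<dots> \<le> D ^ j * exp (s * \<bar>x\<bar>)"
        using C_ge_1 assms D2 by (intro mult_right_mono power_mono) auto
      also have "\<dots> \<le> D ^ k * exp (s * \<bar>x\<bar>)"
        using D1 j by (intro mult_right_mono power_increasing) auto
      finally show ?thesis .
    qed
    ultimately show ?thesis
      unfolding norm_mult[of "w k / w j / fact (k - j)"] using C_ge_1 by (intro mult_mono) auto
  qed
  have "\<bar>psi k x\<bar> = cmod (complex_of_real (psi k x))"
    by simp
  also have "\<dots> = sg k * cmod (\<Sum>j\<le>k. w k / w j / fact (k - j) * (rho ^ j / fact j *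
      (\<Prod>i<j. of_real x - y i)))"
    unfolding expansion norm_mult using sg_ge_1[of k] by simp
  also have "\<dots> \<le> sg k * (\<Sum>j\<le>k. C ^ k * (D ^ k * exp (s * \<bar>x\<bar>)))"
    using sg_ge_1[of k] by (intro mult_left_mono order_trans[OF norm_sum] sum_mono summand) auto
  also have "\<dots> = sg k * (real (Suc k) * (C * D) ^ k * exp (s * \<bar>x\<bar>))"
    by (simp add: power_mult_distrib mult_ac)
  also have "\<dots> \<le> sg k * (2 ^ k * (C * D) ^ k * exp (s * \<bar>x\<bar>))"
    using sg_ge_1[of k] C_ge_1 D1 by (intro mult_left_mono mult_right_mono Suc_le_two_power) auto
  also have "2 ^ k * (C * D) ^ k = (2 * C * D) ^ k"
    by (simp add: power_mult_distrib)
  also have "sg k * ((2 * C * D) ^ k * exp (s * \<bar>x\<bar>)) \<le> sg k * ((2 * C * D) ^ K * exp (s * \<bar>x\<bar>))"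
  proof -
    have "1 \<le> 2 * C * D"
      using C_ge_1 D1 mult_mono[of 1 "2 * C" 1 D] by simp
    thus ?thesis
      using sg_ge_1[of k] assms by (intro mult_left_mono mult_right_mono power_increasing) auto
  qed
  finally show ?thesis
    by (simp add: D_def mult.assoc)
qed

text \<open>The values at separated points determine the Newton coefficients, and binomial inversion
  determines the coefficients \<open>a k\<close> from these. The factor \<open>K\<^bsup>K\<^esup>\<close> comes from \<open>j!\<close> in the expansion;
  the powers of \<open>K\<close> in \<open>newton_coeff_le\<close> are cancelled by its factor \<open>1 / K!\<close>.\<close>
lemma coeff_abs_le:
  fixes a :: "nat \<Rightarrow> real" and x :: "nat \<Rightarrow> real"
  assumes K: "1 \<le> K" and k: "k \<le> K" and \<delta>: "\<delta> > 0"
    and X: "\<And>l. l \<le> K \<Longrightarrow> \<bar>x l\<bar> \<le> 2 * real K"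
    and sep: "\<And>l i. i < l \<Longrightarrow> l \<le> K \<Longrightarrow> x l - x i \<ge> \<delta> * (real l - real i)"
    and val: "\<And>l. l \<le> K \<Longrightarrow> \<bar>\<Sum>k\<le>K. a k * psi k (x l)\<bar> \<le> \<mu>"
  shows "\<bar>a k\<bar> \<le> \<mu> * (2 * C\<^sup>2 * (2 * (C + 3) * exp 1) * real K / \<delta>) ^ K"
proof -
  define D where "D j =
      (\<Sum>k\<in>{j..K}. of_real (a k * sg k) * (w k / w j / fact (k - j)) * (rho ^ j / fact j))" for j
  have expand: "(\<Sum>j\<le>K. D j * (\<Prod>i<j. of_real u - y i)) = of_real (\<Sum>k\<le>K. a k * psi k u)" for u
  proof -
    have "of_real (\<Sum>k\<le>K. a k * psi k u) =
        (\<Sum>k\<le>K. \<Sum>j\<le>k. of_real (a k * sg k) * (w k / w j / fact (k - j)) *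
        (rho ^ j / fact j) * (\<Prod>i<j. of_real u - y i))"
      by (simp add: expansion sum_distrib_left mult.assoc)
    also have "\<dots> = (\<Sum>j\<le>K. \<Sum>k\<in>{j..K}. of_real (a k * sg k) * (w k / w j / fact (k - j)) *
        (rho ^ j / fact j) * (\<Prod>i<j. of_real u - y i))"
      using sum_triangle_swap[where f = "\<lambda>j k. of_real (a k * sg k) * (w k / w j / fact (k - j)) *
        (rho ^ j / fact j) * (\<Prod>i<j. of_real u - y i)" and k = 0 and n = K]
      by (simp only: atLeast0AtMost)
    finally show ?thesis
      by (simp add: D_def sum_distrib_right)
  qed
  have \<mu>: "0 \<le> \<mu>"
    using val[of 0] by (auto intro: order_trans[OF abs_ge_zero])
  have D_le: "cmod (D j) \<le> \<mu> * (2 * (C + 3) * exp 1 / \<delta>) ^ K" if j: "j \<le> K" for j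
  proof -
    have "cmod (D j) \<le> \<mu> * (2 * (1 + C * real K + 2 * real K) / \<delta>) ^ K / fact K"
    proof (rule newton_coeff_le[where y = y and x = x])
      show "cmod (y i) \<le> C * real K" if "i < K" for i
      proof -
        have "C * (real i + 1) \<le> C * real K"
          using that C_ge_1 by (intro mult_left_mono) auto
        thus ?thesis using node_le[of i] by linarith
      qed
      show "cmod (\<Sum>j\<le>K. D j * (\<Prod>i<j. complex_of_real (x l) - y i)) \<le> \<mu>" if "l \<le> K" for l
        unfolding expand norm_of_real using that by (rule val)
      show "0 \<le> 1 + C * real K + 2 * real K"
        using C_ge_1 by (simp add: add_nonneg_nonneg)
    qed (rule X \<delta> sep j; assumption)+
    also have "\<dots> \<le> \<mu> * (2 * (C + 3) * real K / \<delta>) ^ K / fact K"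
    proof -
      have le: "2 * (1 + C * real K + 2 * real K) \<le> 2 * (C + 3) * real K"
        using K by (simp add: distrib_right)
      show ?thesis
        using \<mu> \<delta> C_ge_1
        by (intro divide_right_mono mult_left_mono power_mono le) (simp_all add: add_nonneg_nonneg)
    qed
    also have "(2 * (C + 3) * real K / \<delta>) ^ K = (2 * (C + 3) / \<delta>) ^ K * real K ^ K"
      unfolding power_mult_distrib[symmetric] by simp
    also have "\<mu> * ((2 * (C + 3) / \<delta>) ^ K * real K ^ K) / fact K \<le>
       \<mu> * ((2 * (C + 3) / \<delta>) ^ K * (fact K * exp (real K))) / fact K"
      using \<mu> \<delta> C_ge_1
      by (intro divide_right_mono mult_left_mono power_le_exp_fact) auto
    also have "\<dots> = \<mu> * ((2 * (C + 3) / \<delta>) ^ K * exp 1 ^ K)"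
      by (simp add: exp_of_nat_mult[symmetric])
    also have "(2 * (C + 3) / \<delta>) ^ K * exp 1 ^ K = (2 * (C + 3) * exp 1 / \<delta>) ^ K"
      unfolding power_mult_distrib[symmetric] by simp
    finally show ?thesis .
  qed
  \<comment> \<open>After this rescaling the triangular system has entries \<open>1 / (l - j)!\<close>.\<close>
  define B where "B j = D j * fact j * w j / rho ^ j" for j
  have rho0: "rho \<noteq> 0"
    using rho_ge by auto
  have B: "B j = (\<Sum>l\<in>{j..K}. of_real (a l * sg l) * w l / fact (l - j))" for j
    using rho0 w_nonzero by (simp add: B_def D_def sum_distrib_right sum_divide_distrib)
  have inversion: "(\<Sum>j\<in>{k..K}. (-1) ^ (j - k) * B j / fact (j - k)) = of_real (a k * sg k) * w k"
  proof -
    have alt: "(\<Sum>j\<in>{k..l}. (-1) ^ (j - k) / (fact (j - k) * fact (l - j))) = (if l =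
        k then 1 else 0 :: complex)"
      if "k \<le> l" for l
    proof -
      have "(\<Sum>j\<in>{k..l}. (-1) ^ (j - k) / (fact (j - k) * fact (l - j))) =
          (\<Sum>i\<le>l - k. (-1) ^ i / (fact i * fact (l - k - i)) :: complex)"
        using that by (intro sum.reindex_bij_witness[of _ "\<lambda>i. i + k" "\<lambda>j. j - k"]) auto
      also have "\<dots> = (\<Sum>i\<le>l - k. (-1) ^ i * of_nat ((l - k) choose i) / fact (l - k))"
        by (intro sum.cong refl) (simp add: binomial_fact)
      also have "\<dots> = (\<Sum>i\<le>l - k. (-1) ^ i * of_nat ((l - k) choose i)) / fact (l - k)"
        by (simp add: sum_divide_distrib)
      also have "\<dots> = (if l = k then 1 else 0)"
        using choose_alternating_sum[of "l - k", where 'a = complex] that by (cases "l = k") auto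
      finally show ?thesis .
    qed
    have "(\<Sum>j\<in>{k..K}. (-1) ^ (j - k) * B j / fact (j - k)) =
        (\<Sum>j\<in>{k..K}. \<Sum>l\<in>{j..K}. of_real (a l * sg l) * w l * ((-1) ^ (j - k) / (fact (j - k) * fact
            (l - j))))"
      unfolding B sum_distrib_left sum_divide_distrib by (intro sum.cong refl) (simp add: mult_ac)
    also have "\<dots> = (\<Sum>l\<in>{k..K}. \<Sum>j\<in>{k..l}. of_real (a l * sg l) * w l * ((-1) ^ (j -
        k) / (fact (j - k) * fact (l - j))))"
      by (rule sum_triangle_swap)
    also have "\<dots> = (\<Sum>l\<in>{k..K}. of_real (a l * sg l) * w l * (if l = k then 1 else 0))"
      by (intro sum.cong refl)
          (simp add: sum_distrib_left[symmetric] alt del: times_divide_eq_right)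
    also have "\<dots> = (\<Sum>l\<in>{k..K}. if l = k then of_real (a k * sg k) * w k else 0)"
      by (intro sum.cong refl) auto
    also have "\<dots> = of_real (a k * sg k) * w k"
      using k by simp
    finally show ?thesis .
  qed
  have summand: "cmod ((-1) ^ (j - k) * B j / fact (j - k) / w k) \<le>
      \<mu> * (2 * (C + 3) * exp 1 / \<delta>) ^ K * real K ^ K * C ^ K * C ^ K" if j: "j \<in> {k..K}" for j
  proof -
    have "cmod ((-1) ^ (j - k) * B j / fact (j - k) / w k) =
        cmod (D j) * fact j * (cmod (w j / w k) / fact (j - k)) * (1 / cmod rho) ^ j"
      by (simp add: B_def norm_mult norm_divide norm_power power_divide)
    also have "\<dots> \<le> (\<mu> * (2 * (C + 3) * exp 1 / \<delta>) ^ K) * real K ^ K * C ^ K * C ^ K"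
    proof (intro mult_mono)
      show "cmod (D j) \<le> \<mu> * (2 * (C + 3) * exp 1 / \<delta>) ^ K"
        using j by (intro D_le) auto
      have "fact j \<le> (fact K :: real)"
        using j by (intro fact_mono) auto
      also have "\<dots> \<le> real K ^ K"
        by (rule order_trans[OF fact_le_power[of K]]) simp_all
      finally show "fact j \<le> real K ^ K" .
      have "cmod (w j / w k) / fact (j - k) \<le> C ^ j"
        using w_ratio[of k j] j by (simp add: field_simps)
      also have "\<dots> \<le> C ^ K"
        using C_ge_1 j by (intro power_increasing) auto
      finally show "cmod (w j / w k) / fact (j - k) \<le> C ^ K" .
      have "1 / cmod rho \<le> C"
        using rho_ge rho0 by (simp add: field_simps)
      hence "(1 / cmod rho) ^ j \<le> C ^ j"
        by (intro power_mono) auto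
      also have "\<dots> \<le> C ^ K"
        using C_ge_1 j by (intro power_increasing) auto
      finally show "(1 / cmod rho) ^ j \<le> C ^ K" .
    qed (use C_ge_1 \<mu> \<delta> in auto)
    finally show ?thesis .
  qed
  have "\<bar>a k\<bar> \<le> \<bar>a k * sg k\<bar>"
    using sg_ge_1[of k] mult_left_mono[of 1 "sg k" "\<bar>a k\<bar>"] by (simp add: abs_mult)
  also have "\<dots> = cmod ((\<Sum>j\<in>{k..K}. (-1) ^ (j - k) * B j / fact (j - k)) / w k)"
    unfolding inversion using w_nonzero[of k] by (simp add: norm_mult norm_divide abs_mult)
  also have "\<dots> \<le> (\<Sum>j\<in>{k..K}. \<mu> * (2 * (C + 3) * exp 1 / \<delta>) ^ K * real K ^ K * C ^ K * C ^ K)"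
    unfolding sum_divide_distrib by (intro order_trans[OF norm_sum] sum_mono summand)
  also have "\<dots> \<le> 2 ^ K * (\<mu> * (2 * (C + 3) * exp 1 / \<delta>) ^ K * real K ^ K * C ^ K * C ^ K)"
  proof -
    have "real (card {k..K}) \<le> 2 ^ K"
      by (rule order_trans[OF _ Suc_le_two_power[of K]]) simp
    thus ?thesis
      using \<mu> \<delta> C_ge_1 by (simp only: sum_constant) (intro mult_right_mono; auto)
  qed
  also have "\<dots> = \<mu> * (2 * C\<^sup>2 * (2 * (C + 3) * exp 1) * real K / \<delta>) ^ K"
  proof -
    have "2 * C\<^sup>2 * (2 * (C + 3) * exp 1) * real K / \<delta> =
        2 * (2 * (C + 3) * exp 1 / \<delta>) * real K * C * C"
      by (simp add: power2_eq_square)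
    hence "(2 * C\<^sup>2 * (2 * (C + 3) * exp 1) * real K / \<delta>) ^ K =
        2 ^ K * (2 * (C + 3) * exp 1 / \<delta>) ^ K * real K ^ K * C ^ K * C ^ K"
      by (simp only: power_mult_distrib[of _ C] power_mult_distrib[of _
          "real K"] power_mult_distrib[of 2 "2 * (C + 3) * exp 1 / \<delta>"])
    thus ?thesis
      by simp
  qed
  finally show ?thesis .
qed

end

section \<open>The laws of the four processes\<close>

definition exp_moment :: "real measure \<Rightarrow> bool" where
  "exp_moment L \<longleftrightarrow> (\<exists>\<theta>>0. (\<integral>\<^sup>+x. ennreal (exp (\<theta> * \<bar>x\<bar>)) \<partial>L) < \<infinity>)"

text \<open>Sets rather than points allow densities and atoms to be treated alike.\<close>
definition separated_charge ::
    "real measure \<Rightarrow> nat \<Rightarrow> (nat \<Rightarrow> real set) \<Rightarrow> real \<Rightarrow> real \<Rightarrow> bool" where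
  "separated_charge L K I \<delta> \<pi> \<longleftrightarrow> \<delta> > 0 \<and> \<pi> > 0 \<and>
     (\<forall>l\<le>K. compact (I l) \<and> I l \<noteq> {} \<and> I l \<subseteq> {- 2 * real K..2 * real K} \<and>
        ennreal \<pi> \<le> emeasure L (I l)) \<and>
     (\<forall>l\<le>K. \<forall>i<l. \<forall>u\<in>I i. \<forall>x\<in>I l. \<delta> * (real l - real i) \<le> x - u)"

text \<open>The number \<open>v\<close> measures the price of sampling a polynomial of degree \<open>K\<close> under \<open>L\<close>: up to a
  geometric factor, mass and separation together cost \<open>K\<^bsup>v K\<^esup>\<close> in the squared coefficients.\<close>
definition charges_separated_sets :: "real measure \<Rightarrow> nat \<Rightarrow> bool" where
  "charges_separated_sets L v \<longleftrightarrow> (\<exists>c\<ge>1. \<forall>K\<ge>1. \<exists>I \<delta> \<pi>. separated_charge L K I \<delta> \<pi> \<and>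
     1 / \<pi> * (1 / \<delta>) ^ (2 * K) \<le> c ^ K * real K ^ (v * K))"

text \<open>Even moments suffice because \<open>exp \<bar>u\<bar> \<le> 2 cosh u\<close>, and \<open>cosh\<close> is a power series in even
  powers.\<close>
lemma exp_momentI:
  assumes borel[measurable_cong]: "sets L = sets borel" and A: "A \<ge> 0" and C: "C > 0"
    and moment: "\<And>n. even n \<Longrightarrow> (\<integral>\<^sup>+x. ennreal (x ^ n) \<partial>L) \<le> ennreal (A * C ^ n * fact n)"
  shows "exp_moment L"
proof -
  \<comment> \<open>With this choice the terms of the series for \<open>cosh\<close> decay like \<open>2\<^bsup>-n\<^esup>\<close>.\<close>
  define \<theta> where "\<theta> = 1 / (2 * C)"
  have \<theta>: "\<theta> > 0" using C by (simp add: \<theta>_def)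
  define f where "f n x = (if even n then (\<theta> * x) ^ n / fact n else 0)" for n :: nat and x :: real
  have f_nonneg: "f n x \<ge> 0" for n x
    by (simp add: f_def zero_le_even_power)
  have f_int: "(\<integral>\<^sup>+x. ennreal (f n x) \<partial>L) \<le> ennreal (A * (1 / 2) ^ n)" for n
  proof (cases "even n")
    case True
    have "(\<integral>\<^sup>+x. ennreal (f n x) \<partial>L) = (\<integral>\<^sup>+x. ennreal (\<theta> ^ n / fact n) * ennreal (x ^ n) \<partial>L)"
      using True \<theta> by (intro nn_integral_cong)
        (simp add: f_def power_mult_distrib ennreal_mult[symmetric] zero_le_even_power)
    also have "\<dots> = ennreal (\<theta> ^ n / fact n) * (\<integral>\<^sup>+x. ennreal (x ^ n) \<partial>L)"
      by (rule nn_integral_cmult) measurable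
    also have "\<dots> \<le> ennreal (\<theta> ^ n / fact n) * ennreal (A * C ^ n * fact n)"
      by (intro mult_left_mono moment True) simp
    also have "\<dots> = ennreal (A * (1 / 2) ^ n)"
      using \<theta> A C by (simp add: ennreal_mult[symmetric] \<theta>_def power_divide power_mult_distrib)
    finally show ?thesis .
  qed (simp add: f_def)
  have "(\<integral>\<^sup>+x. ennreal (exp (\<theta> * \<bar>x\<bar>)) \<partial>L) \<le> (\<integral>\<^sup>+x. 2 * (\<Sum>n. ennreal (f n x)) \<partial>L)"
  proof (rule nn_integral_mono)
    fix x
    have sums: "(\<lambda>n. f n x) sums cosh (\<theta> * x)"
      using cosh_converges[of "\<theta> * x"]
          by (simp add: f_def divide_inverse mult.commute if_distrib cong: if_cong)
    have "exp (\<theta> * \<bar>x\<bar>) \<le> 2 * cosh (\<theta> * x)"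
      using \<theta> by (cases "x \<ge> 0") (auto simp: cosh_def abs_if)
    hence "ennreal (exp (\<theta> * \<bar>x\<bar>)) \<le> ennreal (2 * cosh (\<theta> * x))"
      by (rule ennreal_leI)
    also have "\<dots> = 2 * ennreal (\<Sum>n. f n x)"
      using sums by (simp add: ennreal_mult sums_iff)
    also have "ennreal (\<Sum>n. f n x) = (\<Sum>n. ennreal (f n x))"
      using sums f_nonneg by (intro suminf_ennreal2[symmetric]) (auto simp: sums_iff)
    finally show "ennreal (exp (\<theta> * \<bar>x\<bar>)) \<le> 2 * (\<Sum>n. ennreal (f n x))" .
  qed
  also have "\<dots> = 2 * (\<Sum>n. \<integral>\<^sup>+x. ennreal (f n x) \<partial>L)"
    unfolding f_def by (subst nn_integral_cmult, measurable) (subst nn_integral_suminf, measurable)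
  also have "\<dots> \<le> 2 * (\<Sum>n. ennreal (A * (1 / 2) ^ n))"
    by (intro mult_left_mono suminf_le f_int) auto
  also have "(\<Sum>n. ennreal (A * (1 / 2) ^ n)) = ennreal (\<Sum>n. A * (1 / 2) ^ n)"
    using A by (intro suminf_ennreal2 summable_mult summable_geometric) auto
  also have "2 * \<dots> < \<infinity>"
    by (simp add: ennreal_mult_less_top)
  finally show ?thesis
    unfolding exp_moment_def using \<theta> by blast
qed

text \<open>The sets are \<open>K + 1\<close> subintervals of \<open>[1, 2]\<close> of length \<open>\<delta> = 1 / (2 K + 2)\<close>, with gaps of the
  same length between them.\<close>
lemma charges_separated_setsI_density:
  assumes d: "d > 0"
    and lower: "\<And>u w. 1 \<le> u \<Longrightarrow> u \<le> w \<Longrightarrow> w \<le> 2 \<Longrightarrow> ennreal (d * (w - u)) \<le> emeasure L {u..w}"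
  shows "charges_separated_sets L 2"
  unfolding charges_separated_sets_def
proof (intro exI[of _ "128 * max 1 (1 / d)"] conjI allI impI)
  define D where "D = max 1 (1 / d)"
  have D1: "D \<ge> 1" "1 / d \<le> D" by (auto simp: D_def)
  show "1 \<le> 128 * max 1 (1 / d)" by (simp add: max_def)
  fix K :: nat assume K: "1 \<le> K"
  define \<delta> where "\<delta> = 1 / (2 * real K + 2)"
  define I where "I l = {1 + 2 * real l * \<delta>..1 + (2 * real l + 1) * \<delta>}" for l
  have \<delta>: "\<delta> > 0" by (simp add: \<delta>_def add_nonneg_pos)
  have top: "(2 * real K + 1) * \<delta> \<le> 1"
    by (simp add: \<delta>_def field_simps add_nonneg_pos)
  have I_top: "1 + (2 * real l + 1) * \<delta> \<le> 2" if "l \<le> K" for l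
  proof -
    have "(2 * real l + 1) * \<delta> \<le> (2 * real K + 1) * \<delta>"
      using that \<delta> by (intro mult_right_mono) auto
    with top show ?thesis by linarith
  qed
  show "\<exists>I \<delta> \<pi>. separated_charge L K I \<delta> \<pi> \<and>
     1 / \<pi> * (1 / \<delta>) ^ (2 * K) \<le> (128 * max 1 (1 / d)) ^ K * real K ^ (2 * K)"
    unfolding separated_charge_def
  proof (rule exI[of _ I], rule exI[of _ \<delta>], rule exI[of _ "d * \<delta>"], intro conjI allI impI ballI)
    fix l assume l: "l \<le> K"
    have le: "1 + 2 * real l * \<delta> \<le> 1 + (2 * real l + 1) * \<delta>"
      using \<delta> by (intro add_mono mult_right_mono) auto
    show "I l \<noteq> {}"
      using le by (simp add: I_def)
    show "I l \<subseteq> {- 2 * real K..2 * real K}"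
    proof
      fix x assume "x \<in> I l"
      hence "1 + 2 * real l * \<delta> \<le> x" "x \<le> 2"
        using I_top[OF l] by (auto simp: I_def)
      moreover have "0 \<le> 2 * real l * \<delta>" using \<delta> by simp
      ultimately have "1 \<le> x" "x \<le> 2" by linarith+
      thus "x \<in> {- 2 * real K..2 * real K}"
        using K by simp
    qed
    show "ennreal (d * \<delta>) \<le> emeasure L (I l)"
    proof -
      have "0 \<le> 2 * real l * \<delta>" using \<delta> by simp
      hence "ennreal (d * (1 + (2 * real l + 1) * \<delta> - (1 + 2 * real l * \<delta>))) \<le> emeasure L (I l)"
        unfolding I_def using le I_top[OF l] by (intro lower) auto
      thus ?thesis by (simp add: algebra_simps)
    qed
    fix i u x assume "i < l" "u \<in> I i" "x \<in> I l"
    hence "x - u \<ge> 1 + 2 * real l * \<delta> - (1 + (2 * real i + 1) * \<delta>)"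
      by (simp add: I_def)
    also have "1 + 2 * real l * \<delta> - (1 + (2 * real i + 1) * \<delta>) =
        \<delta> * (real l - real i) + \<delta> * (real l - real i - 1)"
      by (simp add: algebra_simps)
    also have "\<dots> \<ge> \<delta> * (real l - real i)"
      using \<delta> \<open>i < l\<close> by simp
    finally show "\<delta> * (real l - real i) \<le> x - u" .
  next
    have "1 / (d * \<delta>) * (1 / \<delta>) ^ (2 * K) = 1 / d * (2 * real K + 2) * (2 * real K + 2) ^ (2 * K)"
      by (simp add: \<delta>_def)
    also have "\<dots> \<le> D ^ K * 8 ^ K * (4 * real K) ^ (2 * K)"
    proof (intro mult_mono power_mono)
      show "1 / d \<le> D ^ K"
        using D1 self_le_power[of D K] K by linarith
      have "2 * real K + 2 = 2 * real (Suc K)" by simp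
      also have "\<dots> \<le> 4 ^ K * 2 ^ K"
        using Suc_le_two_power[of K] self_le_power[of "4::real" K] K by (intro mult_mono) auto
      also have "\<dots> = 8 ^ K" by (simp flip: power_mult_distrib)
      finally show "2 * real K + 2 \<le> 8 ^ K" .
    qed (use d D1 K in auto)
    also have "(4 * real K) ^ (2 * K) = 16 ^ K * real K ^ (2 * K)"
      by (simp add: power_mult_distrib power_mult)
    also have "D ^ K * 8 ^ K * (16 ^ K * real K ^ (2 * K)) = (D * 8 * 16) ^ K * real K ^ (2 * K)"
      by (simp only: power_mult_distrib mult.assoc)
    finally show "1 / (d * \<delta>) * (1 / \<delta>) ^ (2 * K) \<le> (128 * max 1 (1 / d)) ^ K * real K ^ (2 * K)"
      by (simp add: D_def mult.commute)
  qed (use d \<delta> in \<open>auto simp: I_def\<close>)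
qed

lemma charges_separated_setsI_atoms:
  assumes c: "c \<ge> 1"
    and atoms: "\<And>K l. 1 \<le> K \<Longrightarrow> l \<le> K \<Longrightarrow> ennreal (1 / (c ^ K * real K ^ K)) \<le> emeasure L {real l}"
  shows "charges_separated_sets L 1"
  unfolding charges_separated_sets_def
proof (intro exI[of _ c] conjI c allI impI)
  fix K :: nat assume K: "1 \<le> K"
  show "\<exists>I \<delta> \<pi>. separated_charge L K I \<delta> \<pi> \<and>
     1 / \<pi> * (1 / \<delta>) ^ (2 * K) \<le> c ^ K * real K ^ (1 * K)"
    unfolding separated_charge_def
    by (rule exI[of _ "\<lambda>l. {real l}"], rule exI[of _ 1], rule exI[of _ "1 / (c ^ K * real K ^ K)"])
       (use c K atoms[OF K] in auto)
qed

lemma emeasure_density_interval_ge: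
  fixes f :: "real \<Rightarrow> real"
  assumes f[measurable]: "f \<in> borel_measurable borel"
    and le: "\<And>x. 1 \<le> x \<Longrightarrow> x \<le> 2 \<Longrightarrow> d \<le> f x" and "d > 0" "1 \<le> u" "u \<le> w" "w \<le> 2"
  shows "ennreal (d * (w - u)) \<le> emeasure (density lborel (\<lambda>x. ennreal (f x))) {u..w}"
proof -
  have "ennreal (d * (w - u)) = (\<integral>\<^sup>+x. ennreal d * indicator {u..w} x \<partial>lborel)"
    using assms by (simp add: nn_integral_cmult_indicator ennreal_mult)
  also have "\<dots> \<le> (\<integral>\<^sup>+x. ennreal (f x) * indicator {u..w} x \<partial>lborel)"
    using assms by (intro nn_integral_mono) (auto simp: indicator_def intro!: ennreal_leI le)
  also have "\<dots> = emeasure (density lborel (\<lambda>x. ennreal (f x))) {u..w}"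
    by (simp add: emeasure_density)
  finally show ?thesis .
qed

lemma charges_separated_sets_density:
  fixes f :: "real \<Rightarrow> real"
  assumes f: "f \<in> borel_measurable borel" and cont: "continuous_on {1..2} f"
    and pos: "\<And>x. 1 \<le> x \<Longrightarrow> x \<le> 2 \<Longrightarrow> f x > 0"
  shows "charges_separated_sets (density lborel (\<lambda>x. ennreal (f x))) 2"
proof -
  obtain x0 where x0: "x0 \<in> {1..2}" "\<And>x. x \<in> {1..2} \<Longrightarrow> f x0 \<le> f x"
    using continuous_attains_inf[of "{1..2::real}" f] cont by auto
  show ?thesis
    using x0 pos by (intro charges_separated_setsI_density[of
        "f x0"] emeasure_density_interval_ge f) auto
qed

text \<open>The weights of the law at \<open>t\<close>, multiplied by \<open>2\<^bsup>k\<^esup>\<close>, are \<open>exp t\<close> times the weights at \<open>2 t\<close>.\<close>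
lemma poisson_exp_moment:
  assumes t: "t > 0"
  shows "exp_moment (marginal_law PoissonModel t)"
  unfolding exp_moment_def
proof (intro exI[of _ "ln 2"] conjI)
  have e: "exp t * exp (- (2 * t)) = exp (- t)"
    by (simp add: exp_add[symmetric])
  have "t ^ k / fact k * exp (- t) * 2 ^ k = exp t * ((2 * t) ^ k / fact k * exp (- (2 * t)))" for k
    unfolding e[symmetric] power_mult_distrib by simp
  hence pmf: "ennreal (pmf (poisson_pmf t) k) * ennreal (2 ^ k) =
      ennreal (exp t) * ennreal (pmf (poisson_pmf (2 * t)) k)" for k
    using t by (simp add: ennreal_mult[symmetric])
  have "(\<integral>\<^sup>+x. ennreal (exp (ln 2 * \<bar>x\<bar>)) \<partial>marginal_law PoissonModel t) =
      (\<integral>\<^sup>+k. ennreal (exp (ln 2 * \<bar>real k\<bar>)) \<partial>measure_pmf (poisson_pmf t))"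
    by (simp add: nn_integral_distr)
  also have "\<dots> = (\<integral>\<^sup>+k. ennreal (2 ^ k) \<partial>measure_pmf (poisson_pmf t))"
    by (intro nn_integral_cong) (simp add: exp_of_nat2_mult)
  also have "\<dots> = (\<integral>\<^sup>+k. ennreal (exp t) * ennreal (pmf (poisson_pmf (2 * t)) k) \<partial>count_space UNIV)"
    by (simp add: nn_integral_measure_pmf pmf)
  also have "\<dots> = ennreal (exp t)"
    by (simp add: nn_integral_cmult nn_integral_pmf)
  finally show "(\<integral>\<^sup>+x. ennreal (exp (ln 2 * \<bar>x\<bar>)) \<partial>marginal_law PoissonModel t) < \<infinity>"
    by simp
qed simp

lemma poisson_charges:
  assumes t: "t > 0"
  shows "charges_separated_sets (marginal_law PoissonModel t) 1"
proof (rule charges_separated_setsI_atoms)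
  define r where "r = max 1 (1 / t)"
  have r: "r \<ge> 1" "1 / t \<le> r" by (auto simp: r_def)
  show "1 \<le> exp t * r"
    using r t mult_mono[of 1 "exp t" 1 r] by simp
  fix K l :: nat assume K: "1 \<le> K" and l: "l \<le> K"
  have "emeasure (marginal_law PoissonModel t) {real l} =
      emeasure (measure_pmf (poisson_pmf t)) {l}"
    by (simp add: emeasure_distr vimage_def)
  also have "\<dots> = ennreal (t ^ l / fact l * exp (- t))"
    using t by (simp add: emeasure_pmf_single)
  finally have eq: "emeasure (marginal_law PoissonModel t) {real l} =
      ennreal (t ^ l / fact l * exp (- t))" .
  have "fact l * exp t * (1 / t) ^ l \<le> real K ^ K * exp t ^ K * r ^ K"
  proof (intro mult_mono)
    have "fact l \<le> (fact K :: real)" using l by (intro fact_mono)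
    also have "\<dots> \<le> real K ^ K" by (rule order_trans[OF fact_le_power[of K]]) simp_all
    finally show "fact l \<le> real K ^ K" .
    show "exp t \<le> exp t ^ K" using t K by (intro self_le_power) auto
    have "(1 / t) ^ l \<le> r ^ l" using t r by (intro power_mono) auto
    also have "\<dots> \<le> r ^ K" using l r by (intro power_increasing) auto
    finally show "(1 / t) ^ l \<le> r ^ K" .
  qed (use r t in auto)
  hence "1 / (real K ^ K * exp t ^ K * r ^ K) \<le> 1 / (fact l * exp t * (1 / t) ^ l)"
    using t K by (intro divide_left_mono mult_pos_pos) (auto simp: r_def max_def)
  also have "\<dots> = t ^ l / fact l * exp (- t)"
    by (simp add: exp_minus field_simps)
  finally show "ennreal (1 / ((exp t * r) ^ K * real K ^ K)) \<le>
      emeasure (marginal_law PoissonModel t) {real l}"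
    unfolding eq by (intro ennreal_leI) (simp add: power_mult_distrib mult_ac)
qed

lemma pascal_exp_moment:
  assumes t: "t > 0" and q: "0 < q" "q < 1"
  shows "exp_moment (marginal_law (PascalModel q) t)"
  unfolding exp_moment_def
proof (intro exI conjI)
  \<comment> \<open>Any \<open>r > 1\<close> with \<open>q r < 1\<close> would do; the binomial series then converges at \<open>q r\<close>.\<close>
  define r where "r = (1 + 1 / q) / 2"
  have "q * r = (q + 1) / 2"
    using q by (simp add: r_def field_simps)
  hence r: "r > 1" "q * r < 1" "0 < q * r"
    using q by (auto simp: r_def)
  show "ln r > 0" using r by simp
  define p where "p k = pochhammer t k / fact k * q ^ k * (1 - q) powr t" for k
  have p_nonneg: "p k \<ge> 0" for k
    using t q by (simp add: p_def pochhammer_nonneg)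
  have "(\<lambda>k. ((- t) gchoose k) * (- (q * r)) ^ k) sums (1 + - (q * r)) powr (- t)"
    using r by (intro gen_binomial_real) auto
  moreover have "((- t) gchoose k) * (- (q * r)) ^ k = pochhammer t k / fact k * (q * r) ^ k" for k
    unfolding gbinomial_pochhammer power_minus[of "q * r"] by simp
  ultimately have "summable (\<lambda>k. pochhammer t k / fact k * (q * r) ^ k)"
    by (simp add: sums_iff)
  hence "summable (\<lambda>k. (1 - q) powr t * (pochhammer t k / fact k * (q * r) ^ k))"
    by (rule summable_mult)
  moreover have pr: "p k * r ^ k = (1 - q) powr t * (pochhammer t k / fact k * (q * r) ^ k)" for k
    by (simp add: p_def power_mult_distrib)
  ultimately have summ: "summable (\<lambda>k. p k * r ^ k)"
    by simp
  have "(\<integral>\<^sup>+x. ennreal (exp (ln r * \<bar>x\<bar>)) \<partial>marginal_law (PascalModel q) t) =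
      (\<integral>\<^sup>+k. ennreal (p k) * ennreal (exp (ln r * \<bar>real k\<bar>)) \<partial>count_space UNIV)"
    by (simp add: nn_integral_distr nn_integral_density p_def)
  also have "\<dots> = (\<integral>\<^sup>+k. ennreal (p k * r ^ k) \<partial>count_space UNIV)"
    using r p_nonneg by (intro nn_integral_cong) (simp add: exp_of_nat2_mult ennreal_mult)
  also have "\<dots> = (\<Sum>k. ennreal (p k * r ^ k))"
    by (rule nn_integral_count_space_nat)
  also have "\<dots> = ennreal (\<Sum>k. p k * r ^ k)"
    using summ p_nonneg r by (intro suminf_ennreal2) auto
  finally show "(\<integral>\<^sup>+x. ennreal (exp (ln r * \<bar>x\<bar>)) \<partial>marginal_law (PascalModel q) t) < \<infinity>"
    by simp
qed

lemma pascal_charges: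
  assumes t: "t > 0" and q: "0 < q" "q < 1"
  shows "charges_separated_sets (marginal_law (PascalModel q) t) 1"
proof (rule charges_separated_setsI_atoms)
  \<comment> \<open>\<open>l! \<le> s\<^bsup>l\<^esup> (t)\<^sub>l\<close>, so the weights decay only geometrically.\<close>
  define s where "s = max 1 (1 / t)"
  define g where "g = (1 - q) powr (- t)"
  have s: "s \<ge> 1" "1 / t \<le> s" by (auto simp: s_def)
  have ts: "1 \<le> t * s" using s t by (simp add: field_simps)
  have g: "g \<ge> 1"
    using t q ge_one_powr_ge_zero[of "1 / (1 - q)" t]
        by (simp add: g_def powr_minus powr_divide field_simps)
  show "1 \<le> g * (s * (1 / q))"
    using g s q mult_mono[of 1 g 1 "s * (1 / q)"] mult_mono[of 1 s 1 "1 / q"] by simp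
  fix K l :: nat assume K: "1 \<le> K" and l: "l \<le> K"
  have "real -` {real l} = {l}" by auto
  hence eq: "emeasure (marginal_law (PascalModel q) t) {real l} =
      ennreal (pochhammer t l / fact l * q ^ l * (1 - q) powr t)"
    by (simp add: emeasure_distr emeasure_density nn_integral_count_space_indicator[symmetric]
        nn_integral_indicator_singleton nn_integral_count_space_finite)
  have "fact l = (\<Prod>i<l. 1 + real i)"
    by (simp add: fact_prod_Suc atLeast0LessThan)
  also have "\<dots> \<le> (\<Prod>i<l. s * (t + real i))"
  proof (rule prod_mono, intro conjI)
    fix i
    have "real i * 1 \<le> real i * s" using s by (intro mult_left_mono) auto
    thus "1 + real i \<le> s * (t + real i)"
      using ts by (simp add: algebra_simps)
  qed simp
  also have "\<dots> = s ^ l * pochhammer t l"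
    by (simp add: prod.distrib pochhammer_prod atLeast0LessThan)
  finally have fl: "fact l \<le> s ^ l * pochhammer t l" .
  have pp: "pochhammer t l > 0" using t by (rule pochhammer_pos)
  have "fact l / pochhammer t l * (1 / q) ^ l * g \<le> s ^ K * (1 / q) ^ K * g ^ K"
  proof (intro mult_mono)
    have "fact l / pochhammer t l \<le> s ^ l" using fl pp by (simp add: field_simps)
    also have "\<dots> \<le> s ^ K" using l s by (intro power_increasing) auto
    finally show "fact l / pochhammer t l \<le> s ^ K" .
    show "(1 / q) ^ l \<le> (1 / q) ^ K" using l q by (intro power_increasing) auto
    show "g \<le> g ^ K" using g K by (intro self_le_power) auto
  qed (use s q g pp in auto)
  also have "\<dots> \<le> s ^ K * (1 / q) ^ K * g ^ K * real K ^ K"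
    using mult_left_mono[OF one_le_power[of "real K" K], of "s ^ K * (1 / q) ^ K * g ^ K"] K s q g
        by simp
  finally have "1 / (s ^ K * (1 / q) ^ K * g ^ K * real K ^ K) \<le>
      1 / (fact l / pochhammer t l * (1 / q) ^ l * g)"
    using s q g pp K by (intro divide_left_mono mult_pos_pos) auto
  also have "\<dots> = pochhammer t l / fact l * q ^ l * (1 - q) powr t"
    using q by (simp add: g_def powr_minus power_divide divide_simps)
  finally have "1 / (s ^ K * (1 / q) ^ K * g ^ K * real K ^ K) \<le>
      pochhammer t l / fact l * q ^ l * (1 - q) powr t" .
  moreover have "(g * (s * (1 / q))) ^ K * real K ^ K = s ^ K * (1 / q) ^ K * g ^ K * real K ^ K"
    by (simp only: power_mult_distrib mult_ac)
  ultimately show "ennreal (1 / ((g * (s * (1 / q))) ^ K * real K ^ K)) \<le>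
      emeasure (marginal_law (PascalModel q) t) {real l}"
    unfolding eq by (intro ennreal_leI) (simp only:)
qed

text \<open>A moment of one law read off from the normalisation of another.\<close>
lemma density_moment_le:
  assumes [measurable]: "f \<in> borel_measurable borel" "g \<in> borel_measurable borel"
    and nonneg: "\<And>x. 0 \<le> f x" "\<And>x. 0 \<le> g x" "0 \<le> a" and "even n"
    and shift: "\<And>x. f x * x ^ n \<le> a * g x"
    and prob: "prob_space (density lborel (\<lambda>x. ennreal (g x)))"
  shows "(\<integral>\<^sup>+x. ennreal (x ^ n) \<partial>density lborel (\<lambda>x. ennreal (f x))) \<le> ennreal a"
proof -
  have "(\<integral>\<^sup>+x. ennreal (x ^ n) \<partial>density lborel (\<lambda>x. ennreal (f x))) =
      (\<integral>\<^sup>+x. ennreal (f x) * ennreal (x ^ n) \<partial>lborel)"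
    by (rule nn_integral_density) measurable
  also have "\<dots> \<le> (\<integral>\<^sup>+x. ennreal a * ennreal (g x) \<partial>lborel)"
    using \<open>even n\<close> nonneg
    by (intro nn_integral_mono)
      (simp add: ennreal_mult[symmetric] ennreal_leI shift zero_le_even_power)
  also have "\<dots> = ennreal a * (\<integral>\<^sup>+x. ennreal (g x) \<partial>lborel)"
    by (rule nn_integral_cmult) measurable
  also have "(\<integral>\<^sup>+x. ennreal (g x) \<partial>lborel) = 1"
    using prob_space.emeasure_space_1[OF prob] by (simp add: emeasure_density)
  finally show ?thesis by simp
qed

text \<open>\<open>x\<^bsup>n\<^esup>\<close> times the density at \<open>t\<close> is \<open>(t)\<^sub>n\<close> times the density at \<open>t + n\<close>, which integrates to 1.\<close>
lemma gamma_exp_moment: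
  assumes t: "t > 0" and prob: "\<And>s. s > 0 \<Longrightarrow> prob_space (marginal_law GammaModel s)"
  shows "exp_moment (marginal_law GammaModel t)"
proof (rule exp_momentI[where A = 1 and C = "2 * (1 + t)"])
  define f where "f s x = (if 0 < x then x powr (s - 1) * exp (- x) / Gamma s else 0)"
      for s x :: real
  have f_meas[measurable]: "f s \<in> borel_measurable borel" for s
    unfolding f_def by measurable
  fix n :: nat assume "even n"
  have shift: "f t x * x ^ n = pochhammer t n * f (t + real n) x" for x
  proof (cases "x > 0")
    case True
    have "Gamma (t + real n) = pochhammer t n * Gamma t"
      using t by (subst pochhammer_Gamma)
          (auto simp: Gamma_real_pos less_imp_neq[OF Gamma_real_pos, symmetric])
    moreover have "x powr (t + real n - 1) = x powr (t - 1) * x ^ n"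
      using True by (simp add: powr_add[symmetric] powr_realpow[symmetric] algebra_simps)
    moreover have "pochhammer t n > 0"
      using t by (rule pochhammer_pos)
    ultimately show ?thesis
      using True by (simp add: f_def)
  qed (simp add: f_def)
  have f_nonneg: "f s x \<ge> 0" if "s > 0" for s x
    using that Gamma_real_pos[of s] by (simp add: f_def)
  have "(\<integral>\<^sup>+x. ennreal (x ^ n) \<partial>marginal_law GammaModel t) \<le> ennreal (pochhammer t n)"
    unfolding marginal_law.simps f_def[symmetric]
  proof (rule density_moment_le[where g = "f (t + real n)"])
    show "prob_space (density lborel (\<lambda>x. ennreal (f (t + real n) x)))"
      using prob[of "t + real n"] t by (simp add: f_def)
  qed (use t f_nonneg \<open>even n\<close> in \<open>auto simp: shift pochhammer_nonneg\<close>)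
  also have "\<dots> \<le> ennreal (1 * (2 * (1 + t)) ^ n * fact n)"
    using pochhammer_shift_le[OF t, of 0 n] by (simp add: ennreal_leI)
  finally show "(\<integral>\<^sup>+x. ennreal (x ^ n) \<partial>marginal_law GammaModel t) \<le>
      ennreal (1 * (2 * (1 + t)) ^ n * fact n)" .
qed (use t in auto)

lemma gamma_charges:
  assumes t: "t > 0"
  shows "charges_separated_sets (marginal_law GammaModel t) 2"
  unfolding marginal_law.simps
proof (rule charges_separated_sets_density)
  have "continuous_on {1..2} (\<lambda>x. x powr (t - 1) * exp (- x) / Gamma t)"
    using Gamma_real_pos[OF t] by (intro continuous_intros) auto
  thus "continuous_on {1..2} (\<lambda>x. if 0 < x then x powr (t - 1) * exp (- x) / Gamma t else 0)"
    by (rule continuous_on_eq) auto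
  show "0 < (if 0 < x then x powr (t - 1) * exp (- x) / Gamma t else 0)" if "1 \<le> x" for x
    using that Gamma_real_pos[OF t] by simp
qed measurable

lemma continuous_on_Gamma_Complex:
  assumes "t > 0"
  shows "continuous_on A (\<lambda>x. Gamma (Complex t x))"
proof -
  have "Complex t x \<notin> \<int>\<^sub>\<le>\<^sub>0" for x
    using assms by (auto elim!: nonpos_Ints_cases simp: complex_eq_iff)
  moreover have "continuous_on A (\<lambda>x. Complex t x)"
    by (intro continuous_intros)
  ultimately show ?thesis
    by (intro continuous_on_compose2[OF continuous_on_Gamma[of "range (Complex t)"]]) auto
qed

text \<open>From \<open>\<Gamma>(z + 1) = z \<Gamma>(z)\<close> and \<open>\<bar>z\<bar> \<ge> \<bar>Im z\<bar>\<close>.\<close>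
lemma cmod_Gamma_Complex_shift_ge:
  assumes "t > 0"
  shows "\<bar>x\<bar> ^ n * cmod (Gamma (Complex t x)) \<le> cmod (Gamma (Complex (t + real n) x))"
proof (induction n)
  case (Suc n)
  let ?z = "Complex (t + real n) x"
  have "?z \<notin> \<int>\<^sub>\<le>\<^sub>0"
    using assms by (auto elim!: nonpos_Ints_cases simp: complex_eq_iff)
  hence "Gamma (?z + 1) = ?z * Gamma ?z"
    by (rule Gamma_plus1)
  moreover have "?z + 1 = Complex (t + real (Suc n)) x"
    by (simp add: complex_eq_iff)
  ultimately have "cmod (Gamma (Complex (t + real (Suc n)) x)) = cmod ?z * cmod (Gamma ?z)"
    by (simp add: norm_mult)
  also have "\<dots> \<ge> \<bar>x\<bar> * (\<bar>x\<bar> ^ n * cmod (Gamma (Complex t x)))"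
    using abs_Im_le_cmod[of ?z] by (intro mult_mono Suc.IH) auto
  finally show ?case by (simp add: mult.assoc)
qed simp

text \<open>By \<open>cmod_Gamma_Complex_shift_ge\<close>, \<open>x\<^bsup>2 k\<^esup>\<close> times the density at \<open>t\<close> is at most a multiple of the
  density at \<open>t + k\<close>. As the latter integrates to 1, the ratio of the two normalising constants
  bounds the moment of order \<open>2 k\<close>.\<close>
lemma meixner_process_exp_moment:
  assumes t: "t > 0" and \<zeta>: "0 < \<zeta>" "\<zeta> < pi"
    and prob: "\<And>s. s > 0 \<Longrightarrow> prob_space (marginal_law (MeixnerModel \<zeta>) s)"
  shows "exp_moment (marginal_law (MeixnerModel \<zeta>) t)"
proof (rule exp_momentI[where A = 1 and C = "2 * (1 + 2 * t) / (2 * sin \<zeta>)"])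
  have sin: "sin \<zeta> > 0" using sin_gt_zero[OF \<zeta>] .
  show "2 * (1 + 2 * t) / (2 * sin \<zeta>) > 0"
    using sin t by simp
  define b where "b s = (2 * sin \<zeta>) powr (2 * s) / (2 * pi * Gamma (2 * s))" for s
  define f where "f s x = b s * exp ((2 * \<zeta> - pi) * x) * (cmod (Gamma (Complex s x)))\<^sup>2" for s x
  have b_pos: "b s > 0" if "s > 0" for s
    using that Gamma_real_pos[of "2 * s"] sin by (simp add: b_def)
  have f_meas: "f s \<in> borel_measurable borel" if "s > 0" for s
    unfolding f_def using that
    by (intro borel_measurable_continuous_onI continuous_intros continuous_on_Gamma_Complex)
  fix n :: nat assume "even n"
  then obtain k where n: "n = 2 * k" by (elim evenE)
  define a where "a = pochhammer (2 * t) n / (2 * sin \<zeta>) ^ n"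
  have a_nonneg: "a \<ge> 0"
    using t sin by (simp add: a_def pochhammer_nonneg)
  have bb: "b t = a * b (t + real k)"
  proof -
    have "Gamma (2 * t + real n) = pochhammer (2 * t) n * Gamma (2 * t)"
      using t by (subst pochhammer_Gamma)
          (auto simp: Gamma_real_pos less_imp_neq[OF Gamma_real_pos, symmetric])
    moreover have "2 * (t + real k) = 2 * t + real n"
      by (simp add: n)
    moreover have "(2 * sin \<zeta>) powr (2 * t + real n) = (2 * sin \<zeta>) powr (2 * t) * (2 * sin \<zeta>) ^ n"
      using sin by (simp add: powr_add powr_realpow)
    moreover have "pochhammer (2 * t) n > 0"
      using t by (intro pochhammer_pos) auto
    ultimately show ?thesis
      using sin by (simp add: b_def a_def)
  qed
  have shift: "f t x * x ^ n \<le> a * f (t + real k) x" for x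
  proof -
    have "x ^ n = (\<bar>x\<bar> ^ k)\<^sup>2"
      by (simp add: n power_mult[symmetric] power_even_abs mult.commute)
    hence "x ^ n * (cmod (Gamma (Complex t x)))\<^sup>2 = (\<bar>x\<bar> ^ k * cmod (Gamma (Complex t x)))\<^sup>2"
      by (simp only: power_mult_distrib)
    also have "\<dots> \<le> (cmod (Gamma (Complex (t + real k) x)))\<^sup>2"
      by (intro power_mono cmod_Gamma_Complex_shift_ge t) auto
    finally have "b t * exp ((2 * \<zeta> - pi) * x) * (x ^ n * (cmod (Gamma (Complex t x)))\<^sup>2)
        \<le> b t * exp ((2 * \<zeta> - pi) * x) * (cmod (Gamma (Complex (t + real k) x)))\<^sup>2"
      using b_pos[OF t] by (intro mult_left_mono) auto
    also have "\<dots> = a * f (t + real k) x"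
      by (simp add: f_def bb)
    finally show ?thesis
      by (simp add: f_def mult_ac)
  qed
  have f_nonneg: "f s x \<ge> 0" if "s > 0" for s x
    using b_pos[OF that] by (simp add: f_def)
  have tk: "t + real k > 0" using t by simp
  have "(\<integral>\<^sup>+x. ennreal (x ^ n) \<partial>marginal_law (MeixnerModel \<zeta>) t) \<le> ennreal a"
    unfolding marginal_law.simps b_def[symmetric] f_def[symmetric]
  proof (rule density_moment_le[where g = "f (t + real k)"])
    show "prob_space (density lborel (\<lambda>x. ennreal (f (t + real k) x)))"
      using prob[OF tk] by (simp add: f_def b_def)
  qed (use f_meas f_nonneg a_nonneg \<open>even n\<close> shift t tk in auto)
  also have "\<dots> \<le> ennreal (1 * (2 * (1 + 2 * t) / (2 * sin \<zeta>)) ^ n * fact n)"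
  proof -
    have "pochhammer (2 * t) n / (2 * sin \<zeta>) ^ n \<le> (2 * (1 + 2 * t)) ^ n * fact n / (2 * sin \<zeta>) ^ n"
      using pochhammer_shift_le[of "2 * t" 0 n] t sin by (intro divide_right_mono) auto
    thus ?thesis
      unfolding power_divide by (simp add: a_def ennreal_leI)
  qed
  finally show "(\<integral>\<^sup>+x. ennreal (x ^ n) \<partial>marginal_law (MeixnerModel \<zeta>) t)
      \<le> ennreal (1 * (2 * (1 + 2 * t) / (2 * sin \<zeta>)) ^ n * fact n)" .
qed auto

lemma meixner_process_charges:
  assumes t: "t > 0" and \<zeta>: "0 < \<zeta>" "\<zeta> < pi"
  shows "charges_separated_sets (marginal_law (MeixnerModel \<zeta>) t) 2"
proof -
  have "Complex t x \<notin> \<int>\<^sub>\<le>\<^sub>0" for x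
    using t by (auto elim!: nonpos_Ints_cases simp: complex_eq_iff)
  hence Gamma_nz: "Gamma (Complex t x) \<noteq> 0" for x
    by (simp add: Gamma_eq_zero_iff)
  have Gamma_pos: "Gamma (2 * t) > 0"
    using t by (intro Gamma_real_pos) auto
  have cont: "continuous_on A (\<lambda>x. (2 * sin \<zeta>) powr (2 * t) / (2 * pi * Gamma (2 * t)) *
      exp ((2 * \<zeta> - pi) * x) * (cmod (Gamma (Complex t x)))\<^sup>2)" for A
    by (intro continuous_intros continuous_on_Gamma_Complex t)
  show ?thesis
    unfolding marginal_law.simps using Gamma_nz Gamma_pos sin_gt_zero[OF \<zeta>]
    by (intro charges_separated_sets_density borel_measurable_continuous_onI cont) auto
qed

section \<open>Bounds for the basis at a single date\<close>

lemma law_exp_moment: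
  assumes "valid_model P" "t > 0" "\<And>s. s > 0 \<Longrightarrow> prob_space (marginal_law P s)"
  shows "exp_moment (marginal_law P t)"
  using assms
  by (cases P) (auto intro: poisson_exp_moment pascal_exp_moment gamma_exp_moment
      meixner_process_exp_moment
      simp del: marginal_law.simps)

text \<open>The two sources of powers \<open>K\<^bsup>K\<^esup>\<close>: \<open>degree_growth\<close> is 1 if the basis functions carry a factor
  \<open>k!\<close>, and \<open>sampling_growth\<close> is the parameter of \<open>charges_separated_sets\<close>, 2 for densities and
  1 for atoms.\<close>
fun degree_growth :: "levy_model \<Rightarrow> nat" where
  "degree_growth (MeixnerModel \<zeta>) = 0"
| "degree_growth PoissonModel = 1"
| "degree_growth GammaModel = 0"
| "degree_growth (PascalModel q) = 1"

fun sampling_growth :: "levy_model \<Rightarrow> nat" where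
  "sampling_growth (MeixnerModel \<zeta>) = 2"
| "sampling_growth PoissonModel = 1"
| "sampling_growth GammaModel = 2"
| "sampling_growth (PascalModel q) = 1"

lemma growth_exponent_ge: "4 * degree_growth P + 2 * (2 + sampling_growth P) \<le> growth_exponent P"
  by (cases P) auto

lemma law_charges:
  assumes "valid_model P" "t > 0"
  shows "charges_separated_sets (marginal_law P t) (sampling_growth P)"
  using assms
  by (cases P) (auto intro: poisson_charges pascal_charges gamma_charges meixner_process_charges
      simp del: marginal_law.simps One_nat_def)

lemma basis_newton:
  assumes "valid_model P" "t > 0"
  shows "\<exists>sg w rho y C. newton_basis (basis_fun P t) sg w rho y C \<and>
    (\<forall>K\<ge>1. \<forall>k\<le>K. sg k \<le> real K ^ (degree_growth P * K))"
proof -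
  have fact: "fact k \<le> real K ^ K" if "k \<le> K" for k K :: nat
  proof -
    have "fact k \<le> (fact K :: real)" using that by (rule fact_mono)
    also have "\<dots> \<le> real K ^ K" by (rule order_trans[OF fact_le_power[of K]]) simp_all
    finally show ?thesis .
  qed
  have intro: ?thesis
    if "newton_basis (basis_fun P t) sg w rho y C" "\<And>K k. 1 \<le> K \<Longrightarrow> k \<le> K \<Longrightarrow> sg k \<le>
        real K ^ (degree_growth P * K)"
    for sg w rho y C
    using that by blast
  show ?thesis
  proof (cases P)
    case (MeixnerModel \<zeta>)
    then obtain w rho y C where "newton_basis (basis_fun P t) (\<lambda>_. 1) w rho y C"
      using newton_basis_meixner_pollaczek[of t \<zeta>] assms by auto
    thus ?thesis by (rule intro) (simp add: MeixnerModel)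
  next
    case PoissonModel
    then obtain w rho y C where "newton_basis (basis_fun P t) fact w rho y C"
      using newton_basis_charlier[of t] assms by auto
    thus ?thesis by (rule intro) (simp add: PoissonModel fact)
  next
    case GammaModel
    then obtain w rho y C where "newton_basis (basis_fun P t) (\<lambda>_. 1) w rho y C"
      using newton_basis_laguerre[of t] assms by auto
    thus ?thesis by (rule intro) (simp add: GammaModel)
  next
    case (PascalModel q)
    then obtain w rho y C where "newton_basis (basis_fun P t) fact w rho y C"
      using newton_basis_meixner[of t q] assms by auto
    thus ?thesis by (rule intro) (simp add: PascalModel fact)
  qed
qed

context newton_basis
begin

lemma continuous_psi: "continuous_on A (psi k)"
proof -
  have eq: "psi k = (\<lambda>x. Re (of_real (sg k) *
      (\<Sum>j\<le>k. w k / w j / fact (k - j) * (rho ^ j / fact j * (\<Prod>i<j. of_real x - y i)))))"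
    by (rule ext) (simp only: expansion[symmetric] Re_complex_of_real)
  show ?thesis
    unfolding eq by (intro continuous_intros)
qed

lemma psi_measurable[measurable]: "psi k \<in> borel_measurable borel"
  by (rule borel_measurable_continuous_onI) (rule continuous_psi)

text \<open>The exponent of the available exponential moment is split over the four factors.\<close>
lemma fourth_moment_le:
  assumes L[measurable_cong]: "sets L = sets borel" and "prob_space L" and "exp_moment L"
    and sg: "\<And>K k. 1 \<le> K \<Longrightarrow> k \<le> K \<Longrightarrow> sg k \<le> real K ^ (e * K)"
  shows "\<exists>c\<ge>1. \<forall>K\<ge>1. \<forall>k\<le>K. (\<integral>\<^sup>+x. ennreal (psi k x ^ 4) \<partial>L) \<le> ennreal (c ^ K * real K ^ (4 * e * K))"
proof -
  obtain \<theta> where \<theta>: "\<theta> > 0" and fin: "(\<integral>\<^sup>+x. ennreal (exp (\<theta> * \<bar>x\<bar>)) \<partial>L) < \<infinity>"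
    using assms by (auto simp: exp_moment_def)
  define m where "m = max 1 (enn2real (\<integral>\<^sup>+x. ennreal (exp (\<theta> * \<bar>x\<bar>)) \<partial>L))"
  have "(\<integral>\<^sup>+x. ennreal (exp (\<theta> * \<bar>x\<bar>)) \<partial>L) = ennreal (enn2real (\<integral>\<^sup>+x. ennreal (exp (\<theta> * \<bar>x\<bar>)) \<partial>L))"
    using fin by simp
  also have "\<dots> \<le> ennreal m"
    by (intro ennreal_leI) (simp add: m_def)
  finally have m: "m \<ge> 1" "(\<integral>\<^sup>+x. ennreal (exp (\<theta> * \<bar>x\<bar>)) \<partial>L) \<le> ennreal m"
    by (simp_all add: m_def)
  define s where "s = \<theta> / 4"
  have s: "s > 0" using \<theta> by (simp add: s_def)
  define B where "B = 2 * C * (1 + C * exp (s * C) / s)"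
  have B: "B \<ge> 1"
    using C_ge_1 s mult_mono[of 1 "2 * C" 1 "1 + C * exp (s * C) / s"] by (simp add: B_def)
  show ?thesis
  proof (intro exI[of _ "m * B ^ 4"] conjI allI impI)
    show "1 \<le> m * B ^ 4"
      using m B mult_mono[of 1 m 1 "B ^ 4"] by simp
    fix K k :: nat assume K: "1 \<le> K" and k: "k \<le> K"
    have "(\<integral>\<^sup>+x. ennreal (psi k x ^ 4) \<partial>L) \<le>
        (\<integral>\<^sup>+x. ennreal (real K ^ (4 * e * K) * B ^ (4 * K)) * ennreal (exp (\<theta> * \<bar>x\<bar>)) \<partial>L)"
    proof (intro nn_integral_mono)
      fix x
      have "psi k x ^ 4 = \<bar>psi k x\<bar> ^ 4"
        by simp
      also have "\<dots> \<le> (sg k * B ^ K * exp (s * \<bar>x\<bar>)) ^ 4"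
        unfolding B_def by (intro power_mono psi_abs_le s k) simp
      also have "\<dots> = sg k ^ 4 * B ^ (4 * K) * exp (s * \<bar>x\<bar>) ^ 4"
        by (simp add: power_mult_distrib power_mult mult.commute[of 4 K])
      also have "exp (s * \<bar>x\<bar>) ^ 4 = exp (\<theta> * \<bar>x\<bar>)"
        by (simp add: exp_of_nat_mult[symmetric] s_def)
      also have "sg k ^ 4 * B ^ (4 * K) * exp (\<theta> * \<bar>x\<bar>) \<le>
          (real K ^ (e * K)) ^ 4 * B ^ (4 * K) * exp (\<theta> * \<bar>x\<bar>)"
        using sg[OF K k] sg_ge_1[of k] B by (intro mult_right_mono power_mono) auto
      also have "(real K ^ (e * K)) ^ 4 = real K ^ (4 * e * K)"
        by (simp add: power_mult[symmetric] mult_ac)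
      finally show "ennreal (psi k x ^ 4) \<le>
          ennreal (real K ^ (4 * e * K) * B ^ (4 * K)) * ennreal (exp (\<theta> * \<bar>x\<bar>))"
        using B by (simp add: ennreal_mult[symmetric] ennreal_leI)
    qed
    also have "\<dots> = ennreal (real K ^ (4 * e * K) * B ^ (4 * K)) * (\<integral>\<^sup>+x. ennreal (exp (\<theta> * \<bar>x\<bar>)) \<partial>L)"
      by (rule nn_integral_cmult) measurable
    also have "\<dots> \<le> ennreal (real K ^ (4 * e * K) * B ^ (4 * K)) * ennreal m"
      by (intro mult_left_mono m) simp
    also have "\<dots> \<le> ennreal (real K ^ (4 * e * K) * B ^ (4 * K) * m ^ K)"
      using B m self_le_power[OF m(1), of K] K
      by (simp add: ennreal_mult[symmetric] ennreal_leI mult_left_mono)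
    also have "real K ^ (4 * e * K) * B ^ (4 * K) * m ^ K = (m * B ^ 4) ^ K * real K ^ (4 * e * K)"
      by (simp add: power_mult_distrib power_mult)
    finally show "(\<integral>\<^sup>+x. ennreal (psi k x ^ 4) \<partial>L) \<le>
        ennreal ((m * B ^ 4) ^ K * real K ^ (4 * e * K))" .
  qed
qed

text \<open>On each of the sets that are charged, \<open>p\<^sup>2\<close> attains a minimum, and this minimum times the mass
  of the set is at most \<open>E p\<^sup>2\<close>. These minimisers are the points for \<open>coeff_abs_le\<close>; they depend on
  \<open>p\<close>, which does no harm since that bound is uniform in them.\<close>
lemma coeff_sq_sum_le:
  assumes L[measurable_cong]: "sets L = sets borel" and "charges_separated_sets L v"
  shows "\<exists>c\<ge>1. \<forall>K\<ge>1. \<forall>a. ennreal (\<Sum>k\<le>K. (a k)\<^sup>2) \<le>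
    ennreal (c ^ K * real K ^ ((2 + v) * K)) * (\<integral>\<^sup>+x. ennreal ((\<Sum>k\<le>K. a k * psi k x)\<^sup>2) \<partial>L)"
proof -
  obtain c where c: "c \<ge> 1" and charges: "\<And>K. K \<ge> 1 \<Longrightarrow> \<exists>I \<delta> \<pi>. separated_charge L K I \<delta> \<pi> \<and>
     1 / \<pi> * (1 / \<delta>) ^ (2 * K) \<le> c ^ K * real K ^ (v * K)"
    using assms unfolding charges_separated_sets_def by blast
  define H where "H = 2 * C\<^sup>2 * (2 * (C + 3) * exp 1)"
  have H: "H \<ge> 1"
  proof -
    have "1 \<le> C\<^sup>2"
      using C_ge_1 by (rule one_le_power)
    moreover have "1 \<le> 2 * (C + 3) * exp (1::real)"
      using C_ge_1 mult_mono[of 1 "2 * (C + 3)" 1 "exp 1"] by simp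
    ultimately have "1 * 1 \<le> (2 * C\<^sup>2) * (2 * (C + 3) * exp 1)"
      by (intro mult_mono) auto
    thus ?thesis by (simp add: H_def)
  qed
  show ?thesis
  proof (intro exI[of _ "2 * H\<^sup>2 * c"] conjI allI impI)
    have "1 \<le> H\<^sup>2"
      using H by (rule one_le_power)
    hence "1 * 1 \<le> 2 * H\<^sup>2 * c"
      using c by (intro mult_mono) auto
    thus "1 \<le> 2 * H\<^sup>2 * c" by simp
    fix K :: nat and a :: "nat \<Rightarrow> real" assume K: "1 \<le> K"
    define p where "p x = (\<Sum>k\<le>K. a k * psi k x)" for x
    have cont: "continuous_on A p" for A
      unfolding p_def by (intro continuous_intros continuous_psi)
    have p_meas[measurable]: "p \<in> borel_measurable borel"
      unfolding p_def by measurable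
    define J where "J = (\<integral>\<^sup>+x. ennreal ((p x)\<^sup>2) \<partial>L)"
    have "ennreal (\<Sum>k\<le>K. (a k)\<^sup>2) \<le> ennreal ((2 * H\<^sup>2 * c) ^ K * real K ^ ((2 + v) * K)) * J"
    proof (cases "J = \<infinity>")
      case True
      define W where "W = (2 * H\<^sup>2 * c) ^ K * real K ^ ((2 + v) * K)"
      have "W > 0"
        unfolding W_def using c H K by (intro mult_pos_pos zero_less_power) auto
      hence "ennreal W * J = \<infinity>"
        using True by (simp add: ennreal_mult_eq_top_iff)
      thus ?thesis unfolding W_def[symmetric] by simp
    next
      case False
      define j where "j = enn2real J"
      have "J < \<infinity>"
        using False by (simp add: less_top)
      hence j: "J = ennreal j" "j \<ge> 0"
        by (simp_all add: j_def)
      obtain I \<delta> \<pi> where charge: "separated_charge L K I \<delta> \<pi>"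
        and bound: "1 / \<pi> * (1 / \<delta>) ^ (2 * K) \<le> c ^ K * real K ^ (v * K)"
        using charges[OF K] by blast
      have \<delta>: "\<delta> > 0" and \<pi>: "\<pi> > 0"
        using charge by (auto simp: separated_charge_def)
      have I: "compact (I l)" "I l \<noteq> {}" "I l \<subseteq> {- 2 * real K..2 * real K}"
          "ennreal \<pi> \<le> emeasure L (I l)" if "l \<le> K" for l
        using charge that by (auto simp: separated_charge_def)
      have sep: "\<delta> * (real l - real i) \<le> x - u" if "l \<le> K" "i < l" "u \<in> I i" "x \<in> I l" for l i u x
        using charge that unfolding separated_charge_def by blast
      have "\<exists>x\<in>I l. \<forall>u\<in>I l. \<bar>p x\<bar> \<le> \<bar>p u\<bar>" if "l \<le> K" for l
        using I(1,2)[OF that] by (intro continuous_attains_inf continuous_on_rabs cont)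
      then obtain x where x: "\<And>l. l \<le> K \<Longrightarrow> x l \<in> I l"
        and x_min: "\<And>l u. l \<le> K \<Longrightarrow> u \<in> I l \<Longrightarrow> \<bar>p (x l)\<bar> \<le> \<bar>p u\<bar>"
        by metis
      have px: "\<bar>p (x l)\<bar> \<le> sqrt (j / \<pi>)" if l: "l \<le> K" for l
      proof -
        have "I l \<in> sets borel"
          using I(1)[OF l] by (intro borel_closed compact_imp_closed)
        hence [measurable]: "I l \<in> sets L"
          by (simp add: L)
        have "ennreal ((p (x l))\<^sup>2 * \<pi>) = ennreal ((p (x l))\<^sup>2) * ennreal \<pi>"
          using \<pi> by (simp add: ennreal_mult)
        also have "\<dots> \<le> ennreal ((p (x l))\<^sup>2) * emeasure L (I l)"
          by (intro mult_left_mono I l) simp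
        also have "\<dots> = (\<integral>\<^sup>+u. ennreal ((p (x l))\<^sup>2) * indicator (I l) u \<partial>L)"
          by (simp add: nn_integral_cmult_indicator)
        also have "\<dots> \<le> J"
          unfolding J_def
        proof (intro nn_integral_mono)
          fix u
          have "(p (x l))\<^sup>2 \<le> (p u)\<^sup>2" if "u \<in> I l"
            using x_min[OF l that] by (simp add: abs_le_square_iff)
          thus "ennreal ((p (x l))\<^sup>2) * indicator (I l) u \<le> ennreal ((p u)\<^sup>2)"
            by (auto simp: indicator_def ennreal_leI)
        qed
        finally have "(p (x l))\<^sup>2 * \<pi> \<le> j"
          using j by simp
        hence "(p (x l))\<^sup>2 \<le> j / \<pi>"
          using \<pi> by (simp add: field_simps)
        hence "sqrt ((p (x l))\<^sup>2) \<le> sqrt (j / \<pi>)"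
          by (rule real_sqrt_le_mono)
        thus ?thesis by simp
      qed
      have ak: "(a k)\<^sup>2 \<le> (H\<^sup>2 * c) ^ K * real K ^ ((2 + v) * K) * j" if k: "k \<le> K" for k
      proof -
        have "\<bar>a k\<bar> \<le> sqrt (j / \<pi>) * (H * real K / \<delta>) ^ K"
          unfolding H_def
        proof (rule coeff_abs_le[OF K k \<delta>])
          show "\<bar>x l\<bar> \<le> 2 * real K" if "l \<le> K" for l
          proof -
            have "x l \<in> {- 2 * real K..2 * real K}"
              using x[OF that] I(3)[OF that] by blast
            thus ?thesis by (simp add: abs_le_iff)
          qed
          show "\<delta> * (real l - real i) \<le> x l - x i" if "i < l" "l \<le> K" for l i
            using that x by (intro sep) auto
          show "\<bar>\<Sum>k\<le>K. a k * psi k (x l)\<bar> \<le> sqrt (j / \<pi>)" if "l \<le> K" for l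
            using px[OF that] by (simp add: p_def)
        qed
        hence "\<bar>a k\<bar>\<^sup>2 \<le> (sqrt (j / \<pi>) * (H * real K / \<delta>) ^ K)\<^sup>2"
          by (intro power_mono) auto
        also have "\<dots> = j / \<pi> * ((H * real K / \<delta>) ^ K)\<^sup>2"
          using j \<pi> by (simp add: power_mult_distrib)
        also have "((H * real K / \<delta>) ^ K)\<^sup>2 = (H ^ K)\<^sup>2 * (real K ^ K)\<^sup>2 * (1 / \<delta>) ^ (2 * K)"
          by (simp add: power_mult_distrib power_divide power_mult[symmetric] mult.commute)
        also have "j / \<pi> * ((H ^ K)\<^sup>2 * (real K ^ K)\<^sup>2 * (1 / \<delta>) ^ (2 * K)) =
            j * ((H ^ K)\<^sup>2 * (real K ^ K)\<^sup>2) * (1 / \<pi> * (1 / \<delta>) ^ (2 * K))"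
          by simp
        also have "\<dots> \<le> j * ((H ^ K)\<^sup>2 * (real K ^ K)\<^sup>2) * (c ^ K * real K ^ (v * K))"
          using j by (intro mult_left_mono bound) auto
        also have "\<dots> = (H\<^sup>2 * c) ^ K * real K ^ ((2 + v) * K) * j"
        proof -
          have "(real K ^ K)\<^sup>2 = real K ^ (2 * K)" "(H ^ K)\<^sup>2 = (H\<^sup>2) ^ K"
            by (simp_all add: power_mult[symmetric] mult.commute)
          thus ?thesis
            unfolding power_mult_distrib distrib_right power_add by simp
        qed
        finally show ?thesis by simp
      qed
      have "(\<Sum>k\<le>K. (a k)\<^sup>2) \<le> (\<Sum>k\<le>K. (H\<^sup>2 * c) ^ K * real K ^ ((2 + v) * K) * j)"
        by (intro sum_mono ak) simp
      also have "\<dots> = real (Suc K) * ((H\<^sup>2 * c) ^ K * real K ^ ((2 + v) * K) * j)"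
        by simp
      also have "\<dots> \<le> 2 ^ K * ((H\<^sup>2 * c) ^ K * real K ^ ((2 + v) * K) * j)"
        using c j by (intro mult_right_mono Suc_le_two_power) auto
      also have "\<dots> = (2 * H\<^sup>2 * c) ^ K * real K ^ ((2 + v) * K) * j"
        by (simp add: power_mult_distrib)
      finally show ?thesis
        using c j by (simp add: ennreal_mult[symmetric] ennreal_leI)
    qed
    thus "ennreal (\<Sum>k\<le>K. (a k)\<^sup>2) \<le> ennreal ((2 * H\<^sup>2 * c) ^ K * real K ^ ((2 + v) * K)) *
        (\<integral>\<^sup>+x. ennreal ((\<Sum>k\<le>K. a k * psi k x)\<^sup>2) \<partial>L)"
      by (simp add: J_def p_def)
  qed
qed

end

text \<open>All that the analysis of the algorithm uses about the four processes: fourth moments of the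
  basis functions and coercivity of the Gram matrix, up to geometric factors in \<open>K\<close>.\<close>
definition basis_bounds :: "levy_model \<Rightarrow> real \<Rightarrow> nat \<Rightarrow> real \<Rightarrow> bool" where
  "basis_bounds P t K c \<longleftrightarrow>
    (\<forall>k\<le>K. (\<integral>\<^sup>+x. ennreal (basis_fun P t k x ^ 4) \<partial>marginal_law P t)
        \<le> ennreal (c ^ K * real K ^ (4 * degree_growth P * K))) \<and>
    (\<forall>a. ennreal (\<Sum>k\<le>K. (a k)\<^sup>2) \<le> ennreal (c ^ K * real K ^ ((2 + sampling_growth P) * K)) *
        (\<integral>\<^sup>+x. ennreal ((\<Sum>k\<le>K. a k * basis_fun P t k x)\<^sup>2) \<partial>marginal_law P t))"

lemma basis_boundsI:
  assumes moment: "\<And>k. k \<le> K \<Longrightarrow> (\<integral>\<^sup>+x. ennreal (basis_fun P t k x ^ 4) \<partial>marginal_law P t)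
        \<le> ennreal (c1 ^ K * real K ^ (4 * degree_growth P * K))"
    and coercive: "\<And>a. ennreal (\<Sum>k\<le>K. (a k)\<^sup>2) \<le>
        ennreal (c2 ^ K * real K ^ ((2 + sampling_growth P) * K)) *
        (\<integral>\<^sup>+x. ennreal ((\<Sum>k\<le>K. a k * basis_fun P t k x)\<^sup>2) \<partial>marginal_law P t)"
    and "0 \<le> c1" "c1 \<le> c" "0 \<le> c2" "c2 \<le> c"
  shows "basis_bounds P t K c"
proof -
  have up: "ennreal (c1 ^ K * real K ^ j) \<le> ennreal (c ^ K * real K ^ j)"
    "ennreal (c2 ^ K * real K ^ j) \<le> ennreal (c ^ K * real K ^ j)" for j
    using assms(3-) by (auto intro!: ennreal_leI mult_right_mono power_mono)
  show ?thesis
    unfolding basis_bounds_def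
  proof (intro conjI allI impI)
    fix k assume "k \<le> K"
    from moment[OF this] up(1) show "(\<integral>\<^sup>+x. ennreal (basis_fun P t k x ^ 4) \<partial>marginal_law P t)
        \<le> ennreal (c ^ K * real K ^ (4 * degree_growth P * K))"
      by (rule order_trans)
  next
    fix a
    show "ennreal (\<Sum>k\<le>K. (a k)\<^sup>2) \<le> ennreal (c ^ K * real K ^ ((2 + sampling_growth P) * K)) *
        (\<integral>\<^sup>+x. ennreal ((\<Sum>k\<le>K. a k * basis_fun P t k x)\<^sup>2) \<partial>marginal_law P t)"
      by (rule order_trans[OF coercive mult_right_mono[OF up(2)]]) simp
  qed
qed

lemma basis_bounds_mono:
  assumes "basis_bounds P t K c" "0 \<le> c" "c \<le> c'"
  shows "basis_bounds P t K c'"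
  using assms unfolding basis_bounds_def[of P t K c] by (intro basis_boundsI[of K P t c c]) auto

lemma basis_bounds_at_date:
  assumes P: "valid_model P" and t: "t > 0" and prob: "\<And>s. s > 0 \<Longrightarrow> prob_space (marginal_law P s)"
  shows "\<exists>c\<ge>1. \<forall>K\<ge>1. basis_bounds P t K c"
proof -
  obtain sg w rho y C where nb: "newton_basis (basis_fun P t) sg w rho y C"
    and sg: "\<And>K k. 1 \<le> K \<Longrightarrow> k \<le> K \<Longrightarrow> sg k \<le> real K ^ (degree_growth P * K)"
    using basis_newton[OF P t] by blast
  have sets: "sets (marginal_law P t) = sets borel"
    by (cases P) auto
  note moment = newton_basis.fourth_moment_le[OF nb sets prob[OF t] law_exp_moment[OF P t prob] sg]
  note coercive = newton_basis.coeff_sq_sum_le[OF nb sets law_charges[OF P t]]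
  from moment obtain c1 where c1: "c1 \<ge> 1" "\<forall>K\<ge>1. \<forall>k\<le>K.
      (\<integral>\<^sup>+x. ennreal (basis_fun P t k x ^ 4) \<partial>marginal_law P t)
        \<le> ennreal (c1 ^ K * real K ^ (4 * degree_growth P * K))"
    by blast
  from coercive obtain c2 where c2: "c2 \<ge> 1" "\<forall>K\<ge>1. \<forall>a.
      ennreal (\<Sum>k\<le>K. (a k)\<^sup>2) \<le> ennreal (c2 ^ K * real K ^ ((2 + sampling_growth P) * K)) *
        (\<integral>\<^sup>+x. ennreal ((\<Sum>k\<le>K. a k * basis_fun P t k x)\<^sup>2) \<partial>marginal_law P t)"
    by blast
  have "basis_bounds P t K (max c1 c2)" if "1 \<le> K" for K
    using c1 c2 that by (intro basis_boundsI[of K P t c1 c2]) auto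
  moreover have "1 \<le> max c1 c2"
    using c1(1) by simp
  ultimately show ?thesis by blast
qed

lemma basis_fun_measurable:
  assumes "valid_model P" "t > 0"
  shows "basis_fun P t k \<in> borel_measurable borel"
  using basis_newton[OF assms] newton_basis.psi_measurable by blast

section \<open>Exact and sampled regression\<close>

lemma nn_integral_product_le:
  fixes f g :: "'a \<Rightarrow> real"
  assumes [measurable]: "f \<in> borel_measurable M" "g \<in> borel_measurable M"
    and "(\<integral>\<^sup>+x. ennreal ((f x)\<^sup>2) \<partial>M) \<le> B" "(\<integral>\<^sup>+x. ennreal ((g x)\<^sup>2) \<partial>M) \<le> B"
  shows "(\<integral>\<^sup>+x. ennreal (f x * g x) \<partial>M) \<le> B"
proof -
  have "2 * (\<integral>\<^sup>+x. ennreal (f x * g x) \<partial>M) = (\<integral>\<^sup>+x. 2 * ennreal (f x * g x) \<partial>M)"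
    by (rule nn_integral_cmult[symmetric]) measurable
  also have "\<dots> \<le> (\<integral>\<^sup>+x. ennreal ((f x)\<^sup>2) + ennreal ((g x)\<^sup>2) \<partial>M)"
  proof (rule nn_integral_mono)
    fix x
    have "2 * ennreal (f x * g x) = ennreal (2 * f x * g x)"
      by (simp add: ennreal_mult' mult.assoc)
    also have "\<dots> \<le> ennreal ((f x)\<^sup>2 + (g x)\<^sup>2)"
      by (intro ennreal_leI sum_squares_bound)
    finally show "2 * ennreal (f x * g x) \<le> ennreal ((f x)\<^sup>2) + ennreal ((g x)\<^sup>2)"
      by simp
  qed
  also have "\<dots> = (\<integral>\<^sup>+x. ennreal ((f x)\<^sup>2) \<partial>M) + (\<integral>\<^sup>+x. ennreal ((g x)\<^sup>2) \<partial>M)"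
    by (rule nn_integral_add) measurable
  also have "\<dots> \<le> B + B"
    by (intro add_mono assms)
  finally have "2 * (\<integral>\<^sup>+x. ennreal (f x * g x) \<partial>M) \<le> 2 * B"
    by (simp add: mult_2)
  thus ?thesis
    by (subst (asm) ennreal_mult_le_mult_iff) auto
qed

text \<open>The algorithm for fixed \<open>K\<close>, \<open>N\<close> and payoffs \<open>h\<close>, the final one included. The constant \<open>\<Lambda>\<close>
  bounds the inverse Gram matrices and \<open>T\<close> the fourth moments, at all dates.\<close>
locale ls_setup = M: prob_space M + Q: prob_space Q
  for M :: "'a measure" and Q :: "'b measure" +
  fixes P :: levy_model
    and S :: "real \<Rightarrow> 'a \<Rightarrow> real"
    and t :: "nat \<Rightarrow> real"
    and m K N :: nat
    and h :: "nat \<Rightarrow> real \<Rightarrow> real"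
    and X :: "nat \<Rightarrow> nat \<Rightarrow> nat \<Rightarrow> 'b \<Rightarrow> real"
    and \<Lambda> T :: real
  assumes N: "1 \<le> N"
    and \<Lambda>: "1 \<le> \<Lambda>" and T: "1 \<le> T"
    and samples: "sample_paths M S t m N Q X"
    and S_meas: "\<And>n. n \<in> {1..m} \<Longrightarrow> S (t n) \<in> borel_measurable M"
    and h_meas: "\<And>n. n \<in> {1..m} \<Longrightarrow> h n \<in> borel_measurable borel"
    and psi_meas: "\<And>n k. n \<in> {1..m} \<Longrightarrow> basis_fun P (t n) k \<in> borel_measurable borel"
    and h_moment: "\<And>n. n \<in> {1..m} \<Longrightarrow> (\<integral>\<^sup>+\<omega>. ennreal (h n (S (t n) \<omega>) ^ 4) \<partial>M) \<le> ennreal T"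
    and psi_moment: "\<And>n. n \<in> {1..m} \<Longrightarrow>
      (\<integral>\<^sup>+\<omega>. ennreal ((\<Sum>k\<le>K. (basis_fun P (t n) k (S (t n) \<omega>))\<^sup>2)\<^sup>2) \<partial>M) \<le> ennreal T"
    and coercive: "\<And>n a. n \<in> {1..m} \<Longrightarrow> ennreal (\<Sum>k\<le>K. (a k)\<^sup>2) \<le>
      ennreal \<Lambda> * (\<integral>\<^sup>+\<omega>. ennreal ((\<Sum>k\<le>K. a k * basis_fun P (t n) k (S (t n) \<omega>))\<^sup>2) \<partial>M)"
begin

abbreviation psi :: "nat \<Rightarrow> nat \<Rightarrow> real \<Rightarrow> real" where
  "psi n k x \<equiv> basis_fun P (t n) k x"

definition psi_sq :: "nat \<Rightarrow> real \<Rightarrow> real" where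
  "psi_sq n x = (\<Sum>k\<le>K. (psi n k x)\<^sup>2)"

lemma psi_sq_nonneg: "psi_sq n x \<ge> 0"
  by (simp add: psi_sq_def sum_nonneg)

lemma psi_sq_meas: "n \<in> {1..m} \<Longrightarrow> psi_sq n \<in> borel_measurable borel"
  unfolding psi_sq_def using psi_meas by measurable

lemma cauchy_schwarz: "(\<Sum>k\<le>K. a k * psi n k x)\<^sup>2 \<le> (\<Sum>k\<le>K. (a k)\<^sup>2) * psi_sq n x"
  unfolding psi_sq_def by (rule Cauchy_Schwarz_ineq_sum)

lemma psi_sq_product_integral:
  assumes n: "n \<in> {1..m}" "n' \<in> {1..m}"
  shows "(\<integral>\<^sup>+\<omega>. ennreal (psi_sq n (S (t n) \<omega>) * psi_sq n' (S (t n') \<omega>)) \<partial>M) \<le> ennreal T"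
proof -
  note [measurable] = psi_sq_meas[OF n(1)] psi_sq_meas[OF n(2)] S_meas[OF n(1)] S_meas[OF n(2)]
  show ?thesis
    using psi_moment[OF n(1)] psi_moment[OF n(2)]
    by (intro nn_integral_product_le) (simp_all add: psi_sq_def[symmetric])
qed

lemma h_psi_sq_product_integral:
  assumes n: "n \<in> {1..m}" "n' \<in> {1..m}"
  shows "(\<integral>\<^sup>+\<omega>. ennreal ((h n (S (t n) \<omega>))\<^sup>2 * psi_sq n' (S (t n') \<omega>)) \<partial>M) \<le> ennreal T"
proof -
  note [measurable] = h_meas[OF n(1)] psi_sq_meas[OF n(2)] S_meas[OF n(1)] S_meas[OF n(2)]
  show ?thesis
    using h_moment[OF n(1)] psi_moment[OF n(2)]
    by (intro nn_integral_product_le) (simp_all add: psi_sq_def[symmetric] power_mult[symmetric])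
qed

lemma psi_sq_le: "k \<le> K \<Longrightarrow> (psi n k x)\<^sup>2 \<le> psi_sq n x"
  unfolding psi_sq_def by (rule member_le_sum) auto

lemma integrable_if_sq_le:
  assumes f: "f \<in> borel_measurable M" and le: "(\<integral>\<^sup>+\<omega>. ennreal ((f \<omega>)\<^sup>2) \<partial>M) < \<infinity>"
  shows "integrable M (\<lambda>\<omega>. (f \<omega>)\<^sup>2)" "integrable M f"
proof -
  show *: "integrable M (\<lambda>\<omega>. (f \<omega>)\<^sup>2)"
    using f le by (intro integrableI_nonneg) auto
  show "integrable M f"
    by (rule M.square_integrable_imp_integrable[OF f *])
qed

lemma psi_integrable:
  assumes n: "n \<in> {1..m}" and "j \<le> K" "k \<le> K"
  shows "integrable M (\<lambda>\<omega>. psi n j (S (t n) \<omega>) * psi n k (S (t n) \<omega>))"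
proof -
  note [measurable] = psi_meas[OF n] S_meas[OF n]
  have "(\<integral>\<^sup>+\<omega>. ennreal ((psi n j (S (t n) \<omega>) * psi n k (S (t n) \<omega>))\<^sup>2) \<partial>M) \<le>
     (\<integral>\<^sup>+\<omega>. ennreal (psi_sq n (S (t n) \<omega>) * psi_sq n (S (t n) \<omega>)) \<partial>M)"
    using assms by (intro nn_integral_mono ennreal_leI)
      (simp add: power_mult_distrib mult_mono psi_sq_le psi_sq_nonneg)
  also have "\<dots> \<le> ennreal T"
    by (rule psi_sq_product_integral[OF n n])
  finally have "(\<integral>\<^sup>+\<omega>. ennreal ((psi n j (S (t n) \<omega>) * psi n k (S (t n) \<omega>))\<^sup>2) \<partial>M) < \<infinity>"
    by (auto intro: order_le_less_trans)
  thus ?thesis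
    by (intro integrable_if_sq_le(2)) measurable
qed

definition G :: "nat \<Rightarrow> real mat" where "G n = gram_mat P M S K (t n)"

definition Ginv :: "nat \<Rightarrow> real mat" where "Ginv n = gram_inv P M S K (t n)"

lemma G_carrier: "G n \<in> carrier_mat (Suc K) (Suc K)"
  by (simp add: G_def gram_mat_def)

lemma mult_mat_vec_index:
  assumes "A \<in> carrier_mat (Suc K) (Suc K)" "v \<in> carrier_vec (Suc K)" "j \<le> K"
  shows "vec_index (mult_mat_vec A v) j = (\<Sum>k\<le>K. index_mat A (j, k) * vec_index v k)"
  using assms by (simp add: scalar_prod_def atLeast0LessThan lessThan_Suc_atMost)

text \<open>The quadratic form of the Gram matrix is \<open>E (\<Sum>k\<le>K. w\<^sub>k \<psi>\<^sub>k)\<^sup>2\<close>, so coercivity is a lower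
  bound for it. Invertibility and the norm of the inverse both follow from this inequality.\<close>
lemma quadratic_form:
  assumes n: "n \<in> {1..m}" and w: "w \<in> carrier_vec (Suc K)"
  shows "(\<Sum>k\<le>K. (vec_index w k)\<^sup>2) \<le> \<Lambda> * (\<Sum>j\<le>K. vec_index w j * vec_index (mult_mat_vec (G n) w) j)"
proof -
  let ?a = "vec_index w" and ?p = "\<lambda>k \<omega>. psi n k (S (t n) \<omega>)"
  have int: "integrable M (\<lambda>\<omega>. ?a j * ?a k * (?p j \<omega> * ?p k \<omega>))" if "j \<le> K" "k \<le> K" for j k
    using psi_integrable[OF n that] by (rule integrable_mult_right)
  have sq: "(\<Sum>k\<le>K. ?a k * ?p k \<omega>)\<^sup>2 = (\<Sum>j\<le>K. \<Sum>k\<le>K. ?a j * ?a k * (?p j \<omega> * ?p k \<omega>))" for \<omega>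
    unfolding power2_eq_square sum_product by (intro sum.cong refl) (simp add: mult_ac)
  have int_sq: "integrable M (\<lambda>\<omega>. (\<Sum>k\<le>K. ?a k * ?p k \<omega>)\<^sup>2)"
    unfolding sq using int by (intro Bochner_Integration.integrable_sum) auto
  have "(\<integral>\<omega>. (\<Sum>k\<le>K. ?a k * ?p k \<omega>)\<^sup>2 \<partial>M) = (\<Sum>j\<le>K. \<Sum>k\<le>K. ?a j * ?a k * (\<integral>\<omega>. ?p j \<omega> * ?p k \<omega> \<partial>M))"
  proof -
    have "(\<integral>\<omega>. (\<Sum>k\<le>K. ?a k * ?p k \<omega>)\<^sup>2 \<partial>M) = (\<Sum>j\<le>K. \<integral>\<omega>. (\<Sum>k\<le>K. ?a j * ?a k * (?p j \<omega> * ?p k \<omega>)) \<partial>M)"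
      unfolding sq
      by (rule Bochner_Integration.integral_sum, rule Bochner_Integration.integrable_sum, rule
          int) simp_all
    also have "\<dots> = (\<Sum>j\<le>K. \<Sum>k\<le>K. \<integral>\<omega>. ?a j * ?a k * (?p j \<omega> * ?p k \<omega>) \<partial>M)"
      by (intro sum.cong refl, rule Bochner_Integration.integral_sum, rule int) simp_all
    finally show ?thesis
      by simp
  qed
  also have "\<dots> = (\<Sum>j\<le>K. ?a j * vec_index (mult_mat_vec (G n) w) j)"
  proof (intro sum.cong refl)
    fix j assume j: "j \<in> {..K}"
    have "index_mat (G n) (j, k) = (\<integral>\<omega>. ?p j \<omega> * ?p k \<omega> \<partial>M)" if "k \<le> K" for k
      using j that by (simp add: G_def gram_mat_def)
    thus "(\<Sum>k\<le>K. ?a j * ?a k * (\<integral>\<omega>. ?p j \<omega> * ?p k \<omega> \<partial>M)) =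
        ?a j * vec_index (mult_mat_vec (G n) w) j"
      using mult_mat_vec_index[OF G_carrier w, of j n] j by (simp add: sum_distrib_left mult_ac)
  qed
  finally have eq: "(\<integral>\<omega>. (\<Sum>k\<le>K. ?a k * ?p k \<omega>)\<^sup>2 \<partial>M) =
      (\<Sum>j\<le>K. ?a j * vec_index (mult_mat_vec (G n) w) j)" .
  have "ennreal (\<Sum>k\<le>K. (?a k)\<^sup>2) \<le> ennreal \<Lambda> * ennreal (\<integral>\<omega>. (\<Sum>k\<le>K. ?a k * ?p k \<omega>)\<^sup>2 \<partial>M)"
    using coercive[OF n, of ?a] int_sq by (subst nn_integral_eq_integral[symmetric]) auto
  also have "\<dots> = ennreal (\<Lambda> * (\<Sum>j\<le>K. ?a j * vec_index (mult_mat_vec (G n) w) j))"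
    using \<Lambda> unfolding eq[symmetric] by (subst ennreal_mult) auto
  finally show ?thesis
  proof (subst (asm) ennreal_le_iff)
    show "0 \<le> \<Lambda> * (\<Sum>j\<le>K. ?a j * vec_index (mult_mat_vec (G n) w) j)"
      using \<Lambda> unfolding eq[symmetric] by simp
  qed
qed

lemma Ginv:
  assumes n: "n \<in> {1..m}"
  shows "Ginv n \<in> carrier_mat (Suc K) (Suc K)" "G n * Ginv n = 1\<^sub>m (Suc K)"
proof -
  have "Determinant.det (G n) \<noteq> 0"
  proof
    assume "Determinant.det (G n) = 0"
    then obtain v where v: "v \<in> carrier_vec (Suc K)" "v \<noteq> 0\<^sub>v (Suc K)" "mult_mat_vec (G n) v =
        0\<^sub>v (Suc K)"
      using det_0_iff_vec_prod_zero[OF G_carrier] by blast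
    have "(\<Sum>k\<le>K. (vec_index v k)\<^sup>2) \<le> 0"
      using quadratic_form[OF n v(1)] by (simp add: v(3))
    hence "(\<Sum>k\<le>K. (vec_index v k)\<^sup>2) = 0"
      by (intro antisym sum_nonneg) auto
    hence "\<forall>k\<le>K. vec_index v k = 0"
      by (subst (asm) sum_nonneg_eq_0_iff) auto
    hence "v = 0\<^sub>v (Suc K)"
      using v(1) by (intro eq_vecI) auto
    thus False using v(2) by simp
  qed
  hence unit: "G n \<in> Units (ring_mat TYPE(real) (Suc K) ())"
    by (rule det_non_zero_imp_unit[OF G_carrier])
  then obtain B where B: "mat_inverse (G n) = Some B"
    using mat_inverse(1)[OF G_carrier, of n "()"] by (cases "mat_inverse (G n)") auto
  have "Ginv n = B"
    by (simp add: Ginv_def gram_inv_def G_def[symmetric] B)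
  thus "Ginv n \<in> carrier_mat (Suc K) (Suc K)" "G n * Ginv n = 1\<^sub>m (Suc K)"
    using mat_inverse(2)[OF G_carrier B] by auto
qed

definition gi :: "nat \<Rightarrow> (nat \<Rightarrow> real) \<Rightarrow> nat \<Rightarrow> real" where
  "gi n v k = (\<Sum>l\<le>K. index_mat (Ginv n) (k, l) * v l)"

lemma gi_index:
  assumes "n \<in> {1..m}" "k \<le> K"
  shows "vec_index (mult_mat_vec (gram_inv P M S K (t n)) (vec (Suc K) v)) k = gi n v k"
  using mult_mat_vec_index[OF Ginv(1)[OF assms(1)], of "vec (Suc K) v" k] assms
  by (simp add: gi_def Ginv_def)

lemma gi_diff: "gi n u k - gi n v k = gi n (\<lambda>l. u l - v l) k"
  by (simp add: gi_def sum_subtractf right_diff_distrib)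

text \<open>For \<open>w = G\<^bsup>-1\<^esup> v\<close>, coercivity and the Cauchy--Schwarz inequality give
  \<open>\<bar>w\<bar>\<^sup>2 \<le> \<Lambda> (w \<bullet> v) \<le> \<Lambda> \<bar>w\<bar> \<bar>v\<bar>\<close>.\<close>
lemma gi_sq_sum_le:
  assumes n: "n \<in> {1..m}"
  shows "(\<Sum>k\<le>K. (gi n v k)\<^sup>2) \<le> \<Lambda>\<^sup>2 * (\<Sum>k\<le>K. (v k)\<^sup>2)"
proof -
  define w where "w = mult_mat_vec (Ginv n) (vec (Suc K) v)"
  have w: "w \<in> carrier_vec (Suc K)"
    using Ginv(1)[OF n] by (auto simp: w_def)
  have wk: "vec_index w k = gi n v k" if "k \<le> K" for k
    using gi_index[OF n that] by (simp add: w_def Ginv_def)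
  have "mult_mat_vec (G n) w = mult_mat_vec (G n * Ginv n) (vec (Suc K) v)"
    unfolding w_def using assoc_mult_mat_vec[OF G_carrier Ginv(1)[OF n], of "vec (Suc K) v"] by simp
  also have "\<dots> = vec (Suc K) v"
    by (simp add: Ginv(2)[OF n])
  finally have Gw: "mult_mat_vec (G n) w = vec (Suc K) v" .
  define a where "a = (\<Sum>k\<le>K. (gi n v k)\<^sup>2)"
  define b where "b = (\<Sum>k\<le>K. (v k)\<^sup>2)"
  have nonneg: "a \<ge> 0" "b \<ge> 0"
    by (auto simp: a_def b_def sum_nonneg)
  have "a \<le> \<Lambda> * (\<Sum>j\<le>K. gi n v j * v j)"
    using quadratic_form[OF n w] by (simp add: Gw wk a_def)
  hence "a\<^sup>2 \<le> (\<Lambda> * (\<Sum>j\<le>K. gi n v j * v j))\<^sup>2"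
    using nonneg by (intro power_mono)
  also have "\<dots> = \<Lambda>\<^sup>2 * (\<Sum>j\<le>K. gi n v j * v j)\<^sup>2"
    by (rule power_mult_distrib)
  also have "\<dots> \<le> \<Lambda>\<^sup>2 * (a * b)"
    unfolding a_def b_def by (intro mult_left_mono Cauchy_Schwarz_ineq_sum) auto
  finally have "a * a \<le> (\<Lambda>\<^sup>2 * b) * a"
    by (simp add: power2_eq_square mult_ac)
  hence "a \<le> \<Lambda>\<^sup>2 * b"
    using nonneg by (cases "a = 0") (auto simp: mult_le_cancel_right)
  thus ?thesis by (simp add: a_def b_def)
qed

text \<open>The value function at date \<open>n\<close> as a function of the regression coefficients \<open>b\<close> at that date.
  At the final date it does not depend on \<open>b\<close>.\<close>
definition val :: "(nat \<Rightarrow> real) \<Rightarrow> nat \<Rightarrow> real \<Rightarrow> real" where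
  "val b n x = (if n < m then max (h n x) (\<Sum>k\<le>K. b k * psi n k x) else h n x)"

definition target :: "nat \<Rightarrow> (nat \<Rightarrow> real) \<Rightarrow> nat \<Rightarrow> real" where
  "target n b k = (\<integral>\<omega>. val b (Suc n) (S (t (Suc n)) \<omega>) * psi n k (S (t n) \<omega>) \<partial>M)"

text \<open>Coefficients are set to 0 from the final date on. Then the recursion has the same form at all
  dates \<open>n < m\<close> and starts from a vanishing error.\<close>
definition exact :: "nat \<Rightarrow> nat \<Rightarrow> real" where
  "exact n k = (if n < m then vec_index (exact_coeff P M S t m K h n) k else 0)"

definition estimate :: "(nat \<Rightarrow> nat \<Rightarrow> nat \<Rightarrow> 'c \<Rightarrow> real) \<Rightarrow> 'c \<Rightarrow> nat \<Rightarrow> nat \<Rightarrow> real" where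
  "estimate Y \<omega> n k = (if n < m then vec_index (estimated_coeff P M S t m K N Y \<omega> h n) k else 0)"

definition sample_mean :: "nat \<Rightarrow> (nat \<Rightarrow> real) \<Rightarrow> (nat \<Rightarrow> real \<times> real) \<Rightarrow> nat \<Rightarrow> real" where
  "sample_mean n b z k =
      (1 / real N) * (\<Sum>i\<in>{1..N}. val b (Suc n) (snd (z i)) * psi n k (fst (z i)))"

lemma scalar_prod_basis_vec:
  "scalar_prod v (basis_vec P K s x) = (\<Sum>k\<le>K. vec_index v k * basis_fun P s k x)"
  by (simp add: scalar_prod_def basis_vec_def atLeast0LessThan lessThan_Suc_atMost)

lemma exact_rec:
  assumes "1 \<le> n" "n < m" "k \<le> K"
  shows "exact n k = gi n (target n (exact (Suc n))) k"
proof -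
  let ?V = "ls_value (exact_regression P M S t K) (\<lambda>n. basis_vec P K (t n)) h m (Suc n)"
  have "?V x = val (exact (Suc n)) (Suc n) x" for x
    by (subst ls_value.simps)
        (simp add: val_def exact_def exact_coeff_def Let_def scalar_prod_basis_vec)
  hence "?V = val (exact (Suc n)) (Suc n)" by blast
  thus ?thesis
    using assms gi_index[of n k]
        by (simp add: exact_def exact_coeff_def Let_def exact_regression_def target_def[abs_def])
qed

lemma estimate_rec:
  assumes "1 \<le> n" "n < m" "k \<le> K"
  shows "estimate Y \<omega> n k =
    gi n (sample_mean n (estimate Y \<omega> (Suc n)) (\<lambda>i. (Y n i n \<omega>, Y n i (Suc n) \<omega>))) k"
proof -
  let ?V = "ls_value (estimated_regression P M S t K N Y \<omega>) (\<lambda>n. basis_vec P K (t n)) h m (Suc n)"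
  have "?V x = val (estimate Y \<omega> (Suc n)) (Suc n) x" for x
    by (subst ls_value.simps)
        (simp add: val_def estimate_def estimated_coeff_def Let_def scalar_prod_basis_vec)
  hence "?V = val (estimate Y \<omega> (Suc n)) (Suc n)" by blast
  thus ?thesis
    using assms gi_index[of n k]
    by (simp add: estimate_def estimated_coeff_def Let_def estimated_regression_def
        sample_mean_def[abs_def])
qed

lemma val_cong: "(\<And>k. k \<le> K \<Longrightarrow> b k = b' k) \<Longrightarrow> val b n x = val b' n x"
  by (simp add: val_def)

text \<open>The estimate at step \<open>n\<close> is a function of the sample sets of the steps \<open>n, \<dots>, m - 1\<close>. This is
  how the independence of the sample sets enters.\<close>
lemma estimate_cong:
  assumes "1 \<le> n"
    and "\<And>n' i j. n \<le> n' \<Longrightarrow> n' < m \<Longrightarrow> i \<in> {1..N} \<Longrightarrow> j \<in> {n', Suc n'} \<Longrightarrow> Y n' i j \<omega> = Y' n' i j \<omega>'"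
    and "k \<le> K"
  shows "estimate Y \<omega> n k = estimate Y' \<omega>' n k"
  using assms
proof (induction "m - n" arbitrary: n k)
  case 0
  thus ?case by (simp add: estimate_def)
next
  case (Suc d)
  have n: "n < m" using Suc by simp
  have IH: "estimate Y \<omega> (Suc n) l = estimate Y' \<omega>' (Suc n) l" if "l \<le> K" for l
    using Suc that by (intro Suc.hyps) auto
  have "sample_mean n (estimate Y \<omega> (Suc n)) (\<lambda>i. (Y n i n \<omega>, Y n i (Suc n) \<omega>)) =
      sample_mean n (estimate Y' \<omega>' (Suc n)) (\<lambda>i. (Y' n i n \<omega>', Y' n i (Suc n) \<omega>'))"
    unfolding sample_mean_def using Suc.prems(2)[of n] n IH
    by (intro ext arg_cong[where f = "\<lambda>s. 1 / real N * s"] sum.cong arg_cong2[where f = "(*)"])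
       (auto intro: val_cong)
  thus ?case
    by (simp only: estimate_rec[OF Suc.prems(1) n Suc.prems(3)])
qed

lemma val_measurable:
  assumes n: "1 \<le> n" "n \<le> m" and b: "\<And>k. k \<le> K \<Longrightarrow> (\<lambda>\<omega>. b \<omega> k) \<in> borel_measurable R"
    and f: "f \<in> borel_measurable R"
  shows "(\<lambda>\<omega>. val (b \<omega>) n (f \<omega>)) \<in> borel_measurable R"
proof -
  have [measurable]: "h n \<in> borel_measurable borel" "\<And>k. psi n k \<in> borel_measurable borel"
    using n h_meas psi_meas by auto
  note [measurable] = f b
  show ?thesis
    unfolding val_def by (cases "n < m") (simp_all, measurable)
qed

lemma estimate_measurable:
  assumes "1 \<le> n"
    and Y: "\<And>n' i j. n \<le> n' \<Longrightarrow> n' < m \<Longrightarrow> i \<in> {1..N} \<Longrightarrow> j \<in> {n', Suc n'} \<Longrightarrow>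
        Y n' i j \<in> borel_measurable R"
    and "k \<le> K"
  shows "(\<lambda>\<omega>. estimate Y \<omega> n k) \<in> borel_measurable R"
  using assms
proof (induction "m - n" arbitrary: n k)
  case 0
  thus ?case by (simp add: estimate_def)
next
  case (Suc d)
  have n: "n < m" using Suc by simp
  have IH: "(\<lambda>\<omega>. estimate Y \<omega> (Suc n) l) \<in> borel_measurable R" if "l \<le> K" for l
    using Suc that by (intro Suc.hyps) auto
  have [measurable]: "psi n k \<in> borel_measurable borel" for k
    using Suc.prems n psi_meas by auto
  have [measurable]: "Y n i n \<in> borel_measurable R" "Y n i (Suc n) \<in> borel_measurable R"
      if "i \<in> {1..N}" for i
    using Suc.prems(2)[of n i] n that by auto
  have [measurable]: "(\<lambda>\<omega>. val (estimate Y \<omega> (Suc n)) (Suc n) (Y n i (Suc n) \<omega>)) \<in> borel_measurable R"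
    if "i \<in> {1..N}" for i
    using n that IH by (intro val_measurable) auto
  have "(\<lambda>\<omega>. gi n (sample_mean n (estimate Y \<omega> (Suc n)) (\<lambda>i. (Y n i n \<omega>, Y n i (Suc n) \<omega>))) k) \<in> borel_measurable R"
    unfolding gi_def sample_mean_def fst_conv snd_conv by measurable
  thus ?case
    by (simp only: estimate_rec[OF Suc.prems(1) n Suc.prems(3)])
qed

end

section \<open>One step of the error recursion\<close>

lemma (in prob_space) expectation_sq_le:
  fixes f :: "'a \<Rightarrow> real"
  assumes "integrable M f" "integrable M (\<lambda>\<omega>. (f \<omega>)\<^sup>2)"
  shows "(expectation f)\<^sup>2 \<le> expectation (\<lambda>\<omega>. (f \<omega>)\<^sup>2)"
  using variance_eq[OF assms] variance_positive[of f] by simp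

text \<open>After centring, the mixed terms in the square of the sum vanish by independence.\<close>
lemma (in prob_space) nn_integral_sample_mean_le:
  fixes Y :: "'i \<Rightarrow> 'a \<Rightarrow> real"
  assumes I: "finite I" "I \<noteq> {}" and indep: "indep_vars (\<lambda>_. borel) Y I"
    and sq: "\<And>i. i \<in> I \<Longrightarrow> integrable M (\<lambda>\<omega>. (Y i \<omega>)\<^sup>2)"
    and mean: "\<And>i. i \<in> I \<Longrightarrow> expectation (Y i) = \<mu>"
    and second: "\<And>i. i \<in> I \<Longrightarrow> expectation (\<lambda>\<omega>. (Y i \<omega>)\<^sup>2) \<le> V"
  shows "(\<integral>\<^sup>+\<omega>. ennreal ((1 / real (card I) * (\<Sum>i\<in>I. Y i \<omega>) - \<mu>)\<^sup>2) \<partial>M) \<le> ennreal (V / real (card I))"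
proof -
  define n where "n = real (card I)"
  have n: "n > 0" using I by (simp add: n_def card_gt_0_iff)
  define Z where "Z i \<omega> = Y i \<omega> - \<mu>" for i \<omega>
  have Y_meas: "Y i \<in> borel_measurable M" if "i \<in> I" for i
    using indep that by (auto simp: indep_vars_def)
  have Y_int: "integrable M (Y i)" if "i \<in> I" for i
    using square_integrable_imp_integrable[OF Y_meas sq] that by blast
  have Z_int: "integrable M (Z i)" if "i \<in> I" for i
    unfolding Z_def using Y_int[OF that] by simp
  have Z_mean: "expectation (Z i) = 0" if "i \<in> I" for i
    unfolding Z_def using Y_int[OF that] mean[OF that] by (simp add: prob_space)
  have indep_Z: "indep_vars (\<lambda>_. borel) Z I"
    unfolding Z_def by (rule indep_vars_compose2[OF indep]) measurable
  have sq_eq: "(Z i \<omega>)\<^sup>2 = (Y i \<omega>)\<^sup>2 - 2 * \<mu> * Y i \<omega> + \<mu>\<^sup>2" for i \<omega>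
    by (simp add: Z_def power2_eq_square algebra_simps)
  have Z_sq_int: "integrable M (\<lambda>\<omega>. Z i \<omega> * Z i \<omega>)" if "i \<in> I" for i
    unfolding power2_eq_square[symmetric] sq_eq using sq[OF that] Y_int[OF that] by simp
  have Z_sq: "expectation (\<lambda>\<omega>. Z i \<omega> * Z i \<omega>) \<le> V" if "i \<in> I" for i
  proof -
    have "expectation (\<lambda>\<omega>. Z i \<omega> * Z i \<omega>) = expectation (\<lambda>\<omega>. (Y i \<omega>)\<^sup>2) - \<mu>\<^sup>2"
      unfolding power2_eq_square[symmetric] sq_eq using sq[OF that] Y_int[OF that] mean[OF that]
      by (simp add: prob_space power2_eq_square)
    thus ?thesis using second[OF that] zero_le_power2[of \<mu>] by linarith
  qed
  have cross: "integrable M (\<lambda>\<omega>. Z i \<omega> * Z j \<omega>)" "expectation (\<lambda>\<omega>. Z i \<omega> * Z j \<omega>) = 0"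
    if "i \<in> I" "j \<in> I" "i \<noteq> j" for i j
  proof -
    have ind: "indep_vars (\<lambda>_. borel) Z {i, j}"
      using that by (intro indep_vars_subset[OF indep_Z]) auto
    have "integrable M (\<lambda>\<omega>. \<Prod>l\<in>{i, j}. Z l \<omega>)"
      using that Z_int by (intro indep_vars_integrable ind) auto
    thus "integrable M (\<lambda>\<omega>. Z i \<omega> * Z j \<omega>)"
      using that by simp
    have "expectation (\<lambda>\<omega>. \<Prod>l\<in>{i, j}. Z l \<omega>) = (\<Prod>l\<in>{i, j}. expectation (Z l))"
      using that Z_int by (intro indep_vars_lebesgue_integral ind) auto
    thus "expectation (\<lambda>\<omega>. Z i \<omega> * Z j \<omega>) = 0"
      using that Z_mean by simp
  qed
  have ZZ: "integrable M (\<lambda>\<omega>. Z i \<omega> * Z j \<omega>)" if "i \<in> I" "j \<in> I" for i j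
    using cross(1)[of i j] Z_sq_int[of i] that by (cases "i = j") auto
  have eq: "1 / n * (\<Sum>i\<in>I. Y i \<omega>) - \<mu> = 1 / n * (\<Sum>i\<in>I. Z i \<omega>)" for \<omega>
    using n by (simp add: Z_def sum_subtractf n_def right_diff_distrib diff_divide_distrib)
  have expand: "(1 / n * (\<Sum>i\<in>I. Z i \<omega>))\<^sup>2 = 1 / n\<^sup>2 * (\<Sum>i\<in>I. \<Sum>j\<in>I. Z i \<omega> * Z j \<omega>)" for \<omega>
    unfolding power_mult_distrib by (simp add: power2_eq_square sum_product)
  have int: "integrable M (\<lambda>\<omega>. (1 / n * (\<Sum>i\<in>I. Z i \<omega>))\<^sup>2)"
    unfolding expand
    by (intro integrable_mult_right Bochner_Integration.integrable_sum ZZ)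
  have "expectation (\<lambda>\<omega>. (1 / n * (\<Sum>i\<in>I. Z i \<omega>))\<^sup>2) =
      1 / n\<^sup>2 * (\<Sum>i\<in>I. \<Sum>j\<in>I. expectation (\<lambda>\<omega>. Z i \<omega> * Z j \<omega>))"
  proof -
    have "expectation (\<lambda>\<omega>. \<Sum>i\<in>I. \<Sum>j\<in>I. Z i \<omega> * Z j \<omega>) =
        (\<Sum>i\<in>I. expectation (\<lambda>\<omega>. \<Sum>j\<in>I. Z i \<omega> * Z j \<omega>))"
      by (intro Bochner_Integration.integral_sum Bochner_Integration.integrable_sum ZZ)
    also have "\<dots> = (\<Sum>i\<in>I. \<Sum>j\<in>I. expectation (\<lambda>\<omega>. Z i \<omega> * Z j \<omega>))"
      by (intro sum.cong refl Bochner_Integration.integral_sum ZZ)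
    finally show ?thesis
      unfolding expand integral_mult_right_zero by simp
  qed
  also have "(\<Sum>i\<in>I. \<Sum>j\<in>I. expectation (\<lambda>\<omega>. Z i \<omega> * Z j \<omega>)) =
      (\<Sum>i\<in>I. \<Sum>j\<in>I. if j = i then expectation (\<lambda>\<omega>. Z i \<omega> * Z i \<omega>) else 0)"
    using cross(2) by (intro sum.cong refl) auto
  also have "\<dots> = (\<Sum>i\<in>I. expectation (\<lambda>\<omega>. Z i \<omega> * Z i \<omega>))"
    using I by (intro sum.cong refl) simp
  also have "1 / n\<^sup>2 * \<dots> \<le> 1 / n\<^sup>2 * (\<Sum>i\<in>I. V)"
    by (intro mult_left_mono sum_mono Z_sq) auto
  also have "\<dots> = V / n"
    using n by (simp add: n_def power2_eq_square)
  finally have "ennreal (expectation (\<lambda>\<omega>. (1 / n * (\<Sum>i\<in>I. Z i \<omega>))\<^sup>2)) \<le> ennreal (V / n)"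
    by (rule ennreal_leI)
  moreover have "(\<integral>\<^sup>+\<omega>. ennreal ((1 / n * (\<Sum>i\<in>I. Z i \<omega>))\<^sup>2) \<partial>M) =
      ennreal (expectation (\<lambda>\<omega>. (1 / n * (\<Sum>i\<in>I. Z i \<omega>))\<^sup>2))"
    by (rule nn_integral_eq_integral[OF int]) simp
  ultimately show ?thesis
    unfolding n_def[symmetric] eq by simp
qed

context ls_setup
begin

abbreviation summand :: "nat \<Rightarrow> (nat \<Rightarrow> real) \<Rightarrow> nat \<Rightarrow> 'a \<Rightarrow> real" where
  "summand n b k \<omega> \<equiv> val b (Suc n) (S (t (Suc n)) \<omega>) * psi n k (S (t n) \<omega>)"

abbreviation sample :: "nat \<Rightarrow> 'b \<Rightarrow> nat \<Rightarrow> real \<times> real" where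
  "sample n \<omega> \<equiv> \<lambda>i. (X n i n \<omega>, X n i (Suc n) \<omega>)"

definition norm_sq :: "(nat \<Rightarrow> real) \<Rightarrow> real" where
  "norm_sq b = (\<Sum>k\<le>K. (b k)\<^sup>2)"

abbreviation deviation :: "nat \<Rightarrow> (nat \<Rightarrow> real) \<Rightarrow> (nat \<Rightarrow> real \<times> real) \<Rightarrow> real" where
  "deviation n b z \<equiv> norm_sq (\<lambda>k. sample_mean n b z k - target n b k)"

lemma norm_sq_nonneg: "norm_sq b \<ge> 0"
  by (simp add: norm_sq_def sum_nonneg)

lemma val_sq_le: "(val b n x)\<^sup>2 \<le> (h n x)\<^sup>2 + norm_sq b * psi_sq n x"
proof -
  have "(max u v)\<^sup>2 \<le> u\<^sup>2 + v\<^sup>2" for u v :: real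
    by (simp add: max_def)
  hence "(max (h n x) (\<Sum>k\<le>K. b k * psi n k x))\<^sup>2 \<le> (h n x)\<^sup>2 + (\<Sum>k\<le>K. b k * psi n k x)\<^sup>2" .
  also have "\<dots> \<le> (h n x)\<^sup>2 + norm_sq b * psi_sq n x"
    unfolding norm_sq_def by (intro add_left_mono cauchy_schwarz)
  finally show ?thesis
    using norm_sq_nonneg psi_sq_nonneg by (simp add: val_def)
qed

text \<open>The function \<open>max u\<close> is 1-Lipschitz, so an error in the continuation value is not enlarged by
  the comparison with the payoff.\<close>
lemma val_diff_sq_le: "(val b n x - val b' n x)\<^sup>2 \<le> norm_sq (\<lambda>k. b k - b' k) * psi_sq n x"
proof (cases "n < m")
  case True
  have "\<bar>max u v - max u v'\<bar> \<le> \<bar>v - v'\<bar>" for u v v' :: real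
    by (simp add: max_def abs_if)
  hence "\<bar>val b n x - val b' n x\<bar> \<le> \<bar>(\<Sum>k\<le>K. b k * psi n k x) - (\<Sum>k\<le>K. b' k * psi n k x)\<bar>"
    using True by (simp add: val_def)
  also have "(\<Sum>k\<le>K. b k * psi n k x) - (\<Sum>k\<le>K. b' k * psi n k x) = (\<Sum>k\<le>K. (b k - b' k) * psi n k x)"
    by (simp add: sum_subtractf left_diff_distrib)
  finally have "(val b n x - val b' n x)\<^sup>2 \<le> (\<Sum>k\<le>K. (b k - b' k) * psi n k x)\<^sup>2"
    by (simp add: abs_le_square_iff)
  also have "\<dots> \<le> norm_sq (\<lambda>k. b k - b' k) * psi_sq n x"
    unfolding norm_sq_def by (rule cauchy_schwarz)
  finally show ?thesis .
qed (simp add: val_def norm_sq_nonneg psi_sq_nonneg)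

lemma val_S_meas:
  assumes "n \<in> {1..m}"
  shows "(\<lambda>\<omega>. val b n (S (t n) \<omega>)) \<in> borel_measurable M"
  using assms by (intro val_measurable S_meas) auto

lemma regression_term_moment:
  assumes n: "1 \<le> n" "n < m"
  shows "(\<Sum>k\<le>K. \<integral>\<^sup>+\<omega>. ennreal ((summand n b k \<omega>)\<^sup>2) \<partial>M)
    \<le> ennreal (T * (1 + norm_sq b))"
proof -
  have d: "n \<in> {1..m}" "Suc n \<in> {1..m}" using n by auto
  note [measurable] = val_S_meas[OF d(2)] psi_meas[OF d(1)] S_meas[OF d(1)] S_meas[OF d(2)]
    h_meas[OF d(2)] psi_sq_meas[OF d(1)] psi_sq_meas[OF d(2)]
  let ?U = "S (t n)" and ?W = "S (t (Suc n))"
  have "(\<Sum>k\<le>K. \<integral>\<^sup>+\<omega>. ennreal ((summand n b k \<omega>)\<^sup>2) \<partial>M) =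
      (\<integral>\<^sup>+\<omega>. (\<Sum>k\<le>K. ennreal ((summand n b k \<omega>)\<^sup>2)) \<partial>M)"
    by (rule nn_integral_sum[symmetric]) measurable
  also have "\<dots> \<le> (\<integral>\<^sup>+\<omega>. ennreal ((h (Suc n) (?W \<omega>))\<^sup>2 * psi_sq n (?U \<omega>)) +
      ennreal (norm_sq b) * ennreal (psi_sq (Suc n) (?W \<omega>) * psi_sq n (?U \<omega>)) \<partial>M)"
  proof (rule nn_integral_mono)
    fix \<omega>
    have "(\<Sum>k\<le>K. ennreal ((summand n b k \<omega>)\<^sup>2)) =
        ennreal ((val b (Suc n) (?W \<omega>))\<^sup>2 * psi_sq n (?U \<omega>))"
      by (subst sum_ennreal) (simp_all add: psi_sq_def power_mult_distrib sum_distrib_left)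
    also have "\<dots> \<le>
        ennreal (((h (Suc n) (?W \<omega>))\<^sup>2 + norm_sq b * psi_sq (Suc n) (?W \<omega>)) * psi_sq n (?U \<omega>))"
      by (intro ennreal_leI mult_right_mono val_sq_le psi_sq_nonneg)
    also have "\<dots> = ennreal ((h (Suc n) (?W \<omega>))\<^sup>2 * psi_sq n (?U \<omega>)) +
      ennreal (norm_sq b) * ennreal (psi_sq (Suc n) (?W \<omega>) * psi_sq n (?U \<omega>))"
      by (simp add: distrib_right mult.assoc ennreal_mult norm_sq_nonneg psi_sq_nonneg)
    finally show "(\<Sum>k\<le>K. ennreal ((summand n b k \<omega>)\<^sup>2)) \<le>
      ennreal ((h (Suc n) (?W \<omega>))\<^sup>2 * psi_sq n (?U \<omega>)) +
      ennreal (norm_sq b) * ennreal (psi_sq (Suc n) (?W \<omega>) * psi_sq n (?U \<omega>))" .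
  qed
  also have "\<dots> = (\<integral>\<^sup>+\<omega>. ennreal ((h (Suc n) (?W \<omega>))\<^sup>2 * psi_sq n (?U \<omega>)) \<partial>M) +
      ennreal (norm_sq b) * (\<integral>\<^sup>+\<omega>. ennreal (psi_sq (Suc n) (?W \<omega>) * psi_sq n (?U \<omega>)) \<partial>M)"
    by (simp add: nn_integral_add nn_integral_cmult)
  also have "\<dots> \<le> ennreal T + ennreal (norm_sq b) * ennreal T"
    by (intro add_mono mult_left_mono h_psi_sq_product_integral psi_sq_product_integral d) simp
  also have "\<dots> = ennreal (T * (1 + norm_sq b))"
    using T norm_sq_nonneg[of b]
    by (simp add: ennreal_mult[symmetric] ennreal_plus[symmetric] algebra_simps del: ennreal_plus)
  finally show ?thesis .
qed

lemma regression_term_integrable: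
  assumes n: "1 \<le> n" "n < m" and k: "k \<le> K"
  shows "integrable M (\<lambda>\<omega>. (summand n b k \<omega>)\<^sup>2)"
    "integrable M (\<lambda>\<omega>. summand n b k \<omega>)"
proof -
  have d: "n \<in> {1..m}" "Suc n \<in> {1..m}" using n by auto
  note [measurable] = val_S_meas[OF d(2)] psi_meas[OF d(1)] S_meas[OF d(1)]
  have meas: "(\<lambda>\<omega>. summand n b k \<omega>) \<in> borel_measurable M"
    by measurable
  have "(\<integral>\<^sup>+\<omega>. ennreal ((summand n b k \<omega>)\<^sup>2) \<partial>M) \<le>
    (\<Sum>k\<le>K. \<integral>\<^sup>+\<omega>. ennreal ((summand n b k \<omega>)\<^sup>2) \<partial>M)"
    using k by (intro member_le_sum) auto
  also have "\<dots> < \<infinity>"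
    by (rule order_le_less_trans[OF regression_term_moment[OF n]]) simp
  finally show "integrable M (\<lambda>\<omega>. (summand n b k \<omega>)\<^sup>2)"
    "integrable M (\<lambda>\<omega>. summand n b k \<omega>)"
    using integrable_if_sq_le[OF meas] by auto
qed

lemma second_moment_sum_le:
  assumes n: "1 \<le> n" "n < m"
  shows "(\<Sum>k\<le>K. M.expectation (\<lambda>\<omega>. (summand n b k \<omega>)\<^sup>2))
    \<le> T * (1 + norm_sq b)" (is "(\<Sum>k\<le>K. ?E k) \<le> _")
proof -
  have "ennreal (\<Sum>k\<le>K. ?E k) = (\<Sum>k\<le>K. ennreal (?E k))"
    by (subst sum_ennreal) auto
  also have "\<dots> = (\<Sum>k\<le>K. \<integral>\<^sup>+\<omega>. ennreal ((summand n b k \<omega>)\<^sup>2) \<partial>M)"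
    using regression_term_integrable(1)[OF n, of _ b]
    by (intro sum.cong refl nn_integral_eq_integral[symmetric]) auto
  also have "\<dots> \<le> ennreal (T * (1 + norm_sq b))"
    by (rule regression_term_moment[OF n])
  finally show ?thesis
    using T norm_sq_nonneg[of b] by (subst (asm) ennreal_le_iff) auto
qed

lemma target_sq_sum_le:
  assumes n: "1 \<le> n" "n < m"
  shows "norm_sq (target n b) \<le> T * (1 + norm_sq b)"
proof -
  have "norm_sq (target n b) \<le> (\<Sum>k\<le>K. M.expectation (\<lambda>\<omega>. (summand n b k \<omega>)\<^sup>2))"
    unfolding norm_sq_def target_def
    using regression_term_integrable[OF n, of _ b] by (intro sum_mono M.expectation_sq_le) auto
  also have "\<dots> \<le> T * (1 + norm_sq b)"
    by (rule second_moment_sum_le[OF n])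
  finally show ?thesis .
qed

lemma target_diff_sq_sum_le:
  assumes n: "1 \<le> n" "n < m"
  shows "norm_sq (\<lambda>k. target n b k - target n b' k) \<le> T * norm_sq (\<lambda>k. b k - b' k)"
proof -
  have d: "n \<in> {1..m}" "Suc n \<in> {1..m}" using n by auto
  note [measurable] = val_S_meas[OF d(2)] psi_meas[OF d(1)] S_meas[OF d(1)] S_meas[OF d(2)]
    psi_sq_meas[OF d(1)] psi_sq_meas[OF d(2)]
  let ?U = "S (t n)" and ?W = "S (t (Suc n))"
  let ?D = "\<lambda>k \<omega>. (val b (Suc n) (?W \<omega>) - val b' (Suc n) (?W \<omega>)) * psi n k (?U \<omega>)"
  define \<delta> where "\<delta> = norm_sq (\<lambda>k. b k - b' k)"
  have \<delta>: "\<delta> \<ge> 0" by (simp add: \<delta>_def norm_sq_nonneg)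
  have sum: "(\<Sum>k\<le>K. \<integral>\<^sup>+\<omega>. ennreal ((?D k \<omega>)\<^sup>2) \<partial>M) \<le> ennreal (T * \<delta>)"
  proof -
    have "(\<Sum>k\<le>K. \<integral>\<^sup>+\<omega>. ennreal ((?D k \<omega>)\<^sup>2) \<partial>M) = (\<integral>\<^sup>+\<omega>. (\<Sum>k\<le>K. ennreal ((?D k \<omega>)\<^sup>2)) \<partial>M)"
      by (rule nn_integral_sum[symmetric]) measurable
    also have "\<dots> \<le> (\<integral>\<^sup>+\<omega>. ennreal \<delta> * ennreal (psi_sq (Suc n) (?W \<omega>) * psi_sq n (?U \<omega>)) \<partial>M)"
    proof (rule nn_integral_mono)
      fix \<omega>
      have "(\<Sum>k\<le>K. ennreal ((?D k \<omega>)\<^sup>2)) =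
          ennreal ((val b (Suc n) (?W \<omega>) - val b' (Suc n) (?W \<omega>))\<^sup>2 * psi_sq n (?U \<omega>))"
        by (subst sum_ennreal) (simp_all add: psi_sq_def power_mult_distrib sum_distrib_left)
      also have "\<dots> \<le> ennreal (\<delta> * psi_sq (Suc n) (?W \<omega>) * psi_sq n (?U \<omega>))"
        unfolding \<delta>_def by (intro ennreal_leI mult_right_mono val_diff_sq_le psi_sq_nonneg)
      also have "\<dots> = ennreal \<delta> * ennreal (psi_sq (Suc n) (?W \<omega>) * psi_sq n (?U \<omega>))"
        using \<delta> by (simp add: ennreal_mult[symmetric] psi_sq_nonneg mult.assoc)
      finally show "(\<Sum>k\<le>K. ennreal ((?D k \<omega>)\<^sup>2)) \<le>
          ennreal \<delta> * ennreal (psi_sq (Suc n) (?W \<omega>) * psi_sq n (?U \<omega>))" .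
    qed
    also have "\<dots> = ennreal \<delta> * (\<integral>\<^sup>+\<omega>. ennreal (psi_sq (Suc n) (?W \<omega>) * psi_sq n (?U \<omega>)) \<partial>M)"
      by (rule nn_integral_cmult) measurable
    also have "\<dots> \<le> ennreal \<delta> * ennreal T"
      by (intro mult_left_mono psi_sq_product_integral d) simp
    finally show ?thesis
      using \<delta> T by (simp add: ennreal_mult[symmetric] mult.commute)
  qed
  have D_fin: "(\<integral>\<^sup>+\<omega>. ennreal ((?D k \<omega>)\<^sup>2) \<partial>M) < \<infinity>" if "k \<le> K" for k
  proof -
    have "(\<integral>\<^sup>+\<omega>. ennreal ((?D k \<omega>)\<^sup>2) \<partial>M) \<le> (\<Sum>k\<le>K. \<integral>\<^sup>+\<omega>. ennreal ((?D k \<omega>)\<^sup>2) \<partial>M)"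
      using that by (intro member_le_sum) auto
    also have "\<dots> < \<infinity>" by (rule order_le_less_trans[OF sum]) simp
    finally show ?thesis .
  qed
  have D_meas: "?D k \<in> borel_measurable M" for k
    by measurable
  have D_int: "integrable M (\<lambda>\<omega>. (?D k \<omega>)\<^sup>2)" "integrable M (?D k)" if "k \<le> K" for k
    by (rule integrable_if_sq_le(1)[OF D_meas D_fin[OF that]],
        rule integrable_if_sq_le(2)[OF D_meas D_fin[OF that]])
  have diff: "target n b k - target n b' k = M.expectation (?D k)" if "k \<le> K" for k
    unfolding target_def left_diff_distrib
    using regression_term_integrable(2)[OF n that]
        by (intro Bochner_Integration.integral_diff[symmetric])
  have "ennreal (norm_sq (\<lambda>k. target n b k - target n b' k)) \<le>
      ennreal (\<Sum>k\<le>K. M.expectation (\<lambda>\<omega>. (?D k \<omega>)\<^sup>2))"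
    unfolding norm_sq_def using D_int
        by (intro ennreal_leI sum_mono) (simp add: diff M.expectation_sq_le)
  also have "\<dots> = (\<Sum>k\<le>K. ennreal (M.expectation (\<lambda>\<omega>. (?D k \<omega>)\<^sup>2)))"
    by (subst sum_ennreal) auto
  also have "\<dots> = (\<Sum>k\<le>K. \<integral>\<^sup>+\<omega>. ennreal ((?D k \<omega>)\<^sup>2) \<partial>M)"
    using D_int by (intro sum.cong refl nn_integral_eq_integral[symmetric]) auto
  also note sum
  finally show ?thesis
    using T \<delta> unfolding \<delta>_def by (subst (asm) ennreal_le_iff) auto
qed

lemma samplesD:
  shows paths_indep: "Q.indep_vars (\<lambda>(n, i). PiM {1..Suc n} (\<lambda>_. borel))
      (\<lambda>(n, i) \<omega>. \<lambda>j\<in>{1..Suc n}. X n i j \<omega>) ({1..<m} \<times> {1..N})"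
    and path_law: "n \<in> {1..<m} \<Longrightarrow> i \<in> {1..N} \<Longrightarrow>
        distr Q (PiM {1..Suc n} (\<lambda>_. borel)) (\<lambda>\<omega>. \<lambda>j\<in>{1..Suc n}. X n i j \<omega>) =
        distr M (PiM {1..Suc n} (\<lambda>_. borel)) (\<lambda>\<omega>. \<lambda>j\<in>{1..Suc n}. S (t j) \<omega>)"
  using samples unfolding sample_paths_def by auto

lemma path_meas:
  assumes "n \<in> {1..<m}" "i \<in> {1..N}"
  shows "(\<lambda>\<omega>. \<lambda>j\<in>{1..Suc n}. X n i j \<omega>) \<in> measurable Q (PiM {1..Suc n} (\<lambda>_. borel))"
  using paths_indep assms unfolding Q.indep_vars_def by auto

lemma X_meas:
  assumes "n \<in> {1..<m}" "i \<in> {1..N}" "j \<in> {1..Suc n}"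
  shows "X n i j \<in> borel_measurable Q"
  using measurable_compose[OF path_meas[OF assms(1,2)] measurable_component_singleton[OF
      assms(3)]] assms(3)
  by simp

text \<open>The fluctuation for fixed coefficients \<open>b\<close>, before they are replaced by estimates from other
  sample sets.\<close>
lemma sample_mean_error:
  assumes n: "1 \<le> n" "n < m"
  shows "(\<integral>\<^sup>+\<omega>. ennreal (deviation n b (sample n \<omega>)) \<partial>Q)
    \<le> ennreal (T * (1 + norm_sq b) / real N)"
proof -
  have d: "n \<in> {1..m}" "Suc n \<in> {1..m}" "n \<in> {1..<m}" using n by auto
  let ?MP = "PiM {1..Suc n} (\<lambda>_. borel :: real measure)"
  define F where "F k p = val b (Suc n) (p (Suc n)) * psi n k (p n)" for k and p :: "nat \<Rightarrow> real"
  have [measurable]: "(\<lambda>p. p n) \<in> borel_measurable ?MP" "(\<lambda>p. p (Suc n)) \<in> borel_measurable ?MP"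
    using n by (intro measurable_component_singleton; simp)+
  note [measurable] = psi_meas[OF d(1)]
  have [measurable]: "(\<lambda>p. val b (Suc n) (p (Suc n))) \<in> borel_measurable ?MP"
    using n by (intro val_measurable) auto
  have F_meas[measurable]: "F k \<in> borel_measurable ?MP" for k
    unfolding F_def by measurable
  define Y where "Y k i \<omega> = val b (Suc n) (X n i (Suc n) \<omega>) * psi n k (X n i n \<omega>)" for k i \<omega>
  define Z where "Z k \<omega> = summand n b k \<omega>" for k \<omega>
  have YF: "Y k i \<omega> = F k (\<lambda>j\<in>{1..Suc n}. X n i j \<omega>)" for k i \<omega>
    using n by (simp add: Y_def F_def)
  have ZF: "Z k \<omega> = F k (\<lambda>j\<in>{1..Suc n}. S (t j) \<omega>)" for k \<omega>
    using n by (simp add: Z_def F_def)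
  have S_path: "(\<lambda>\<omega>. \<lambda>j\<in>{1..Suc n}. S (t j) \<omega>) \<in> measurable M ?MP"
    using n by (intro measurable_restrict S_meas) auto
  have transfer: "(\<integral>\<omega>. f (Y k i \<omega>) \<partial>Q) = (\<integral>\<omega>. f (Z k \<omega>) \<partial>M)"
      "integrable Q (\<lambda>\<omega>. f (Y k i \<omega>)) \<longleftrightarrow> integrable M (\<lambda>\<omega>. f (Z k \<omega>))"
    if i: "i \<in> {1..N}" and [measurable]: "f \<in> borel_measurable borel" for f :: "real \<Rightarrow> real" and k i
  proof -
    have [measurable]: "(\<lambda>p. f (F k p)) \<in> borel_measurable ?MP" by measurable
    have "(\<integral>\<omega>. f (Y k i \<omega>) \<partial>Q) = (\<integral>p. f (F k p) \<partial>distr Q ?MP (\<lambda>\<omega>. \<lambda>j\<in>{1..Suc n}. X n i j \<omega>))"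
      unfolding YF by (rule integral_distr[OF path_meas[OF d(3) i], symmetric]) measurable
    also have "\<dots> = (\<integral>\<omega>. f (Z k \<omega>) \<partial>M)"
      unfolding ZF path_law[OF d(3) i] by (rule integral_distr[OF S_path]) measurable
    finally show "(\<integral>\<omega>. f (Y k i \<omega>) \<partial>Q) = (\<integral>\<omega>. f (Z k \<omega>) \<partial>M)" .
    have "integrable Q (\<lambda>\<omega>. f (Y k i \<omega>)) \<longleftrightarrow>
        integrable (distr Q ?MP (\<lambda>\<omega>. \<lambda>j\<in>{1..Suc n}. X n i j \<omega>)) (\<lambda>p. f (F k p))"
      unfolding YF by (rule integrable_distr_eq[OF path_meas[OF d(3) i], symmetric]) measurable
    also have "\<dots> \<longleftrightarrow> integrable M (\<lambda>\<omega>. f (Z k \<omega>))"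
      unfolding ZF path_law[OF d(3) i] by (rule integrable_distr_eq[OF S_path]) measurable
    finally show "integrable Q (\<lambda>\<omega>. f (Y k i \<omega>)) \<longleftrightarrow> integrable M (\<lambda>\<omega>. f (Z k \<omega>))" .
  qed
  \<comment> \<open>The independence of all paths is indexed by pairs of a step and a path number.\<close>
  define I where "I = Pair n ` {1..N}"
  have card_I: "card I = N"
    unfolding I_def by (subst card_image) (auto simp: inj_on_def)
  have sum_I: "(\<Sum>p\<in>I. g (snd p)) = (\<Sum>i\<in>{1..N}. g i)" for g :: "nat \<Rightarrow> real"
    unfolding I_def by (subst sum.reindex) (auto simp: inj_on_def)
  have indep: "Q.indep_vars (\<lambda>_. borel) (\<lambda>p. Y k (snd p)) I" for k
  proof -
    have "Q.indep_vars (\<lambda>(n, i). PiM {1..Suc n} (\<lambda>_. borel))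
      (\<lambda>(n, i) \<omega>. \<lambda>j\<in>{1..Suc n}. X n i j \<omega>) I"
      using d by (intro Q.indep_vars_subset[OF paths_indep]) (auto simp: I_def)
    hence comp: "Q.indep_vars (\<lambda>_. borel) (\<lambda>p \<omega>. F k ((case p of (n, i) \<Rightarrow> \<lambda>\<omega>. \<lambda>j\<in>{1..Suc n}. X n i j \<omega>) \<omega>)) I"
    proof (rule Q.indep_vars_compose2[where Y = "\<lambda>_. F k"])
      fix p assume "p \<in> I"
      then obtain i where "p = (n, i)" by (auto simp: I_def)
      thus "F k \<in> borel_measurable (case p of (n, i) \<Rightarrow> PiM {1..Suc n} (\<lambda>_. borel))"
        using F_meas[of k] by simp
    qed
    have eq: "(\<lambda>\<omega>. F k ((case p of (n, i) \<Rightarrow> \<lambda>\<omega>. \<lambda>j\<in>{1..Suc n}. X n i j \<omega>) \<omega>)) = Y k (snd p)"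
      if "p \<in> I" for p
    proof -
      from that obtain i where "p = (n, i)" by (auto simp: I_def)
      thus ?thesis by (simp only: prod.case snd_conv YF[symmetric])
    qed
    show ?thesis
      by (rule iffD1[OF Q.indep_vars_cong[OF refl eq refl] comp])
  qed
  have one: "(\<integral>\<^sup>+\<omega>. ennreal ((sample_mean n b (sample n \<omega>) k - target n b k)\<^sup>2) \<partial>Q)
      \<le> ennreal (M.expectation (\<lambda>\<omega>. (Z k \<omega>)\<^sup>2) / real N)" if k: "k \<le> K" for k
  proof -
    have "(\<integral>\<^sup>+\<omega>. ennreal ((1 / real (card I) * (\<Sum>p\<in>I. Y k (snd p) \<omega>) - target n b k)\<^sup>2) \<partial>Q)
      \<le> ennreal (M.expectation (\<lambda>\<omega>. (Z k \<omega>)\<^sup>2) / real (card I))"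
    proof (rule Q.nn_integral_sample_mean_le[OF _ _ indep])
      fix p assume "p \<in> I"
      hence i: "snd p \<in> {1..N}" by (auto simp: I_def)
      show "integrable Q (\<lambda>\<omega>. (Y k (snd p) \<omega>)\<^sup>2)"
        using transfer(2)[OF i, of "\<lambda>x. x\<^sup>2"] regression_term_integrable(1)[OF n k]
            by (simp add: Z_def)
      show "Q.expectation (Y k (snd p)) = target n b k"
        using transfer(1)[OF i, of "\<lambda>x. x"] by (simp add: Z_def target_def)
      show "Q.expectation (\<lambda>\<omega>. (Y k (snd p) \<omega>)\<^sup>2) \<le> M.expectation (\<lambda>\<omega>. (Z k \<omega>)\<^sup>2)"
        using transfer(1)[OF i, of "\<lambda>x. x\<^sup>2"] by simp
    qed (use N in \<open>auto simp: I_def\<close>)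
    thus ?thesis
      unfolding card_I sum_I[of "\<lambda>i. Y k i _"] by (simp add: sample_mean_def Y_def)
  qed
  have [measurable]: "X n i n \<in> borel_measurable Q" "X n i (Suc n) \<in> borel_measurable Q"
      if "i \<in> {1..N}" for i
    using X_meas d that by auto
  have [measurable]: "(\<lambda>\<omega>. val b (Suc n) (X n i (Suc n) \<omega>)) \<in> borel_measurable Q" if "i \<in> {1..N}"
      for i
    using n that by (intro val_measurable) auto
  have "(\<integral>\<^sup>+\<omega>. ennreal (deviation n b (sample n \<omega>)) \<partial>Q) =
      (\<integral>\<^sup>+\<omega>. (\<Sum>k\<le>K. ennreal ((sample_mean n b (sample n \<omega>) k - target n b k)\<^sup>2)) \<partial>Q)"
    by (simp add: norm_sq_def sum_ennreal)
  also have "\<dots> = (\<Sum>k\<le>K. \<integral>\<^sup>+\<omega>. ennreal ((sample_mean n b (sample n \<omega>) k - target n b k)\<^sup>2) \<partial>Q)"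
    unfolding sample_mean_def fst_conv snd_conv by (rule nn_integral_sum) measurable
  also have "\<dots> \<le> (\<Sum>k\<le>K. ennreal (M.expectation (\<lambda>\<omega>. (Z k \<omega>)\<^sup>2) / real N))"
    by (intro sum_mono one) auto
  also have "\<dots> = ennreal ((\<Sum>k\<le>K. M.expectation (\<lambda>\<omega>. (Z k \<omega>)\<^sup>2)) / real N)"
    by (subst sum_ennreal) (auto simp: sum_divide_distrib)
  also have "\<dots> \<le> ennreal (T * (1 + norm_sq b) / real N)"
    using second_moment_sum_le[OF n, of b]
        by (intro ennreal_leI divide_right_mono) (auto simp: Z_def)
  finally show ?thesis .
qed

end

text \<open>Conditioning on \<open>X\<close>: the integral over an independent pair is computed with an independent
  copy of \<open>Y\<close>.\<close>
lemma (in prob_space) nn_integral_indep_pair: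
  assumes indep: "indep_var R X S Y" and f[measurable]: "f \<in> borel_measurable (R \<Otimes>\<^sub>M S)"
  shows "(\<integral>\<^sup>+\<omega>. f (X \<omega>, Y \<omega>) \<partial>M) = (\<integral>\<^sup>+\<omega>'. \<integral>\<^sup>+\<omega>. f (X \<omega>', Y \<omega>) \<partial>M \<partial>M)"
proof -
  have X[measurable]: "X \<in> measurable M R" and Y[measurable]: "Y \<in> measurable M S"
    using indep_var_rv1[OF indep] indep_var_rv2[OF indep] by auto
  interpret Y: prob_space "distr M S Y"
    by (rule prob_space_distr) measurable
  have law: "distr M (R \<Otimes>\<^sub>M S) (\<lambda>\<omega>. (X \<omega>, Y \<omega>)) = distr M R X \<Otimes>\<^sub>M distr M S Y"
    using indep unfolding indep_var_distribution_eq by simp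
  have f': "f \<in> borel_measurable (distr M R X \<Otimes>\<^sub>M distr M S Y)"
    using f by (simp cong: measurable_cong_sets sets_pair_measure_cong)
  have "(\<integral>\<^sup>+\<omega>. f (X \<omega>, Y \<omega>) \<partial>M) = (\<integral>\<^sup>+p. f p \<partial>distr M (R \<Otimes>\<^sub>M S) (\<lambda>\<omega>. (X \<omega>, Y \<omega>)))"
    by (rule nn_integral_distr[symmetric]) measurable
  also have "\<dots> = (\<integral>\<^sup>+x. \<integral>\<^sup>+y. f (x, y) \<partial>distr M S Y \<partial>distr M R X)"
    unfolding law by (rule Y.nn_integral_fst[OF f', symmetric])
  also have "\<dots> = (\<integral>\<^sup>+x. \<integral>\<^sup>+\<omega>. f (x, Y \<omega>) \<partial>M \<partial>distr M R X)"
  proof (rule nn_integral_cong)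
    fix x assume "x \<in> space (distr M R X)"
    hence [measurable]: "(\<lambda>y. f (x, y)) \<in> borel_measurable S"
      by (intro measurable_compose[OF _ f] measurable_Pair1') simp
    show "(\<integral>\<^sup>+y. f (x, y) \<partial>distr M S Y) = (\<integral>\<^sup>+\<omega>. f (x, Y \<omega>) \<partial>M)"
      by (rule nn_integral_distr) measurable
  qed
  also have "\<dots> = (\<integral>\<^sup>+\<omega>'. \<integral>\<^sup>+\<omega>. f (X \<omega>', Y \<omega>) \<partial>M \<partial>M)"
    by (rule nn_integral_distr) measurable
  finally show ?thesis .
qed

context ls_setup
begin

definition err :: "nat \<Rightarrow> ennreal" where
  "err n = (\<integral>\<^sup>+\<omega>. ennreal (norm_sq (\<lambda>k. estimate X \<omega> n k - exact n k)) \<partial>Q)"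

lemma estimate_X_meas:
  assumes "1 \<le> n" "k \<le> K"
  shows "(\<lambda>\<omega>. estimate X \<omega> n k) \<in> borel_measurable Q"
  using assms X_meas by (intro estimate_measurable) auto

lemma norm_sq_add_le: "norm_sq (\<lambda>k. a k + b k) \<le> 2 * norm_sq a + 2 * norm_sq b"
proof -
  have "(u + v)\<^sup>2 \<le> 2 * u\<^sup>2 + 2 * v\<^sup>2" for u v :: real
    using sum_squares_bound[of u v] by (simp add: power2_sum)
  hence "norm_sq (\<lambda>k. a k + b k) \<le> (\<Sum>k\<le>K. 2 * (a k)\<^sup>2 + 2 * (b k)\<^sup>2)"
    unfolding norm_sq_def by (intro sum_mono)
  thus ?thesis by (simp add: norm_sq_def sum.distrib sum_distrib_left)
qed

text \<open>The coefficients estimated at step \<open>n + 1\<close> are independent of the paths of step \<open>n\<close>. Thus they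
  may be frozen when the mean over the latter is taken, and \<open>sample_mean_error\<close> applies.\<close>
lemma fresh_sample_error:
  assumes n: "1 \<le> n" "n < m"
  shows "(\<integral>\<^sup>+\<omega>. ennreal (deviation n (estimate X \<omega> (Suc n)) (sample n \<omega>)) \<partial>Q)
    \<le> (\<integral>\<^sup>+\<omega>. ennreal (T * (1 + norm_sq (estimate X \<omega> (Suc n))) / real N) \<partial>Q)"
proof -
  have d: "n \<in> {1..m}" "Suc n \<in> {1..m}" "n \<in> {1..<m}" using n by auto
  define A where "A = {Suc n..<m} \<times> {1..N}"
  define B where "B = {n} \<times> {1..N}"
  define MP where "MP = (\<lambda>(n, i::nat). PiM {1..Suc n} (\<lambda>_. borel :: real measure))"
  define path where "path = (\<lambda>(n, i) \<omega>. \<lambda>j\<in>{1..Suc n}. X n i j \<omega>)"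
  define PA where "PA \<omega> = (\<lambda>p\<in>A. path p \<omega>)" for \<omega>
  define PB where "PB \<omega> = (\<lambda>p\<in>B. path p \<omega>)" for \<omega>
  have indep: "Q.indep_var (PiM A MP) PA (PiM B MP) PB"
    unfolding PA_def PB_def
  proof (rule Q.indep_var_restrict)
    show "Q.indep_vars MP path ({1..<m} \<times> {1..N})"
      using paths_indep by (simp add: MP_def path_def)
  qed (use n in \<open>auto simp: A_def B_def\<close>)
  \<comment> \<open>The estimate is evaluated on the space of all path configurations \<open>p\<close>, where \<open>Y\<close> is the
     canonical sample; \<open>est_PA\<close> pulls it back to the given sample space.\<close>
  define Y where "Y n' i j p = p (n', i) j" for n' i j and p :: "nat \<times> nat \<Rightarrow> nat \<Rightarrow> real"
  have comp_meas: "(\<lambda>p. p (n', i) j) \<in> borel_measurable (PiM I MP)"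
    if "(n', i) \<in> I" "j \<in> {1..Suc n'}" for n' i j I
  proof -
    have "(\<lambda>p. p (n', i)) \<in> measurable (PiM I MP) (MP (n', i))"
      using that(1) by (rule measurable_component_singleton)
    thus ?thesis
      unfolding MP_def using that(2)
          by (auto intro: measurable_compose[OF _ measurable_component_singleton])
  qed
  have est_meas: "(\<lambda>p. estimate Y p (Suc n) k) \<in> borel_measurable (PiM A MP)" if "k \<le> K" for k
    using that unfolding Y_def[abs_def]
    by (intro estimate_measurable comp_meas) (auto simp: A_def)
  have est_PA: "estimate Y (PA \<omega>) (Suc n) k = estimate X \<omega> (Suc n) k" if "k \<le> K" for \<omega> k
    using that by (intro estimate_cong) (auto simp: Y_def PA_def A_def path_def)
  have PB_eq: "Y n i j (PB \<omega>) = X n i j \<omega>" if "i \<in> {1..N}" "j \<in> {n, Suc n}" for i j \<omega>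
    using that n by (auto simp: Y_def PB_def B_def path_def)
  define H where "H z = ennreal (deviation n (estimate Y (fst z) (Suc n))
      (\<lambda>i. (Y n i n (snd z), Y n i (Suc n) (snd z))))" for z
  have [measurable]: "(\<lambda>z. estimate Y (fst z) (Suc n) k) \<in> borel_measurable (PiM A MP \<Otimes>\<^sub>M PiM B MP)"
    if "k \<le> K" for k
    by (rule measurable_compose[OF measurable_fst est_meas[OF that]])
  have [measurable]: "(\<lambda>z. Y n i n (snd z)) \<in> borel_measurable (PiM A MP \<Otimes>\<^sub>M PiM B MP)"
      "(\<lambda>z. Y n i (Suc n) (snd z)) \<in> borel_measurable (PiM A MP \<Otimes>\<^sub>M PiM B MP)" if "i \<in> {1..N}" for i
    unfolding Y_def using that n
    by (auto intro!: measurable_compose[OF measurable_snd comp_meas] simp: B_def)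
  have [measurable]: "(\<lambda>z. val (estimate Y (fst z) (Suc n)) (Suc n) (Y n i (Suc n) (snd z)))
      \<in> borel_measurable (PiM A MP \<Otimes>\<^sub>M PiM B MP)" if "i \<in> {1..N}" for i
    using n that by (intro val_measurable) auto
  note [measurable] = psi_meas[OF d(1)] S_meas[OF d(1)] S_meas[OF d(2)]
  have target_meas: "(\<lambda>p. target n (estimate Y p (Suc n)) k) \<in> borel_measurable (PiM A MP)" for k
    unfolding target_def
  proof (rule M.borel_measurable_lebesgue_integral)
    have [measurable]: "(\<lambda>z. val (estimate Y (fst z) (Suc n)) (Suc n) (S (t (Suc n)) (snd z))) \<in> borel_measurable (PiM A MP \<Otimes>\<^sub>M M)"
      using n by (intro val_measurable measurable_compose[OF measurable_fst est_meas]) auto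
    show "(\<lambda>(p, \<omega>). val (estimate Y p (Suc n)) (Suc n) (S (t (Suc n)) \<omega>) * psi n k (S (t n) \<omega>))
      \<in> borel_measurable (PiM A MP \<Otimes>\<^sub>M M)"
      unfolding split_beta' by measurable
  qed
  have [measurable]: "(\<lambda>z. target n (estimate Y (fst z) (Suc n)) k) \<in> borel_measurable (PiM A MP \<Otimes>\<^sub>M PiM B MP)" for k
    by (rule measurable_compose[OF measurable_fst target_meas])
  have H_meas: "H \<in> borel_measurable (PiM A MP \<Otimes>\<^sub>M PiM B MP)"
    unfolding H_def norm_sq_def sample_mean_def fst_conv snd_conv by measurable
  have target_cong: "target n b k = target n b' k" if "\<And>k. k \<le> K \<Longrightarrow> b k = b' k" for b b' k
    unfolding target_def using val_cong[OF that] by simp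
  have sample_cong: "sample_mean n b z k = sample_mean n b' z' k"
    if "\<And>k. k \<le> K \<Longrightarrow> b k = b' k" "\<And>i. i \<in> {1..N} \<Longrightarrow> z i = z' i" for b b' z z' k
    unfolding sample_mean_def using that val_cong[OF that(1)]
        by (auto intro!: sum.cong arg_cong2[where f = "(*)"])
  have H_eq: "H (PA \<omega>', PB \<omega>) = ennreal (deviation n (estimate X \<omega>' (Suc n)) (sample n \<omega>))" for \<omega> \<omega>'
    unfolding H_def fst_conv snd_conv norm_sq_def
    by (intro arg_cong[where f = ennreal] sum.cong refl arg_cong[where f = "\<lambda>x. x\<^sup>2"]
        arg_cong2[where f = "(-)"] sample_cong target_cong) (auto simp: est_PA PB_eq)
  have "(\<integral>\<^sup>+\<omega>. ennreal (deviation n (estimate X \<omega> (Suc n)) (sample n \<omega>)) \<partial>Q) =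
      (\<integral>\<^sup>+\<omega>. H (PA \<omega>, PB \<omega>) \<partial>Q)"
    by (simp only: H_eq)
  also have "\<dots> = (\<integral>\<^sup>+\<omega>'. \<integral>\<^sup>+\<omega>. H (PA \<omega>', PB \<omega>) \<partial>Q \<partial>Q)"
    by (rule Q.nn_integral_indep_pair[OF indep H_meas])
  also have "\<dots> \<le> (\<integral>\<^sup>+\<omega>'. ennreal (T * (1 + norm_sq (estimate X \<omega>' (Suc n))) / real N) \<partial>Q)"
    unfolding H_eq by (intro nn_integral_mono sample_mean_error n)
  finally show ?thesis .
qed

lemma exact_bound:
  assumes "1 \<le> n" "n \<le> m"
  shows "norm_sq (exact n) \<le> (2 * (\<Lambda>\<^sup>2 * T)) ^ (m - n)"
  using assms
proof (induction "m - n" arbitrary: n)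
  case 0
  hence "\<not> n < m" by simp
  thus ?case using 0(1)[symmetric] unfolding norm_sq_def exact_def by (simp only: if_False) simp
next
  case (Suc j)
  define R where "R = \<Lambda>\<^sup>2 * T"
  have R: "R \<ge> 1"
    using \<Lambda> T one_le_power[of \<Lambda> 2] mult_mono[of 1 "\<Lambda>\<^sup>2" 1 T] by (simp add: R_def)
  have n: "1 \<le> n" "n < m" using Suc by auto
  have j: "m - n = Suc j" "j = m - Suc n" using Suc by auto
  have IH: "norm_sq (exact (Suc n)) \<le> (2 * R) ^ j"
    unfolding R_def using Suc.hyps(1)[OF j(2)] n j(2) by simp
  have one: "1 \<le> (2 * R) ^ j"
    using R by (intro one_le_power) simp
  have "norm_sq (exact n) = (\<Sum>k\<le>K. (gi n (target n (exact (Suc n))) k)\<^sup>2)"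
    unfolding norm_sq_def using n by (intro sum.cong refl) (simp add: exact_rec)
  also have "\<dots> \<le> \<Lambda>\<^sup>2 * norm_sq (target n (exact (Suc n)))"
    unfolding norm_sq_def using n by (intro gi_sq_sum_le) auto
  also have "\<dots> \<le> \<Lambda>\<^sup>2 * (T * (1 + norm_sq (exact (Suc n))))"
    by (intro mult_left_mono target_sq_sum_le n) auto
  also have "\<dots> \<le> R * (1 + (2 * R) ^ j)"
    using IH R unfolding R_def mult.assoc[symmetric] by (intro mult_left_mono) auto
  also have "\<dots> \<le> R * (2 * (2 * R) ^ j)"
    using R one by (intro mult_left_mono; linarith)
  also have "\<dots> = (2 * (\<Lambda>\<^sup>2 * T)) ^ (m - n)"
    unfolding j(1) R_def by simp
  finally show ?case .
qed

text \<open>The error of \<open>\<gamma>\<close> is the fluctuation \<open>V\<close> around the conditional expectation plus the bias of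
  the latter, which is at most \<open>T D\<close> in squared norm. In the bound for \<open>V\<close>, the estimated
  coefficients are replaced by the exact ones at the cost of another multiple of \<open>D\<close>.\<close>
lemma err_rec:
  assumes n: "1 \<le> n" "n < m"
  shows "err n \<le> ennreal (2 * (\<Lambda>\<^sup>2 * T)) *
    (ennreal ((1 + 2 * norm_sq (exact (Suc n))) / real N) + 3 * err (Suc n))"
proof -
  have d: "n \<in> {1..m}" "Suc n \<in> {1..m}" "n \<in> {1..<m}" using n by auto
  define g where "g \<omega> = sample_mean n (estimate X \<omega> (Suc n)) (sample n \<omega>)" for \<omega>
  define b where "b \<omega> = estimate X \<omega> (Suc n)" for \<omega>
  define \<beta> where "\<beta> = exact (Suc n)"
  define D where "D \<omega> = norm_sq (\<lambda>k. b \<omega> k - \<beta> k)" for \<omega>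
  have D_nonneg: "D \<omega> \<ge> 0" for \<omega> by (simp add: D_def norm_sq_nonneg)
  have b_meas[measurable]: "(\<lambda>\<omega>. b \<omega> k) \<in> borel_measurable Q" if "k \<le> K" for k
    unfolding b_def using that by (intro estimate_X_meas) auto
  have D_meas[measurable]: "D \<in> borel_measurable Q"
    unfolding D_def norm_sq_def by measurable
  have err_D: "err (Suc n) = (\<integral>\<^sup>+\<omega>. ennreal (D \<omega>) \<partial>Q)"
    by (simp add: err_def D_def b_def \<beta>_def)
  define V where "V \<omega> = norm_sq (\<lambda>k. g \<omega> k - target n (b \<omega>) k)" for \<omega>
  have pointwise: "norm_sq (\<lambda>k. estimate X \<omega> n k - exact n k) \<le> \<Lambda>\<^sup>2 * (2 * V \<omega> + 2 * (T * D \<omega>))"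
      for \<omega>
  proof -
    have "norm_sq (\<lambda>k. estimate X \<omega> n k - exact n k) = (\<Sum>k\<le>K. (gi n (\<lambda>l. g \<omega> l - target n \<beta> l) k)\<^sup>2)"
      unfolding norm_sq_def using n
      by (intro sum.cong refl) (simp add: exact_rec estimate_rec g_def \<beta>_def gi_diff)
    also have "\<dots> \<le> \<Lambda>\<^sup>2 * norm_sq (\<lambda>l. g \<omega> l - target n \<beta> l)"
      unfolding norm_sq_def by (rule gi_sq_sum_le[OF d(1)])
    also have "norm_sq (\<lambda>l. g \<omega> l - target n \<beta> l) =
        norm_sq (\<lambda>l. (g \<omega> l - target n (b \<omega>) l) + (target n (b \<omega>) l - target n \<beta> l))"
      by simp
    also have "\<dots> \<le> 2 * V \<omega> + 2 * norm_sq (\<lambda>l. target n (b \<omega>) l - target n \<beta> l)"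
      unfolding V_def by (rule norm_sq_add_le)
    also have "norm_sq (\<lambda>l. target n (b \<omega>) l - target n \<beta> l) \<le> T * D \<omega>"
      unfolding D_def by (rule target_diff_sq_sum_le[OF n])
    finally show ?thesis
      by (simp add: mult_left_mono)
  qed
  have V_nonneg: "V \<omega> \<ge> 0" for \<omega> by (simp add: V_def norm_sq_nonneg)
  have V_int: "(\<integral>\<^sup>+\<omega>. ennreal (V \<omega>) \<partial>Q) \<le>
      ennreal (T * (1 + 2 * norm_sq \<beta>) / real N) + ennreal (2 * T / real N) * err (Suc n)"
  proof -
    have "(\<integral>\<^sup>+\<omega>. ennreal (V \<omega>) \<partial>Q) \<le> (\<integral>\<^sup>+\<omega>. ennreal (T * (1 + norm_sq (b \<omega>)) / real N) \<partial>Q)"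
      unfolding V_def g_def b_def by (rule fresh_sample_error[OF n])
    also have "\<dots> \<le>
        (\<integral>\<^sup>+\<omega>. ennreal (T * (1 + 2 * norm_sq \<beta>) / real N) + ennreal (2 * T / real N) * ennreal (D
            \<omega>) \<partial>Q)"
    proof (rule nn_integral_mono)
      fix \<omega>
      have "norm_sq (b \<omega>) = norm_sq (\<lambda>k. \<beta> k + (b \<omega> k - \<beta> k))"
        by simp
      also have "\<dots> \<le> 2 * norm_sq \<beta> + 2 * D \<omega>"
        unfolding D_def by (rule norm_sq_add_le)
      finally have "T * (1 + norm_sq (b \<omega>)) / real N \<le> T * (1 + (2 * norm_sq \<beta> + 2 * D \<omega>)) / real N"
        using T by (intro divide_right_mono mult_left_mono) auto
      also have "\<dots> = T * (1 + 2 * norm_sq \<beta>) / real N + 2 * T / real N * D \<omega>"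
        by (simp add: algebra_simps add_divide_distrib)
      finally have "ennreal (T * (1 + norm_sq (b \<omega>)) / real N) \<le>
          ennreal (T * (1 + 2 * norm_sq \<beta>) / real N + 2 * T / real N * D \<omega>)"
        by (rule ennreal_leI)
      also have "\<dots> = ennreal (T * (1 + 2 * norm_sq \<beta>) / real N) + ennreal (2 * T / real N) *
          ennreal (D \<omega>)"
        using T D_nonneg[of \<omega>] norm_sq_nonneg[of \<beta>]
            by (subst ennreal_plus) (auto simp: ennreal_mult[symmetric])
      finally show "ennreal (T * (1 + norm_sq (b \<omega>)) / real N) \<le>
        ennreal (T * (1 + 2 * norm_sq \<beta>) / real N) + ennreal (2 * T / real N) * ennreal (D \<omega>)" .
    qed
    also have "\<dots> = ennreal (T * (1 + 2 * norm_sq \<beta>) / real N) + ennreal (2 * T / real N) *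
        err (Suc n)"
      by (simp add: nn_integral_add nn_integral_cmult err_D Q.emeasure_space_1)
    finally show ?thesis .
  qed
  have [measurable]: "X n i n \<in> borel_measurable Q" "X n i (Suc n) \<in> borel_measurable Q"
      if "i \<in> {1..N}" for i
    using X_meas d that by auto
  note [measurable] = psi_meas[OF d(1)] S_meas[OF d(1)] S_meas[OF d(2)]
  have [measurable]: "(\<lambda>\<omega>. val (b \<omega>) (Suc n) (X n i (Suc n) \<omega>)) \<in> borel_measurable Q"
      if "i \<in> {1..N}" for i
    using n that by (intro val_measurable) auto
  have [measurable]: "(\<lambda>\<omega>. target n (b \<omega>) k) \<in> borel_measurable Q" for k
    unfolding target_def
  proof (rule M.borel_measurable_lebesgue_integral)
    have [measurable]: "(\<lambda>z. val (b (fst z)) (Suc n) (S (t (Suc n)) (snd z))) \<in> borel_measurable (Q \<Otimes>\<^sub>M M)"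
      using n by (intro val_measurable measurable_compose[OF measurable_fst b_meas]) auto
    show "(\<lambda>(p, \<omega>). val (b p) (Suc n) (S (t (Suc n)) \<omega>) *
        psi n k (S (t n) \<omega>)) \<in> borel_measurable (Q \<Otimes>\<^sub>M M)"
      unfolding split_beta' by measurable
  qed
  have [measurable]: "V \<in> borel_measurable Q"
    unfolding V_def g_def b_def[symmetric] norm_sq_def sample_mean_def fst_conv snd_conv
        by measurable
  have "err n \<le> (\<integral>\<^sup>+\<omega>. ennreal (2 * \<Lambda>\<^sup>2) * (ennreal (V \<omega>) + ennreal T * ennreal (D \<omega>)) \<partial>Q)"
    unfolding err_def
  proof (rule nn_integral_mono)
    fix \<omega>
    have "ennreal (norm_sq (\<lambda>k. estimate X \<omega> n k - exact n k)) \<le> ennreal (2 * \<Lambda>\<^sup>2 * (V \<omega> + T * D \<omega>))"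
      using pointwise[of \<omega>] by (intro ennreal_leI) (simp add: algebra_simps)
    also have "\<dots> = ennreal (2 * \<Lambda>\<^sup>2) * (ennreal (V \<omega>) + ennreal T * ennreal (D \<omega>))"
      using T V_nonneg[of \<omega>] D_nonneg[of \<omega>]
      by (subst ennreal_mult) (auto simp: ennreal_mult)
    finally show "ennreal (norm_sq (\<lambda>k. estimate X \<omega> n k - exact n k)) \<le>
        ennreal (2 * \<Lambda>\<^sup>2) * (ennreal (V \<omega>) + ennreal T * ennreal (D \<omega>))" .
  qed
  also have "\<dots> = ennreal (2 * \<Lambda>\<^sup>2) * ((\<integral>\<^sup>+\<omega>. ennreal (V \<omega>) \<partial>Q) + ennreal T * err (Suc n))"
    by (simp add: nn_integral_add nn_integral_cmult err_D)
  also have "\<dots> \<le> ennreal (2 * \<Lambda>\<^sup>2) * (ennreal (T * (1 + 2 * norm_sq \<beta>) / real N) +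
      ennreal (2 * T / real N) * err (Suc n) + ennreal T * err (Suc n))"
    by (intro mult_left_mono add_mono V_int) auto
  also have "\<dots> \<le>
      ennreal (2 * \<Lambda>\<^sup>2) * (ennreal (T * (1 + 2 * norm_sq \<beta>) / real N) + ennreal (3 * T) * err (Suc
          n))"
  proof -
    have "2 * T / real N + T \<le> 3 * T"
      using T N by (simp add: field_simps)
    hence "ennreal (2 * T / real N) * err (Suc n) + ennreal T * err (Suc n) \<le>
        ennreal (3 * T) * err (Suc n)"
      using T unfolding distrib_right[symmetric]
      by (intro mult_right_mono)
          (simp_all add: ennreal_plus[symmetric] ennreal_leI del: ennreal_plus)
    thus ?thesis
      unfolding add.assoc by (intro mult_left_mono add_left_mono) auto
  qed
  also have "\<dots> = ennreal (2 * (\<Lambda>\<^sup>2 * T)) * (ennreal ((1 + 2 * norm_sq \<beta>) / real N) + 3 *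
      err (Suc n))"
  proof -
    have "ennreal (T * (1 + 2 * norm_sq \<beta>) / real N) =
        ennreal T * ennreal ((1 + 2 * norm_sq \<beta>) / real N)"
      using T norm_sq_nonneg[of \<beta>] by (subst ennreal_mult[symmetric]) auto
    moreover have "ennreal (3 * T) = ennreal T * 3"
      using T by (simp add: ennreal_mult mult.commute)
    moreover have "ennreal (2 * (\<Lambda>\<^sup>2 * T)) = ennreal (2 * \<Lambda>\<^sup>2) * ennreal T"
      using T by (simp add: ennreal_mult[symmetric] mult.assoc)
    ultimately show ?thesis
      by (simp only: distrib_left mult.assoc)
  qed
  finally show ?thesis by (simp add: \<beta>_def)
qed

text \<open>With \<open>R = \<Lambda>\<^sup>2 T\<close>, \<open>exact_bound\<close> and the induction hypothesis turn the recursion into a factor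
  \<open>2 R (3 + 3) = 12 R\<close>, which is at most \<open>20 R\<close>.\<close>
lemma err_bound:
  assumes "1 \<le> n" "n \<le> m"
  shows "err n \<le> ennreal (1 / real N * (20 * (\<Lambda>\<^sup>2 * T)) ^ (m - n))"
  using assms
proof (induction "m - n" arbitrary: n)
  case 0
  hence "\<not> n < m" by simp
  thus ?case unfolding err_def norm_sq_def exact_def estimate_def by (simp only: if_False) simp
next
  case (Suc j)
  define R where "R = \<Lambda>\<^sup>2 * T"
  have R: "R \<ge> 1"
    using \<Lambda> T one_le_power[of \<Lambda> 2] mult_mono[of 1 "\<Lambda>\<^sup>2" 1 T] by (simp add: R_def)
  have n: "1 \<le> n" "n < m" using Suc by auto
  have j: "m - n = Suc j" "m - Suc n = j" using Suc by auto
  have IH: "err (Suc n) \<le> ennreal (1 / real N * (20 * R) ^ j)"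
    using Suc.hyps(1)[of "Suc n"] n j by (simp add: R_def)
  have ex: "norm_sq (exact (Suc n)) \<le> (20 * R) ^ j"
  proof -
    have "norm_sq (exact (Suc n)) \<le> (2 * R) ^ j"
      using exact_bound[of "Suc n"] n j by (simp add: R_def)
    also have "\<dots> \<le> (20 * R) ^ j"
      using R by (intro power_mono) auto
    finally show ?thesis .
  qed
  have one: "1 \<le> (20 * R) ^ j"
    using R by (intro one_le_power) auto
  have "err n \<le> ennreal (2 * R) * (ennreal ((1 + 2 * norm_sq (exact (Suc n))) / real N) + 3 *
      err (Suc n))"
    unfolding R_def by (rule err_rec[OF n])
  also have "\<dots> \<le>
      ennreal (2 * R) * (ennreal (3 * (20 * R) ^ j / real N) + 3 * ennreal (1 / real N * (20 * R)
          ^ j))"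
    using ex one by (intro mult_left_mono add_mono IH ennreal_leI divide_right_mono) auto
  also have "\<dots> = ennreal (2 * R * (3 * (20 * R) ^ j / real N + 3 * (1 / real N * (20 * R) ^ j)))"
  proof -
    define A where "A = (20 * R) ^ j / real N"
    have A: "A \<ge> 0" using R by (simp add: A_def)
    have a3: "0 \<le> 3 * A" and a6: "0 \<le> 3 * A + 3 * A" and r2: "0 \<le> 2 * R"
      using A R by simp_all
    have three: "3 * ennreal A = ennreal (3 * A)"
      using A by (simp add: ennreal_mult)
    have "ennreal (2 * R) * (ennreal (3 * A) + 3 * ennreal A) = ennreal (2 * R * (3 * A + 3 * A))"
      unfolding three ennreal_plus[OF a3 a3, symmetric] ennreal_mult[OF r2 a6, symmetric] ..
    thus ?thesis by (simp add: A_def)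
  qed
  also have "\<dots> \<le> ennreal (1 / real N * (20 * R) ^ Suc j)"
    using R by (intro ennreal_leI) (simp add: divide_right_mono)
  finally show ?case
    by (simp only: j R_def)
qed

lemma coeff_error_bound:
  assumes n: "1 \<le> n" "n < m"
  shows "(\<integral>\<^sup>+\<omega>. ennreal ((euclid_norm (exact_coeff P M S t m K h n -
      estimated_coeff P M S t m K N X \<omega> h n))\<^sup>2) \<partial>Q) \<le> ennreal (1 / real N * (20 * (\<Lambda>\<^sup>2 * T)) ^ (m -
          n))"
proof -
  have dim: "dim_row (gram_inv P M S K (t n)) = Suc K"
    using Ginv(1)[of n] n by (auto simp: Ginv_def)
  have "(euclid_norm (exact_coeff P M S t m K h n - estimated_coeff P M S t m K N X \<omega> h n))\<^sup>2 =
      norm_sq (\<lambda>k. estimate X \<omega> n k - exact n k)" for \<omega>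
  proof -
    have dims: "dim_vec (exact_coeff P M S t m K h n) = Suc K"
        "dim_vec (estimated_coeff P M S t m K N X \<omega> h n) = Suc K"
      by (simp_all add: exact_coeff_def estimated_coeff_def exact_regression_def
          estimated_regression_def Let_def dim)
    show ?thesis
      using n by (simp add: euclid_norm_def L2_set_def sum_nonneg dims norm_sq_def exact_def
          estimate_def
          lessThan_Suc_atMost power2_commute)
  qed
  thus ?thesis
    using err_bound[of n] n by (simp add: err_def)
qed

end

section \<open>The error bound\<close>

lemma finite_uniform_constant:
  fixes Pr :: "'i \<Rightarrow> real \<Rightarrow> bool"
  assumes "finite I" and "\<And>i. i \<in> I \<Longrightarrow> \<exists>c\<ge>1. Pr i c"
    and mono: "\<And>i c c'. Pr i c \<Longrightarrow> 1 \<le> c \<Longrightarrow> c \<le> c' \<Longrightarrow> Pr i c'"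
  shows "\<exists>c\<ge>1. \<forall>i\<in>I. Pr i c"
proof -
  obtain f where f: "\<And>i. i \<in> I \<Longrightarrow> 1 \<le> f i \<and> Pr i (f i)"
    using assms(2) by metis
  define c where "c = Max (insert 1 (f ` I))"
  have "1 \<le> c" "\<And>i. i \<in> I \<Longrightarrow> f i \<le> c"
    using assms(1) by (auto simp: c_def)
  thus ?thesis
    using f mono by blast
qed

lemma nn_integral_sum_squares_sq_le:
  fixes f :: "nat \<Rightarrow> 'a \<Rightarrow> real"
  assumes [measurable]: "\<And>k. f k \<in> borel_measurable M" and "0 \<le> \<tau>"
    and moment: "\<And>k. k \<le> K \<Longrightarrow> (\<integral>\<^sup>+x. ennreal (f k x ^ 4) \<partial>M) \<le> ennreal \<tau>"
  shows "(\<integral>\<^sup>+x. ennreal ((\<Sum>k\<le>K. (f k x)\<^sup>2)\<^sup>2) \<partial>M) \<le> ennreal (4 ^ K * \<tau>)"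
proof -
  define r where "r = real (Suc K)"
  have r: "0 \<le> r" "r \<le> 2 ^ K"
    unfolding r_def by (rule of_nat_0_le_iff, rule Suc_le_two_power)
  have card: "(\<Sum>k\<le>K. c) = r * c" for c :: real
    by (simp add: r_def)
  have "(\<integral>\<^sup>+x. ennreal ((\<Sum>k\<le>K. (f k x)\<^sup>2)\<^sup>2) \<partial>M) \<le>
      (\<integral>\<^sup>+x. ennreal r * (\<Sum>k\<le>K. ennreal (f k x ^ 4)) \<partial>M)"
  proof (rule nn_integral_mono)
    fix x
    have "(\<Sum>k\<le>K. 1 * (f k x)\<^sup>2)\<^sup>2 \<le> (\<Sum>k\<le>K. 1\<^sup>2) * (\<Sum>k\<le>K. ((f k x)\<^sup>2)\<^sup>2)"
      by (rule Cauchy_Schwarz_ineq_sum)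
    hence "(\<Sum>k\<le>K. (f k x)\<^sup>2)\<^sup>2 \<le> r * (\<Sum>k\<le>K. f k x ^ 4)"
      unfolding card by (simp add: power_mult[symmetric])
    hence "ennreal ((\<Sum>k\<le>K. (f k x)\<^sup>2)\<^sup>2) \<le> ennreal (r * (\<Sum>k\<le>K. f k x ^ 4))"
      by (rule ennreal_leI)
    also have "\<dots> = ennreal r * (\<Sum>k\<le>K. ennreal (f k x ^ 4))"
      using r by (simp add: ennreal_mult sum_nonneg)
    finally show "ennreal ((\<Sum>k\<le>K. (f k x)\<^sup>2)\<^sup>2) \<le> ennreal r * (\<Sum>k\<le>K. ennreal (f k x ^ 4))" .
  qed
  also have "\<dots> = ennreal r * (\<integral>\<^sup>+x. (\<Sum>k\<le>K. ennreal (f k x ^ 4)) \<partial>M)"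
    by (rule nn_integral_cmult) measurable
  also have "(\<integral>\<^sup>+x. (\<Sum>k\<le>K. ennreal (f k x ^ 4)) \<partial>M) = (\<Sum>k\<le>K. \<integral>\<^sup>+x. ennreal (f k x ^ 4) \<partial>M)"
    by (rule nn_integral_sum) measurable
  also have "ennreal r * \<dots> \<le> ennreal r * (\<Sum>k\<le>K. ennreal \<tau>)"
    by (intro mult_left_mono sum_mono moment) auto
  also have "(\<Sum>k\<le>K. ennreal \<tau>) = ennreal (\<Sum>k\<le>K. \<tau>)"
    using \<open>0 \<le> \<tau>\<close> by (intro sum_ennreal) auto
  also have "ennreal r * \<dots> = ennreal (r * (r * \<tau>))"
    unfolding card using r \<open>0 \<le> \<tau>\<close> by (intro ennreal_mult[symmetric]) auto
  also have "\<dots> \<le> ennreal (4 ^ K * \<tau>)"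
  proof (rule ennreal_leI)
    have "r * (r * \<tau>) \<le> 2 ^ K * (2 ^ K * \<tau>)"
      using r \<open>0 \<le> \<tau>\<close> by (intro mult_mono) auto
    also have "\<dots> = 4 ^ K * \<tau>"
      by (simp add: power_mult_distrib[symmetric] mult.assoc[symmetric])
    finally show "r * (r * \<tau>) \<le> 4 ^ K * \<tau>" .
  qed
  finally show ?thesis .
qed

text \<open>The powers of \<open>a\<close> in \<open>\<Lambda>\<^sup>2\<close> and \<open>T\<close> add up to \<open>4 e + 2 (2 + v)\<close> per unit of \<open>K\<close>; the geometric
  factors combine to \<open>4 \<rho>\<^sup>2 c\<^sup>3\<close>, and the factor 20 is absorbed into \<open>20\<^bsup>K\<^esup>\<close>.\<close>
lemma error_factor_le:
  fixes c \<rho> a :: real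
  assumes c: "1 \<le> c" and \<rho>: "1 \<le> \<rho>" and a: "1 \<le> a" and K: "1 \<le> K"
    and u: "4 * e + 2 * (2 + v) \<le> u" and j: "j \<le> m"
  shows "(20 * ((c ^ K * a ^ ((2 + v) * K))\<^sup>2 * ((4 * \<rho>\<^sup>2 * c) ^ K * a ^ (4 * e * K)))) ^ j
    \<le> ((80 * \<rho>\<^sup>2 * c ^ 3) ^ m) ^ K * a ^ ((j + 1) * u * K)"
proof -
  define E where "E = 4 * e + 2 * (2 + v)"
  define x where "x = 4 * \<rho>\<^sup>2 * c ^ 3"
  have "1 * 1 * 1 \<le> 4 * \<rho>\<^sup>2 * c ^ 3"
    using one_le_power[OF \<rho>, of 2] one_le_power[OF c, of 3] by (intro mult_mono) auto
  hence x: "1 \<le> x" by (simp add: x_def)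
  have c3: "c ^ K * c ^ K * c ^ K = (c ^ 3) ^ K"
    by (simp add: power_mult_distrib[symmetric] power3_eq_cube)
  have aE: "a ^ ((2 + v) * K) * a ^ ((2 + v) * K) * a ^ (4 * e * K) = a ^ (E * K)"
    unfolding power_add[symmetric]
        by (rule arg_cong[where f = "power a"]) (simp add: E_def algebra_simps)
  have "(c ^ K * a ^ ((2 + v) * K))\<^sup>2 * ((4 * \<rho>\<^sup>2 * c) ^ K * a ^ (4 * e * K)) =
      (c ^ K * c ^ K * c ^ K) * (4 * \<rho>\<^sup>2) ^ K * (a ^ ((2 + v) * K) * a ^ ((2 + v) * K) * a ^ (4 * e
          * K))"
    unfolding power_mult_distrib[of _ c] power2_eq_square[of "_ * _"] by (simp only: mult_ac)
  also have "\<dots> = x ^ K * a ^ (E * K)"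
    unfolding c3 aE x_def power_mult_distrib[of _ "c ^ 3"] by (simp only: mult_ac)
  finally have eq: "(c ^ K * a ^ ((2 + v) * K))\<^sup>2 * ((4 * \<rho>\<^sup>2 * c) ^ K * a ^ (4 * e * K)) =
      x ^ K * a ^ (E * K)" .
  have "E * K \<le> u * K"
    using u unfolding E_def by (rule mult_le_mono1)
  hence "a ^ (E * K) \<le> a ^ (u * K)"
    using a by (rule power_increasing)
  moreover have "20 \<le> (20::real) ^ K"
    using K self_le_power[of "20::real" K] by simp
  ultimately have "20 * (x ^ K * a ^ (E * K)) \<le> 20 ^ K * (x ^ K * a ^ (u * K))"
    using x a by (intro mult_mono[of 20] mult_left_mono) auto
  also have "\<dots> = (20 * x) ^ K * a ^ (u * K)"
    unfolding power_mult_distrib by (rule mult.assoc[symmetric])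
  finally have "(20 * (x ^ K * a ^ (E * K))) ^ j \<le> ((20 * x) ^ K * a ^ (u * K)) ^ j"
    using x a by (intro power_mono) simp_all
  also have "\<dots> = (20 * x) ^ (K * j) * a ^ (u * K * j)"
    by (simp only: power_mult_distrib[of "_ ^ _"] power_mult)
  also have "\<dots> \<le> (20 * x) ^ (m * K) * a ^ ((j + 1) * u * K)"
  proof (rule mult_mono)
    show "(20 * x) ^ (K * j) \<le> (20 * x) ^ (m * K)"
      using x j by (intro power_increasing) (simp_all add: mult.commute)
    show "a ^ (u * K * j) \<le> a ^ ((j + 1) * u * K)"
      using a by (intro power_increasing) (simp_all add: algebra_simps)
  qed (use x a in auto)
  also have "(20 * x) ^ (m * K) = ((80 * \<rho>\<^sup>2 * c ^ 3) ^ m) ^ K"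
    unfolding power_mult x_def by (simp add: mult.assoc[symmetric])
  finally show ?thesis
    unfolding eq .
qed

theorem theorem6:
  fixes P :: levy_model
    and M :: "'a measure"
    and S :: "real \<Rightarrow> 'a \<Rightarrow> real"
    and t :: "nat \<Rightarrow> real"
    and m :: nat
  assumes "valid_model P"
    and "model_process P M S"
    and "t 0 = 0"
    and "\<forall>n<m. t n < t (Suc n)"
  shows "\<exists>c::real. c > 0 \<and>
    (\<forall>(K::nat) (N::nat) (h::nat \<Rightarrow> real \<Rightarrow> real) (Q::'b measure)
       (X::nat \<Rightarrow> nat \<Rightarrow> nat \<Rightarrow> 'b \<Rightarrow> real).
       K \<ge> 1 \<longrightarrow> N \<ge> 1 \<longrightarrow>
       sample_paths M S t m N Q X \<longrightarrow>
       (\<forall>n<m. h n \<in> borel_measurable borel) \<longrightarrow>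
       (\<forall>n<m. growth_constraint P M S t m K h n) \<longrightarrow>
       (\<forall>n. 1 \<le> n \<and> n < m \<longrightarrow>
          (SUP \<beta> \<in> {\<beta> \<in> carrier_vec (Suc K). euclid_norm \<beta> = 1 \<and>
                     growth_constraint P M S t m K (with_final_payoff P t m K h \<beta>) m}.
             \<integral>\<^sup>+\<omega>. ennreal ((euclid_norm
                 (exact_coeff P M S t m K (with_final_payoff P t m K h \<beta>) n -
                  estimated_coeff P M S t m K N X \<omega> (with_final_payoff P t m K h \<beta>) n))\<^sup>2) \<partial>Q)
          \<le> ennreal (1 / real N * c ^ K * real K ^ ((m - n + 1) * growth_exponent P * K))))"
proof -
  have levy: "levy_process M S" and law: "\<And>s. s > 0 \<Longrightarrow> distr M borel (S s) = marginal_law P s"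
    using assms(2) by (auto simp: model_process_def)
  interpret M: prob_space M
    using levy by (simp add: levy_process_def)
  have S_meas: "S s \<in> borel_measurable M" if "s \<ge> 0" for s
    using levy that by (simp add: levy_process_def)
  have t_pos: "t n > 0" if "n \<in> {1..m}" for n
    using that
  proof (induction n)
    case (Suc n)
    thus ?case
      using assms(3,4) by (cases "n = 0") (force intro: less_trans)+
  qed simp
  have prob: "prob_space (marginal_law P s)" if "s > 0" for s
    using M.prob_space_distr[OF S_meas[of s]] law[OF that] that by simp
  have law_integral: "(\<integral>\<^sup>+x. f x \<partial>marginal_law P (t n)) = (\<integral>\<^sup>+\<omega>. f (S (t n) \<omega>) \<partial>M)"
    if "n \<in> {1..m}" "f \<in> borel_measurable borel" for n and f :: "real \<Rightarrow> ennreal"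
    unfolding law[OF t_pos[OF that(1)], symmetric]
    using t_pos[OF that(1)] that(2) by (intro nn_integral_distr S_meas) auto
  have psi_meas: "basis_fun P (t n) k \<in> borel_measurable borel" if "n \<in> {1..m}" for n k
    by (rule basis_fun_measurable[OF assms(1) t_pos[OF that]])
  define e where "e = degree_growth P"
  define v where "v = sampling_growth P"
  have "\<exists>c\<ge>1. \<forall>n\<in>{1..m}. \<forall>K\<ge>1. basis_bounds P (t n) K c"
  proof (rule finite_uniform_constant)
    show "\<exists>c\<ge>1. \<forall>K\<ge>1. basis_bounds P (t n) K c" if "n \<in> {1..m}" for n
      by (rule basis_bounds_at_date[OF assms(1) t_pos[OF that] prob])
  qed (auto intro: basis_bounds_mono)
  then obtain c0 where c0: "1 \<le> c0"
    and bounds: "\<And>n K. n \<in> {1..m} \<Longrightarrow> 1 \<le> K \<Longrightarrow> basis_bounds P (t n) K c0"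
    by blast
  have moment: "(\<integral>\<^sup>+\<omega>. ennreal (basis_fun P (t n) k (S (t n) \<omega>) ^ 4) \<partial>M) \<le>
      ennreal (c0 ^ K * real K ^ (4 * e * K))" if n: "n \<in> {1..m}" and K: "1 \<le> K" "k \<le> K" for n K k
  proof -
    note [measurable] = psi_meas[OF n]
    show ?thesis
      using bounds[OF n K(1)] K(2) unfolding basis_bounds_def e_def
      by (subst law_integral[OF n, symmetric]) auto
  qed
  have coercive: "ennreal (\<Sum>k\<le>K. (a k)\<^sup>2) \<le> ennreal (c0 ^ K * real K ^ ((2 + v) * K)) *
      (\<integral>\<^sup>+\<omega>. ennreal ((\<Sum>k\<le>K. a k * basis_fun P (t n) k (S (t n) \<omega>))\<^sup>2) \<partial>M)"
    if n: "n \<in> {1..m}" and K: "1 \<le> K" for n K a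
  proof -
    note [measurable] = psi_meas[OF n]
    show ?thesis
      using bounds[OF n K] unfolding basis_bounds_def v_def
      by (subst law_integral[OF n, symmetric]) auto
  qed
  define \<rho> where "\<rho> = Max (insert 1 ((\<lambda>\<nu>. t (Suc \<nu>) / t \<nu>) ` {1..<m}))"
  have \<rho>: "1 \<le> \<rho>" "\<And>\<nu>. \<nu> \<in> {1..<m} \<Longrightarrow> t (Suc \<nu>) / t \<nu> \<le> \<rho>"
    unfolding \<rho>_def by (intro Max_ge; simp)+
  \<comment> \<open>\<open>80 = 20 \<cdot> 4\<close>: the factor 20 of the error recursion, and \<open>4\<^bsup>K\<^esup> \<ge> (K + 1)\<^sup>2\<close> from passing from
     the basis functions to the norm of the basis vector.\<close>
  define c1 where "c1 = 80 * \<rho>\<^sup>2 * c0 ^ 3"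
  have "1 * 1 * 1 \<le> 80 * \<rho>\<^sup>2 * c0 ^ 3"
    using \<rho>(1) c0 one_le_power[OF \<rho>(1), of 2] one_le_power[OF c0, of 3] by (intro mult_mono) auto
  hence c1: "1 \<le> c1" by (simp add: c1_def)
  show ?thesis
  proof (intro exI[of _ "c1 ^ m"] conjI allI impI)
    show "0 < c1 ^ m" using c1 by simp
    fix K N :: nat and h :: "nat \<Rightarrow> real \<Rightarrow> real" and Q :: "'b measure"
      and X :: "nat \<Rightarrow> nat \<Rightarrow> nat \<Rightarrow> 'b \<Rightarrow> real" and n :: nat
    assume K: "1 \<le> K" and N: "1 \<le> N" and samples: "sample_paths M S t m N Q X"
      and h_meas: "\<forall>n<m. h n \<in> borel_measurable borel"
      and growth: "\<forall>n<m. growth_constraint P M S t m K h n"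
      and "1 \<le> n \<and> n < m"
    hence n: "1 \<le> n" "n < m" by auto
    define T where "T = (4 * \<rho>\<^sup>2 * c0) ^ K * real K ^ (4 * e * K)"
    define \<Lambda> where "\<Lambda> = c0 ^ K * real K ^ ((2 + v) * K)"
    have "1 * 1 * 1 \<le> 4 * \<rho>\<^sup>2 * c0"
      using \<rho>(1) c0 one_le_power[OF \<rho>(1), of 2] by (intro mult_mono) auto
    hence "1 * 1 \<le> T"
      unfolding T_def using K
          by (intro mult_mono one_le_power) (simp_all add: c0 order_trans[OF zero_le_one])
    hence T: "1 \<le> T" by simp
    have "1 * 1 \<le> \<Lambda>"
      unfolding \<Lambda>_def using K c0 by (intro mult_mono one_le_power) auto
    hence \<Lambda>: "1 \<le> \<Lambda>" by simp
    define \<tau> where "\<tau> = c0 ^ K * real K ^ (4 * e * K)"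
    have \<tau>: "0 \<le> \<tau>" using c0 by (simp add: \<tau>_def)
    have T_eq: "T = 4 ^ K * (\<rho> ^ (2 * K) * \<tau>)"
      unfolding T_def \<tau>_def power_mult[of \<rho> 2 K] power_mult_distrib by (simp only: mult_ac)
    have bound: "growth_bound P M S t m K \<le> ennreal (\<rho> ^ (2 * K)) * ennreal \<tau>"
      unfolding growth_bound_def
    proof (intro mult_mono ennreal_leI)
      show "Max ((\<lambda>\<nu>. (t (Suc \<nu>) / t \<nu>) ^ (2 * K)) ` {1..<m}) \<le> \<rho> ^ (2 * K)"
      proof (rule Max.boundedI)
        fix r assume "r \<in> (\<lambda>\<nu>. (t (Suc \<nu>) / t \<nu>) ^ (2 * K)) ` {1..<m}"
        then obtain \<nu> where \<nu>: "\<nu> \<in> {1..<m}" "r = (t (Suc \<nu>) / t \<nu>) ^ (2 * K)" by auto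
        have "t (Suc \<nu>) > 0" "t \<nu> > 0" using \<nu> by (auto intro!: t_pos)
        thus "r \<le> \<rho> ^ (2 * K)"
          unfolding \<nu>(2) using \<rho>(2)[OF \<nu>(1)] by (intro power_mono) auto
      qed (use n in auto)
      show "Max ((\<lambda>(\<nu>, k). fourth_moment M (\<lambda>\<omega>. basis_fun P (t \<nu>) k (S (t \<nu>) \<omega>))) ` ({1..m} \<times> {0..K})) \<le> ennreal \<tau>"
      proof (rule Max.boundedI)
        fix r assume "r \<in> (\<lambda>(\<nu>, k). fourth_moment M (\<lambda>\<omega>. basis_fun P (t \<nu>) k (S (t \<nu>) \<omega>))) ` ({1..m} \<times> {0..K})"
        thus "r \<le> ennreal \<tau>"
          using moment K by (auto simp: fourth_moment_def \<tau>_def)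
      qed (use n in auto)
    qed auto
    have growth_le: "fourth_moment M (\<lambda>\<omega>. g (S (t n) \<omega>)) \<le> ennreal T"
      if "fourth_moment M (\<lambda>\<omega>. g (S (t n) \<omega>)) \<le> growth_bound P M S t m K" for g n
    proof -
      have "growth_bound P M S t m K \<le> ennreal (\<rho> ^ (2 * K)) * ennreal \<tau>"
        by (rule bound)
      also have "\<dots> = ennreal (\<rho> ^ (2 * K) * \<tau>)"
        using \<tau> \<rho> by (simp add: ennreal_mult)
      also have "\<dots> \<le> ennreal T"
        unfolding T_eq using \<tau> \<rho>(1) mult_right_mono[of 1 "4 ^ K" "\<rho> ^ (2 * K) * \<tau>"]
        by (intro ennreal_leI) (simp add: one_le_power)
      finally show ?thesis
        using that by (rule order_trans[rotated])
    qed
    show "(SUP \<beta> \<in> {\<beta> \<in> carrier_vec (Suc K). euclid_norm \<beta> = 1 \<and>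
                     growth_constraint P M S t m K (with_final_payoff P t m K h \<beta>) m}.
             \<integral>\<^sup>+\<omega>. ennreal ((euclid_norm
                 (exact_coeff P M S t m K (with_final_payoff P t m K h \<beta>) n -
                  estimated_coeff P M S t m K N X \<omega> (with_final_payoff P t m K h \<beta>) n))\<^sup>2) \<partial>Q)
          \<le> ennreal (1 / real N * (c1 ^ m) ^ K * real K ^ ((m - n + 1) * growth_exponent P * K))"
      (is "(SUP \<beta> \<in> ?B. ?err \<beta>) \<le> ?bound")
    proof (rule SUP_least)
      fix \<beta> assume "\<beta> \<in> ?B"
      hence growth_m: "growth_constraint P M S t m K (with_final_payoff P t m K h \<beta>) m"
        by simp
      define g where "g = with_final_payoff P t m K h \<beta>"
      have g_meas: "g n \<in> borel_measurable borel" if "n \<in> {1..m}" for n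
      proof (cases "n = m")
        case True
        have [measurable]: "basis_fun P (t m) k \<in> borel_measurable borel" for k
          using that True by (intro psi_meas) auto
        have "g m = (\<lambda>x. \<Sum>k\<le>K. vec_index \<beta> k * basis_fun P (t m) k x)"
          by (simp add: g_def with_final_payoff_def scalar_prod_def basis_vec_def atLeast0LessThan
              lessThan_Suc_atMost)
        thus ?thesis using True by simp
      next
        case False
        thus ?thesis using that h_meas by (simp add: g_def with_final_payoff_def)
      qed
      have g_growth: "fourth_moment M (\<lambda>\<omega>. g n (S (t n) \<omega>)) \<le> ennreal T" if "n \<in> {1..m}" for n
      proof (rule growth_le)
        show "fourth_moment M (\<lambda>\<omega>. g n (S (t n) \<omega>)) \<le> growth_bound P M S t m K"
        proof (cases "n = m")
          case True
          thus ?thesis using growth_m by (simp add: growth_constraint_def g_def)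
        next
          case False
          hence "g n = h n" "n < m"
            using that by (simp_all add: g_def with_final_payoff_def)
          thus ?thesis using growth by (simp add: growth_constraint_def)
        qed
      qed
      have psi_moment: "(\<integral>\<^sup>+\<omega>. ennreal ((\<Sum>k\<le>K. (basis_fun P (t n) k (S (t n) \<omega>))\<^sup>2)\<^sup>2) \<partial>M) \<le> ennreal T"
        if n: "n \<in> {1..m}" for n
      proof -
        have [measurable]: "S (t n) \<in> borel_measurable M"
          using t_pos[OF n] by (intro S_meas) simp
        note [measurable] = psi_meas[OF n]
        have "(\<integral>\<^sup>+\<omega>. ennreal ((\<Sum>k\<le>K. (basis_fun P (t n) k (S (t n) \<omega>))\<^sup>2)\<^sup>2) \<partial>M) \<le> ennreal (4 ^ K * \<tau>)"
          using moment[OF n K] \<tau> by (intro nn_integral_sum_squares_sq_le) (auto simp: \<tau>_def)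
        also have "\<dots> \<le> ennreal T"
          unfolding T_eq using \<tau> mult_right_mono[OF one_le_power[OF \<rho>(1), of "2 * K"] \<tau>]
          by (intro ennreal_leI mult_left_mono) auto
        finally show ?thesis .
      qed
      have "prob_space Q"
        using samples by (simp add: sample_paths_def)
      then interpret ls_setup M Q P S t m K N g X \<Lambda> T
      proof (intro ls_setup.intro ls_setup_axioms.intro M.prob_space_axioms N \<Lambda> T samples g_meas
          psi_meas psi_moment)
        show "S (t n) \<in> borel_measurable M" if "n \<in> {1..m}" for n
          using t_pos[OF that] by (intro S_meas) simp
        show "(\<integral>\<^sup>+\<omega>. ennreal (g n (S (t n) \<omega>) ^ 4) \<partial>M) \<le> ennreal T" if "n \<in> {1..m}" for n
          using g_growth[OF that] by (simp add: fourth_moment_def)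
        show "ennreal (\<Sum>k\<le>K. (a k)\<^sup>2) \<le> ennreal \<Lambda> *
          (\<integral>\<^sup>+\<omega>. ennreal ((\<Sum>k\<le>K. a k * basis_fun P (t n) k (S (t n) \<omega>))\<^sup>2) \<partial>M)" if "n \<in>
              {1..m}" for n a
          unfolding \<Lambda>_def by (rule coercive[OF that K])
      qed
      have power_le: "(20 * (\<Lambda>\<^sup>2 * T)) ^ (m - n) \<le>
          (c1 ^ m) ^ K * real K ^ ((m - n + 1) * growth_exponent P * K)"
        unfolding \<Lambda>_def T_def c1_def
        by (rule error_factor_le[OF c0 \<rho>(1) _ K])
            (use K growth_exponent_ge[of P] in \<open>auto simp: e_def v_def\<close>)
      have "?err \<beta> \<le> ennreal (1 / real N * (20 * (\<Lambda>\<^sup>2 * T)) ^ (m - n))"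
        using coeff_error_bound[OF n] by (simp only: g_def)
      also have "\<dots> \<le>
          ennreal (1 / real N * ((c1 ^ m) ^ K * real K ^ ((m - n + 1) * growth_exponent P * K)))"
        by (intro ennreal_leI mult_left_mono power_le) simp
      finally show "?err \<beta> \<le> ?bound"
        by (simp only: mult.assoc)
    qed
  qed
qed

end
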